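(* Let $\varphi$ be a plurisubharmonic function on $\mathbb C^n$ satisfying $$\sqrt{-1}\,\partial\overline\partial\varphi\ge\varepsilon\,\omega$$ (in the sense of currents) for some constant $\varepsilon>0$, where $\omega=\frac{\sqrt{-1}}2\partial\overline\partial|z|^2$ is the standard Kähler form on $\mathbb C^n$. Then every (possibly singular) algebraic hypersurface $W$ in $\mathbb C^n$ has vanishing upper density with respect to $\varphi$, i.e. $D_\varphi(W)=0$.
   Context: Let $B(z,r)$ be the Euclidean ball in $\mathbb C^n$ with center $z$ and radius $r$. For a (possibly singular) analytic hypersurface $W\subset\mathbb C^n$ with current of integration $[W]$, and for $r>0$, define the $(1,1)$-current $$\Upsilon_r^W:=[W]*\frac{\mathbf 1_{B(0,r)}}{\mathrm{Vol}(B(0,r))},$$ where $\mathbf 1_E$ is the characteristic function of $E$ and $*$ is convolution (so $\Upsilon_r^W(z)$ is the average of $[W]$ over $B(z,r)$). For a plurisubharmonic function $\varphi$ on $\mathbb C^n$ set $\varphi_r:=\varphi*\frac{\mathbf 1_{B(0,r)}}{\mathrm{Vol}(B(0,r))}$. The upper density of $W$ with respect to $\varphi$ is $$D_\varphi(W):=\inf\Big\{\alpha\in(0,\infty]:\ \frac{\sqrt{-1}}{2\pi}\partial\overline\partial\varphi_r-\frac1\alpha\Upsilon_r^W\ge0\ \text{ for all sufficiently large } r\Big\},$$ where $\ge 0$ means positivity in the sense of $(1,1)$-currents. *)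

theory Defs
  imports "HOL-Analysis.Analysis"
begin

section \<open>Plurisubharmonic functions\<close>

text \<open>Integral of an extended real function as positive part minus negative part (the coercion
  \<open>e2ennreal\<close> sends negative values to 0). It is only used for functions bounded above on a
  probability space, where the positive part is finite and the value lies in \<open>[-\<infinity>, \<infinity>)\<close>.\<close>

definition ereal_integral :: "'a measure \<Rightarrow> ('a \<Rightarrow> ereal) \<Rightarrow> ereal" where
  "ereal_integral M f =
     enn2ereal (\<integral>\<^sup>+ x. e2ennreal (f x) \<partial>M) - enn2ereal (\<integral>\<^sup>+ x. e2ennreal (- f x) \<partial>M)"

text \<open>Upper semicontinuous, with values in \<open>[-\<infinity>, \<infinity>)\<close>, not identically \<open>-\<infinity>\<close>, and satisfying the
  sub-mean value inequality on every circle of every complex line.\<close>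

definition plurisubharmonic :: "(complex ^ 'n \<Rightarrow> ereal) \<Rightarrow> bool" where
  "plurisubharmonic \<phi> \<longleftrightarrow>
     (\<forall>z. \<phi> z < \<infinity>) \<and> (\<exists>z. \<phi> z \<noteq> - \<infinity>) \<and>
     (\<forall>c. open {z. \<phi> z < c}) \<and>
     (\<forall>a b. \<phi> a \<le>
        ereal_integral (uniform_measure lborel {0..2*pi}) (\<lambda>\<theta>. \<phi> (a + cis \<theta> *s b)))"


section \<open>Differential forms\<close>

text \<open>A complex-valued \<open>k\<close>-form on \<open>\<complex>\<^sup>n\<close> is a function \<open>\<eta>\<close> such that \<open>\<eta> z\<close>, applied to a list
  of \<open>k\<close> tangent vectors, is alternating and multilinear over the reals. Values on lists of
  other lengths are irrelevant. The wedge product is normalised so that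
  \<open>(dx \<and> dy)(e, \<i> e) = 1\<close> for \<open>e\<close> the unit vector.\<close>

type_synonym 'n form = "complex ^ 'n \<Rightarrow> (complex ^ 'n) list \<Rightarrow> complex"

definition alternating_multilinear :: "nat \<Rightarrow> ((complex ^ 'n) list \<Rightarrow> complex) \<Rightarrow> bool" where
  "alternating_multilinear k a \<longleftrightarrow>
     (\<forall>vs i. length vs = k \<and> i < k \<longrightarrow> linear (\<lambda>v. a (vs[i := v]))) \<and>
     (\<forall>vs i j. length vs = k \<and> i < j \<and> j < k \<and> vs ! i = vs ! j \<longrightarrow> a vs = 0)"

text \<open>A star marks complex conjugates in comments: \<open>z*\<close>, \<open>dz*\<close>, and \<open>\<partial>*\<close> for del-bar.\<close>

text \<open>A \<open>(p+q)\<close>-covector is of type \<open>(p,q)\<close>, i.e. a combination of the \<open>dz\<^sub>I \<and> dz*\<^sub>J\<close> with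
  \<open>|I| = p\<close> and \<open>|J| = q\<close>, iff complex scalars \<open>c\<close> act on it with weight \<open>c\<^sup>p (cnj c)\<^sup>q\<close>.\<close>

definition of_type :: "nat \<Rightarrow> nat \<Rightarrow> ((complex ^ 'n) list \<Rightarrow> complex) \<Rightarrow> bool" where
  "of_type p q a \<longleftrightarrow> alternating_multilinear (p + q) a \<and>
     (\<forall>c vs. length vs = p + q \<longrightarrow> a (map (\<lambda>v. c *s v) vs) = c ^ p * cnj c ^ q * a vs)"

primrec C_k :: "nat \<Rightarrow> ('a::real_normed_vector \<Rightarrow> 'b::real_normed_vector) \<Rightarrow> bool" where
  "C_k 0 f \<longleftrightarrow> continuous_on UNIV f"
| "C_k (Suc k) f \<longleftrightarrow>
     (\<forall>x. f differentiable (at x)) \<and> (\<forall>v. C_k k (\<lambda>x. frechet_derivative f (at x) v))"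

definition test_form :: "nat \<Rightarrow> nat \<Rightarrow> ('n::finite) form \<Rightarrow> bool" where
  "test_form p q \<eta> \<longleftrightarrow>
     (\<forall>z. of_type p q (\<eta> z)) \<and>
     (\<forall>vs. length vs = p + q \<longrightarrow> (\<forall>k. C_k k (\<lambda>z. \<eta> z vs))) \<and>
     (\<exists>K. compact K \<and> (\<forall>z vs. z \<notin> K \<longrightarrow> length vs = p + q \<longrightarrow> \<eta> z vs = 0))"

text \<open>\<open>\<partial>f(v)\<close> and \<open>\<partial>*f(v)\<close> for a function \<open>f\<close>: the complex linear and the conjugate linear part
  of the real differential.\<close>

definition del_fun :: "(complex ^ 'n \<Rightarrow> complex) \<Rightarrow> complex ^ 'n \<Rightarrow> complex ^ 'n \<Rightarrow> complex" where
  "del_fun f z v = (frechet_derivative f (at z) v - \<i> * frechet_derivative f (at z) (\<i> *s v)) / 2"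

definition delbar_fun :: "(complex ^ 'n \<Rightarrow> complex) \<Rightarrow> complex ^ 'n \<Rightarrow> complex ^ 'n \<Rightarrow> complex" where
  "delbar_fun f z v = (frechet_derivative f (at z) v + \<i> * frechet_derivative f (at z) (\<i> *s v)) / 2"

definition remove_nth :: "nat \<Rightarrow> 'a list \<Rightarrow> 'a list" where
  "remove_nth i xs = take i xs @ drop (Suc i) xs"

text \<open>\<open>\<partial>\<eta> = \<Sum>\<^sub>j dz\<^sub>j \<and> \<partial>\<eta>/\<partial>z\<^sub>j\<close> and \<open>\<partial>*\<eta> = \<Sum>\<^sub>j dz*\<^sub>j \<and> \<partial>\<eta>/\<partial>z*\<^sub>j\<close>, evaluated on vectors.\<close>

definition del :: "('n::finite) form \<Rightarrow> 'n form" where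
  "del \<eta> z vs =
     (\<Sum>i<length vs. (- 1) ^ i * del_fun (\<lambda>x. \<eta> x (remove_nth i vs)) z (vs ! i))"

definition delbar :: "('n::finite) form \<Rightarrow> 'n form" where
  "delbar \<eta> z vs =
     (\<Sum>i<length vs. (- 1) ^ i * delbar_fun (\<lambda>x. \<eta> x (remove_nth i vs)) z (vs ! i))"

text \<open>The real frame \<open>w\<^sub>1, \<i> w\<^sub>1, w\<^sub>2, \<i> w\<^sub>2, \<dots>\<close>, positively oriented for the complex orientation
  of the span when the \<open>w\<^sub>j\<close> are linearly independent over the complex numbers.\<close>

definition complex_frame :: "(complex ^ 'n) list \<Rightarrow> (complex ^ 'n) list" where
  "complex_frame ws = concat (map (\<lambda>w. [w, \<i> *s w]) ws)"

definition standard_frame :: "(complex ^ 'n) list" where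
  "standard_frame =
     complex_frame (map (\<lambda>j. axis j 1) (SOME js. distinct js \<and> set js = (UNIV :: 'n set)))"

text \<open>A \<open>(p,p)\<close>-covector is positive if its restriction to every \<open>p\<close>-dimensional complex subspace
  is a nonnegative multiple of the orientation.\<close>

definition positive_covector :: "nat \<Rightarrow> ((complex ^ 'n) list \<Rightarrow> complex) \<Rightarrow> bool" where
  "positive_covector p a \<longleftrightarrow> (\<forall>ws. length ws = p \<longrightarrow> a (complex_frame ws) \<in> \<real>\<^sub>\<ge>\<^sub>0)"


section \<open>Currents of bidegree (1,1)\<close>

text \<open>A \<open>(1,1)\<close>-current acts on test forms of bidegree \<open>(n-1,n-1)\<close>.\<close>

type_synonym 'n current = "'n form \<Rightarrow> complex"

text \<open>Positive covectors of type \<open>(n-1,n-1)\<close> are the same as strongly positive ones, so for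
  \<open>(1,1)\<close>-currents the weak and the strong notion of positivity agree.\<close>

definition positive_current :: "('n::finite) current \<Rightarrow> bool" where
  "positive_current T \<longleftrightarrow>
     (\<forall>\<eta>. test_form (CARD('n) - 1) (CARD('n) - 1) \<eta> \<and>
          (\<forall>z. positive_covector (CARD('n) - 1) (\<eta> z)) \<longrightarrow> T \<eta> \<in> \<real>\<^sub>\<ge>\<^sub>0)"

text \<open>\<open>\<partial>\<partial>*u\<close> for a locally integrable \<open>u\<close>: the pairing with \<open>\<eta>\<close> is the integral over \<open>\<complex>\<^sup>n\<close> of the
  top degree form \<open>u \<partial>\<partial>*\<eta>\<close>.\<close>

definition del_delbar_current :: "(complex ^ 'n \<Rightarrow> real) \<Rightarrow> 'n current" where
  "del_delbar_current u \<eta> =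
     (LINT z|lborel. complex_of_real (u z) * del (delbar \<eta>) z standard_frame)"

definition kaehler_current :: "('n::finite) current" where
  "kaehler_current \<eta> = \<i> / 2 * del_delbar_current (\<lambda>z. (norm z)\<^sup>2) \<eta>"


section \<open>Averages over balls\<close>

text \<open>Convolution with \<open>1\<^bsub>B(0,r)\<^esub> / Vol(B(0,r))\<close>.\<close>

definition ball_average ::
  "real \<Rightarrow> (complex ^ 'n \<Rightarrow> 'b::{banach, second_countable_topology}) \<Rightarrow> complex ^ 'n \<Rightarrow> 'b" where
  "ball_average r u z =
     (LINT w|lborel. (indicat_real (ball 0 r) (z - w) / measure lborel (ball (0 :: complex ^ 'n) r)) *\<^sub>R u w)"

text \<open>The kernel is even, so convolving a current with it means convolving the coefficients of
  the test form with it.\<close>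

definition ball_average_current :: "real \<Rightarrow> ('n::finite) current \<Rightarrow> 'n current" where
  "ball_average_current r T \<eta> = T (\<lambda>z vs. ball_average r (\<lambda>w. \<eta> w vs) z)"


section \<open>Hausdorff measure\<close>

text \<open>Normalised so that \<open>d\<close>-dimensional Hausdorff measure is Lebesgue measure on Euclidean
  \<open>d\<close>-space and counting measure for \<open>d = 0\<close>. Unbounded covering sets are excluded explicitly,
  as \<open>diameter\<close> is 0 for them.\<close>

definition hausdorff_premeasure :: "nat \<Rightarrow> real \<Rightarrow> 'a::metric_space set \<Rightarrow> ennreal" where
  "hausdorff_premeasure d \<delta> A =
     Inf {(\<Sum>i. if C i = {} then 0
                else ennreal (unit_ball_vol (real d) * (diameter (C i) / 2) ^ d)) | C :: nat \<Rightarrow> 'a set.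
          A \<subseteq> (\<Union>i. C i) \<and> (\<forall>i. bounded (C i) \<and> diameter (C i) \<le> \<delta>)}"

definition hausdorff_measure :: "nat \<Rightarrow> 'a::metric_space measure" where
  "hausdorff_measure d =
     measure_of UNIV (sets borel) (\<lambda>A. SUP \<delta>\<in>{0<..}. hausdorff_premeasure d \<delta> A)"


section \<open>Hypersurfaces and their currents of integration\<close>

definition polynomial_map :: "(complex ^ 'n \<Rightarrow> complex) \<Rightarrow> bool" where
  "polynomial_map P \<longleftrightarrow>
     (\<exists>(S :: ('n \<Rightarrow> nat) set) c. finite S \<and> (\<forall>z. P z = (\<Sum>m\<in>S. c m * (\<Prod>i\<in>UNIV. (z $ i) ^ m i))))"

definition algebraic_hypersurface :: "(complex ^ 'n) set \<Rightarrow> bool" where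
  "algebraic_hypersurface W \<longleftrightarrow>
     (\<exists>P. polynomial_map P \<and> \<not> P constant_on UNIV \<and> W = {z. P z = 0})"

definition holomorphic_at :: "(complex ^ 'n \<Rightarrow> complex) \<Rightarrow> complex ^ 'n \<Rightarrow> bool" where
  "holomorphic_at g z \<longleftrightarrow> g differentiable (at z) \<and>
     (\<forall>c v. frechet_derivative g (at z) (c *s v) = c * frechet_derivative g (at z) v)"

text \<open>\<open>g\<close> is a holomorphic defining function of \<open>W\<close> on the neighbourhood \<open>U\<close> of \<open>p\<close>, with nonzero
  differential at \<open>p\<close>.\<close>

definition submersive_equation ::
  "(complex ^ 'n) set \<Rightarrow> complex ^ 'n \<Rightarrow> (complex ^ 'n) set \<Rightarrow> (complex ^ 'n \<Rightarrow> complex) \<Rightarrow> bool" where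
  "submersive_equation W p U g \<longleftrightarrow>
     open U \<and> p \<in> U \<and> (\<forall>z\<in>U. holomorphic_at g z) \<and>
     W \<inter> U = {z \<in> U. g z = 0} \<and> (\<exists>v. frechet_derivative g (at p) v \<noteq> 0)"

text \<open>The points near which \<open>W\<close> is a complex submanifold of codimension one.\<close>

definition regular_part :: "(complex ^ 'n) set \<Rightarrow> (complex ^ 'n) set" where
  "regular_part W = {p \<in> W. \<exists>U g. submersive_equation W p U g}"

text \<open>The kernel of the differential of a defining function; it does not depend on the choice
  of that function.\<close>

definition tangent_space :: "(complex ^ 'n) set \<Rightarrow> complex ^ 'n \<Rightarrow> (complex ^ 'n) set" where
  "tangent_space W p =
     {v. \<exists>U g. submersive_equation W p U g \<and> frechet_derivative g (at p) v = 0}"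

definition unitary_list :: "(complex ^ 'n) list \<Rightarrow> bool" where
  "unitary_list us \<longleftrightarrow>
     (\<forall>i<length us. \<forall>j<length us. (\<Sum>k\<in>UNIV. us ! i $ k * cnj (us ! j $ k)) = of_bool (i = j))"

definition tangent_frame :: "(complex ^ 'n) set \<Rightarrow> complex ^ 'n \<Rightarrow> (complex ^ 'n) list" where
  "tangent_frame W p = complex_frame
     (SOME us. length us = CARD('n) - 1 \<and> unitary_list us \<and> set us \<subseteq> tangent_space W p)"

text \<open>Integration over the regular part: the integral of a \<open>(2n-2)\<close>-form over the oriented manifold
  \<open>regular_part W\<close> is the integral, for the Riemannian volume (which is the Hausdorff
  measure), of its value on a positively oriented orthonormal tangent frame. This value does
  not depend on the frame.\<close>

definition integration_current :: "(complex ^ 'n) set \<Rightarrow> 'n current" where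
  "integration_current W \<eta> =
     (LINT z:regular_part W|hausdorff_measure (2 * (CARD('n) - 1)). \<eta> z (tangent_frame W z))"


section \<open>Upper density\<close>

definition Upsilon :: "real \<Rightarrow> (complex ^ 'n) set \<Rightarrow> 'n current" where
  "Upsilon r W = ball_average_current r (integration_current W)"

text \<open>A plurisubharmonic function is finite almost everywhere, so the value 0 which
  \<open>real_of_ereal\<close> assigns at \<open>-\<infinity>\<close> affects neither its averages nor its current. For \<open>\<alpha> = \<infinity>\<close>
  the coefficient \<open>1/\<alpha>\<close> is 0.\<close>

definition upper_density :: "(complex ^ 'n \<Rightarrow> ereal) \<Rightarrow> (complex ^ 'n) set \<Rightarrow> ennreal" where
  "upper_density \<phi> W = Inf {\<alpha>. 0 < \<alpha> \<and>
     (\<forall>\<^sub>F r in at_top. positive_current (\<lambda>\<eta>.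
        \<i> / complex_of_real (2 * pi) *
          del_delbar_current (ball_average r (\<lambda>z. real_of_ereal (\<phi> z))) \<eta>
        - complex_of_real (enn2real (1 / \<alpha>)) * Upsilon r W \<eta>))}"

end

theory Submission
  imports Defs "HOL-Complex_Analysis.Conformal_Mappings"
begin

text \<open>Why the density vanishes. Averaging over balls of radius \<open>r\<close> commutes with differentiation and
leaves the Kaehler form \<open>\<omega>\<close> unchanged, so the averaged function still has
\<open>\<i>/(2\<pi>) \<partial>\<partial>*\<phi>\<^sub>r \<ge> \<epsilon>/(2\<pi>) \<omega>\<close>. On the other hand the mass of the averaged current of \<open>W\<close> at \<open>z\<close> is
the area of \<open>W\<close> in the ball \<open>B(z,r)\<close> divided by the volume of the ball. The area of an algebraic
hypersurface grows at most like \<open>r\<^bsup>2n-2\<^esup>\<close>, uniformly in \<open>z\<close>, and the volume grows like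
\<open>r\<^bsup>2n\<^esup>\<close>; hence the averaged current is at most \<open>C/r\<^sup>2 \<omega>\<close>. For every \<open>\<alpha> > 0\<close> the difference
defining the density is therefore positive as soon as \<open>r\<close> is large.

The area bound (\<open>zero_set_area_growth\<close>) is obtained from the degree alone. Separated points of
\<open>W\<close> are counted by means of lines:
by \<open>zeros_on_nearby_lines\<close> a point of \<open>W\<close> forces zeros on all nearby parallel lines in one of
finitely many directions, with constants depending only on the degree, while a line that is not
contained in \<open>W\<close> meets it in at most \<open>deg P\<close> points. Comparing volumes (\<open>packing\<close>) gives at most
\<open>C (r/\<delta>)\<^bsup>2n-2\<^esup>\<close> points with mutual distance at least \<open>\<delta>\<close> in a ball of radius \<open>r\<close>, and the balls around
a maximal such set bound the Hausdorff measure.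

On the analytic side everything is moved to the test form \<open>\<eta>\<close>: the average of a test form is again a
positive test form (\<open>test_form_average\<close>), and averages pass from \<open>\<phi>\<close> to \<open>\<eta>\<close> by duality
(\<open>del_delbar_current_average\<close>), which requires that \<open>\<phi>\<close> be locally integrable
(\<open>psh_loc_integrable\<close>). Two facts then compare the currents. The Kaehler current is the integral of
the trace of the form (\<open>kaehler_current_trace\<close>), and the value of a positive covector on a unitary
frame is at most a constant times its trace (\<open>positive_alternating.frame_mass_le_trace\<close>), which with the
area bound yields \<open>Upsilon_le_trace\<close>.\<close>

section \<open>Polynomials in one variable\<close>

text \<open>This one estimate supplies all the quantitative information about polynomials used below: on a
finite-dimensional space of polynomials all norms are equivalent, and Lagrange interpolation makes
the constant explicit, so that it is the same for all polynomials of a given degree.\<close>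

lemma lagrange_bound:
  fixes p :: "complex poly"
  assumes fin: "finite A" and card: "card A = Suc D" and deg: "degree p \<le> D"
    and g: "0 < g" "\<And>a b. a \<in> A \<Longrightarrow> b \<in> A \<Longrightarrow> a \<noteq> b \<Longrightarrow> g \<le> cmod (a - b)"
    and R: "\<And>a. a \<in> A \<Longrightarrow> cmod (x - a) \<le> R"
    and M: "\<And>a. a \<in> A \<Longrightarrow> cmod (poly p a) \<le> M"
  shows "cmod (poly p x) \<le> real (Suc D) * (R / g) ^ D * M"
proof -
  define l where "l a = (\<Prod>b\<in>A - {a}. smult (1 / (a - b)) [:- b, 1:])" for a
  have poly_l: "poly (l a) y = (\<Prod>b\<in>A - {a}. (y - b) / (a - b))" for a y
    by (simp add: l_def poly_prod diff_divide_distrib)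
  have deg_l: "degree (l a) \<le> D" if "a \<in> A" for a
  proof -
    have "degree (l a) \<le> (\<Sum>b\<in>A - {a}. degree (smult (1 / (a - b)) [:- b, 1:]))"
      unfolding l_def by (rule degree_prod_sum_le[unfolded o_def]) (use fin in auto)
    also have "\<dots> \<le> (\<Sum>b\<in>A - {a}. 1)"
      by (intro sum_mono) simp
    also have "\<dots> = D" using that fin card by simp
    finally show ?thesis .
  qed
  define q where "q = (\<Sum>a\<in>A. smult (poly p a) (l a))"
  have "p = q"
  proof (rule poly_eqI_degree)
    fix y assume y: "y \<in> A"
    have "poly (l a) y = of_bool (a = y)" if "a \<in> A" for a
    proof (cases "a = y")
      case True
      have "(y - b) / (a - b) = 1" if "b \<in> A - {a}" for b using that True by auto
      then show ?thesis unfolding poly_l using True by simp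
    next
      case False
      then have "y \<in> A - {a}" using y by auto
      then show ?thesis unfolding poly_l using False fin by (auto intro!: prod_zero)
    qed
    then have "poly q y = (\<Sum>a\<in>A. poly p a * of_bool (a = y))"
      unfolding q_def poly_sum by (intro sum.cong) auto
    also have "\<dots> = poly p y"
      using y fin by (simp add: of_bool_def if_distrib[of "\<lambda>x. _ * x"] sum.delta' cong: if_cong)
    finally show "poly p y = poly q y" by simp
  next
    show "degree p < card A" using deg card by simp
    have "degree q \<le> D" unfolding q_def
      by (intro degree_sum_le) (use fin deg_l in \<open>auto intro: order_trans[OF degree_smult_le]\<close>)
    then show "degree q < card A" using card by simp
  qed
  then have "poly p x = (\<Sum>a\<in>A. poly p a * poly (l a) x)"
    by (metis (no_types, lifting) poly_smult poly_sum q_def sum.cong)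
  also have "cmod \<dots> \<le> (\<Sum>a\<in>A. M * (R / g) ^ D)"
  proof (rule order_trans[OF norm_sum], rule sum_mono)
    fix a assume a: "a \<in> A"
    have "cmod (poly (l a) x) = (\<Prod>b\<in>A - {a}. cmod (x - b) / cmod (a - b))"
      by (simp add: poly_l prod_norm[symmetric] norm_divide)
    also have "\<dots> \<le> (\<Prod>b\<in>A - {a}. R / g)"
      by (intro prod_mono conjI frac_le divide_nonneg_nonneg)
        (use R g a in \<open>auto intro: order_trans[OF norm_ge_zero]\<close>)
    also have "\<dots> = (R / g) ^ D" using a fin card by simp
    finally have *: "cmod (poly (l a) x) \<le> (R / g) ^ D" .
    have "0 \<le> M" using M[OF a] norm_ge_zero order_trans by blast
    then show "cmod (poly p a * poly (l a) x) \<le> M * (R / g) ^ D"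
      unfolding norm_mult by (intro mult_mono M a *) auto
  qed
  finally show ?thesis using card by (simp add: mult_ac)
qed

text \<open>A weak form of the Cartan lemma. If the polynomial were small somewhere on each of the
\<open>D + 1\<close> concentric circles of radius \<open>s (j + 1) / (D + 1)\<close>, then interpolation at these
\<open>D + 1\<close> well separated points would make it small at \<open>1\<close> as well.\<close>

lemma circle_lower_bound:
  fixes p :: "complex poly"
  assumes deg: "degree p \<le> D" and s: "0 < s" "s \<le> 1"
  shows "\<exists>\<rho>>0. \<rho> \<le> s \<and> (\<forall>t. cmod t = \<rho> \<longrightarrow>
     cmod (poly p 1) / (2 * real (Suc D) * (2 * real (Suc D) / s) ^ D) \<le> cmod (poly p t))"
proof (rule ccontr)
  define m where "m = cmod (poly p 1) / (2 * real (Suc D) * (2 * real (Suc D) / s) ^ D)"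
  \<comment> \<open>The radii of the circles; neighbouring radii differ by \<open>s / (D + 1)\<close>.\<close>
  define \<rho> where "\<rho> j = s * real (Suc j) / real (Suc D)" for j
  assume "\<not> ?thesis"
  then have neg: "\<exists>t. cmod t = r \<and> cmod (poly p t) < m" if "0 < r" "r \<le> s" for r
    using that unfolding m_def by (meson not_le)
  have "\<exists>t. cmod t = \<rho> j \<and> cmod (poly p t) < m" if "j \<le> D" for j
  proof (rule neg)
    show "0 < \<rho> j" using s by (simp add: \<rho>_def)
    have "s * real (Suc j) \<le> s * real (Suc D)" using that s by (intro mult_left_mono) auto
    then show "\<rho> j \<le> s" by (simp add: \<rho>_def divide_le_eq)
  qed
  then obtain t where t: "\<And>j. j \<le> D \<Longrightarrow> cmod (t j) = \<rho> j" "\<And>j. j \<le> D \<Longrightarrow> cmod (poly p (t j)) < m"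
    by metis
  have gap: "s / real (Suc D) \<le> cmod (t i - t j)" if "i \<le> D" "j \<le> D" "i \<noteq> j" for i j
  proof -
    have "\<rho> i - \<rho> j = s / real (Suc D) * (real i - real j)"
      by (simp add: \<rho>_def diff_divide_distrib[symmetric] algebra_simps)
    then have "\<bar>\<rho> i - \<rho> j\<bar> = s / real (Suc D) * \<bar>real i - real j\<bar>"
      using s by (simp add: abs_mult)
    also have "\<dots> \<ge> s / real (Suc D) * 1"
      using that s by (intro mult_left_mono) auto
    finally show ?thesis using t(1) that norm_triangle_ineq3[of "t i" "t j"] by simp
  qed
  have inj: "inj_on t {..D}"
  proof (rule inj_onI)
    fix i j assume "i \<in> {..D}" "j \<in> {..D}" "t i = t j"
    then show "i = j" using gap[of i j] s by (auto simp: divide_le_0_iff)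
  qed
  have "cmod (poly p 1) \<le> real (Suc D) * (2 / (s / real (Suc D))) ^ D * m"
  proof (rule lagrange_bound[where A = "t ` {..D}"])
    show "card (t ` {..D}) = Suc D" using inj by (simp add: card_image)
    show "cmod (1 - a) \<le> 2" if a: "a \<in> t ` {..D}" for a
    proof -
      obtain j where j: "j \<le> D" "a = t j" using a by auto
      have "s * real (Suc j) \<le> 1 * real (Suc D)" using j s by (intro mult_mono) auto
      then have "\<rho> j \<le> 1" by (simp add: \<rho>_def divide_le_eq)
      then show ?thesis using norm_triangle_ineq4[of 1 a] j t(1)[of j] by simp
    qed
  qed (use deg s gap t(2) in \<open>auto intro: less_imp_le\<close>)
  also have "\<dots> = cmod (poly p 1) / 2"
  proof -
    define K where "K = real (Suc D) * (2 * real (Suc D) / s) ^ D"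
    have "K > 0" using s unfolding K_def by (intro mult_pos_pos zero_less_power) auto
    moreover have "real (Suc D) * (2 / (s / real (Suc D))) ^ D = K"
      unfolding K_def by (simp only: divide_divide_eq_right)
    moreover have "m = cmod (poly p 1) / (2 * K)"
      unfolding m_def K_def by (simp only: mult.assoc)
    ultimately show ?thesis by simp
  qed
  finally have "poly p 1 = 0" by simp
  then have "m = 0" by (simp add: m_def)
  then show False using t(2)[of 0] by simp
qed

text \<open>Otherwise \<open>1 / q\<close> would be holomorphic on the disc, at most \<open>2 / m\<close> on its boundary and
larger than \<open>2 / m\<close> at the centre, contradicting the maximum principle.\<close>

lemma zero_persists:
  fixes p q :: "complex poly"
  assumes "0 < \<rho>" "poly p 0 = 0"
    and m: "\<And>t. cmod t = \<rho> \<Longrightarrow> m \<le> cmod (poly p t)"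
    and d: "\<And>t. cmod t \<le> \<rho> \<Longrightarrow> cmod (poly q t - poly p t) < m / 2"
  shows "\<exists>t. cmod t \<le> \<rho> \<and> poly q t = 0"
proof (rule ccontr)
  assume "\<not> ?thesis"
  then have nz: "\<And>t. cmod t \<le> \<rho> \<Longrightarrow> poly q t \<noteq> 0" by auto
  have q0: "cmod (poly q 0) < m / 2" using d[of 0] assms by simp
  have mpos: "0 < m" using q0 norm_ge_zero[of "poly q 0"] by linarith
  have circ: "m / 2 < cmod (poly q t)" if "cmod t = \<rho>" for t
    using m[OF that] d[of t] that norm_triangle_ineq2[of "poly p t" "poly q t"]
    by (simp add: norm_minus_commute)
  have "cmod (inverse (poly q 0)) \<le> 2 / m"
  proof (rule maximum_modulus_frontier[where f = "\<lambda>t. inverse (poly q t)" and S = "cball 0 \<rho>"])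
    show "(\<lambda>t. inverse (poly q t)) holomorphic_on interior (cball 0 \<rho>)"
      using nz by (intro holomorphic_intros) (auto dest: interior_subset[THEN subsetD])
    show "continuous_on (closure (cball 0 \<rho>)) (\<lambda>t. inverse (poly q t))"
      using nz by (intro continuous_intros) auto
    show "cmod (inverse (poly q z)) \<le> 2 / m" if "z \<in> frontier (cball 0 \<rho>)" for z
    proof -
      have "cmod z = \<rho>" using that assms by (simp add: frontier_cball)
      then have "m / 2 \<le> cmod (poly q z)" using circ by (simp add: less_imp_le)
      then have "inverse (cmod (poly q z)) \<le> inverse (m / 2)"
        using mpos by (intro le_imp_inverse_le) auto
      then show ?thesis by (simp add: norm_inverse)
    qed
  qed (use assms in auto)
  moreover have "2 / m < cmod (inverse (poly q 0))"
    using q0 mpos nz[of 0] assms(1) by (simp add: norm_divide divide_simps)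
  ultimately show False by simp
qed

section \<open>Polynomials on complex lines\<close>

text \<open>Polynomials of degree at most \<open>D\<close>, described through their restrictions to complex lines. In this
form the class is visibly invariant under translations and dilations, which is what makes the
constants below independent of the position and the scale.\<close>

definition line_poly :: "nat \<Rightarrow> (complex ^ 'n \<Rightarrow> complex) \<Rightarrow> bool" where
  "line_poly D f \<longleftrightarrow> (\<forall>a b. \<exists>p. degree p \<le> D \<and> (\<forall>t. f (a + t *s b) = poly p t))"

definition grid :: "nat \<Rightarrow> (complex ^ 'n) set" where
  "grid D = {z. \<forall>i. z $ i \<in> of_nat ` {..D}}"

lemma finite_grid: "finite (grid D :: (complex ^ 'n) set)"
proof -
  have "grid D \<subseteq> vec_lambda ` (PiE (UNIV :: 'n set) (\<lambda>_. of_nat ` {..D}))"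
  proof
    fix z :: "complex ^ 'n" assume "z \<in> grid D"
    then have "(\<lambda>i. z $ i) \<in> PiE UNIV (\<lambda>_. of_nat ` {..D})" by (auto simp: grid_def)
    then show "z \<in> vec_lambda ` (PiE (UNIV :: 'n set) (\<lambda>_. of_nat ` {..D}))"
      by (rule rev_image_eqI) simp
  qed
  then show ?thesis by (rule finite_subset) (intro finite_imageI finite_PiE; simp)
qed

lemma norm_scalar_mult: "norm (c *s v) = cmod c * norm (v :: complex ^ 'n)"
  by (simp add: norm_vec_def L2_set_def norm_mult power_mult_distrib sum_distrib_left[symmetric]
      real_sqrt_mult)

lemma one_le_norm_of_nat_diff:
  assumes "of_nat k \<noteq> (of_nat l :: complex)"
  shows "1 \<le> cmod (of_nat k - of_nat l)"
proof -
  have "of_nat k - of_nat l = (of_int (int k - int l) :: complex)" by simp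
  then have "cmod (of_nat k - of_nat l) = \<bar>real_of_int (int k - int l)\<bar>" by (metis norm_of_int)
  then show ?thesis using assms by auto
qed

text \<open>Interpolation in one coordinate after the other, with the nodes \<open>0, \<dots>, D\<close>. In particular a
polynomial that vanishes on the grid vanishes identically.\<close>

lemma grid_bound:
  fixes f :: "complex ^ 'n \<Rightarrow> complex"
  assumes f: "line_poly D f" and M: "\<And>z. z \<in> grid D \<Longrightarrow> cmod (f z) \<le> M"
    and R: "0 \<le> R" "\<And>i. cmod (z $ i) \<le> R"
  shows "cmod (f z) \<le> (real (Suc D) * (R + D) ^ D) ^ CARD('n) * M"
proof -
  let ?K = "real (Suc D) * (R + D) ^ D"
  have "\<forall>z. (\<forall>i. i \<notin> S \<longrightarrow> z $ i \<in> of_nat ` {..D}) \<and> (\<forall>i\<in>S. cmod (z $ i) \<le> R) \<longrightarrow>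
     cmod (f z) \<le> ?K ^ card S * M" for S :: "'n set"
  proof (induction S rule: finite_induct[OF finite])
    case 1
    then show ?case using M by (auto simp: grid_def)
  next
    case (2 i S)
    show ?case
    proof safe
      fix z :: "complex ^ 'n"
      assume z: "\<forall>j. j \<notin> insert i S \<longrightarrow> z $ j \<in> of_nat ` {..D}"
        "\<forall>j\<in>insert i S. cmod (z $ j) \<le> R"
      define z' where "z' = (\<chi> j. if j = i then 0 else z $ j)"
      have z_eq: "z = z' + (z $ i) *s axis i 1"
        by (simp add: vec_eq_iff z'_def axis_def)
      obtain p where p: "degree p \<le> D" "\<And>t. f (z' + t *s axis i 1) = poly p t"
        using f unfolding line_poly_def by blast
      have "cmod (poly p (z $ i)) \<le> real (Suc D) * ((R + D) / 1) ^ D * (?K ^ card S * M)"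
      proof (rule lagrange_bound[where A = "of_nat ` {..D}"])
        show "card (of_nat ` {..D} :: complex set) = Suc D"
          by (subst card_image) (auto simp: inj_on_def)
        show "(1::real) \<le> cmod (a - b)" if "a \<in> of_nat ` {..D}" "b \<in> of_nat ` {..D}" "a \<noteq> b"
          for a b :: complex
          using that one_le_norm_of_nat_diff by blast
        show "cmod (z $ i - a) \<le> R + D" if a: "a \<in> of_nat ` {..D}" for a
        proof -
          have "cmod a \<le> D" using a by auto
          then show ?thesis using norm_triangle_ineq4[of "z $ i" a] z by auto
        qed
        show "cmod (poly p a) \<le> ?K ^ card S * M" if a: "a \<in> of_nat ` {..D}" for a
        proof -
          have "cmod (f (z' + a *s axis i 1)) \<le> ?K ^ card S * M"
          proof (rule 2(3)[rule_format], safe)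
            fix j assume j: "j \<notin> S"
            show "(z' + a *s axis i 1) $ j \<in> of_nat ` {..D}"
              using j z a by (cases "j = i") (auto simp: z'_def axis_def)
          next
            fix j assume j: "j \<in> S"
            then have "j \<noteq> i" using 2 by auto
            then show "cmod ((z' + a *s axis i 1) $ j) \<le> R"
              using j z by (auto simp: z'_def axis_def)
          qed
          then show ?thesis using p by simp
        qed
      qed (use p in auto)
      then show "cmod (f z) \<le> ?K ^ card (insert i S) * M"
        using z_eq p 2 by (metis (no_types, lifting) card.insert div_by_1 finite mult.assoc power_Suc)
    qed
  qed
  from this[of UNIV] R show ?thesis by simp
qed

text \<open>On the line through \<open>x\<close> in the unit direction \<open>e\<close> of \<open>v\<close> the increment is \<open>t * s t\<close> with a
polynomial \<open>s\<close>; the values of \<open>s\<close> at \<open>1, \<dots>, D + 1\<close> are bounded by the values of \<open>f\<close>, and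
interpolation bounds \<open>s\<close> on the unit disc. The points \<open>x + j e\<close> have norm at most \<open>D + 2\<close> and thus
lie in the box of radius \<open>D + 3\<close> on which \<open>f\<close> is bounded first.\<close>

lemma line_poly_Lipschitz:
  fixes D :: nat
  shows "\<exists>L>0. \<forall>(f :: complex ^ 'n \<Rightarrow> complex) M x v. line_poly D f \<longrightarrow>
     (\<forall>z\<in>grid D. cmod (f z) \<le> M) \<longrightarrow> norm x \<le> 1 \<longrightarrow> norm v \<le> 1 \<longrightarrow>
     cmod (f (x + v) - f x) \<le> L * M * norm v"
proof -
  define K where "K = (real (Suc D) * (real (D + 3) + D) ^ D) ^ CARD('n)"
  define L where "L = real (Suc D) * (real (D + 2) / 1) ^ D * (2 * K)"
  have Kpos: "K > 0" unfolding K_def by (intro zero_less_power mult_pos_pos add_pos_nonneg) auto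
  then have "L > 0" by (simp add: L_def)
  moreover have "cmod (f (x + v) - f x) \<le> L * M * norm v"
    if f: "line_poly D f" and M: "\<forall>z\<in>grid D. cmod (f z) \<le> M"
      and x: "norm x \<le> 1" and v: "norm v \<le> 1"
    for f :: "complex ^ 'n \<Rightarrow> complex" and M x v
  proof (cases "v = 0")
    case False
    define e where "e = complex_of_real (1 / norm v) *s v"
    have e: "norm e = 1" using False by (simp add: e_def norm_scalar_mult norm_divide)
    have v_eq: "v = complex_of_real (norm v) *s e"
      using False by (simp add: e_def vector_smult_assoc)
    obtain p where p: "degree p \<le> D" "\<And>t. f (x + t *s e) = poly p t"
      using f unfolding line_poly_def by blast
    obtain c s where s: "p = pCons c s" by (rule pCons_cases)
    have fx: "f x = c" using p(2)[of 0] s by simp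
    have bound: "cmod (f z) \<le> K * M" if "norm z \<le> D + 3" for z
      unfolding K_def
      by (rule grid_bound[OF f]) (use M that in \<open>auto intro: order_trans[OF Finite_Cartesian_Product.norm_nth_le]\<close>)
    have "cmod (poly s (norm v)) \<le> real (Suc D) * (real (D + 2) / 1) ^ D * (2 * (K * M))"
    proof (rule lagrange_bound[where A = "of_nat ` {1..Suc D}"])
      show "card (of_nat ` {1..Suc D} :: complex set) = Suc D"
        by (subst card_image) (auto simp: inj_on_def)
      show "degree s \<le> D" using p s by (cases "s = 0") auto
      show "(1::real) \<le> cmod (a - b)" if "a \<in> of_nat ` {1..Suc D}" "b \<in> of_nat ` {1..Suc D}" "a \<noteq> b"
        for a b :: complex
        using that one_le_norm_of_nat_diff by blast
      show "cmod (complex_of_real (norm v) - a) \<le> real (D + 2)" if a: "a \<in> of_nat ` {1..Suc D}" for a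
      proof -
        have "cmod a \<le> Suc D" using a by (auto simp del: of_nat_Suc)
        then show ?thesis using norm_triangle_ineq4[of "complex_of_real (norm v)" a] v by auto
      qed
      show "cmod (poly s a) \<le> 2 * (K * M)" if a: "a \<in> of_nat ` {1..Suc D}" for a
      proof -
        obtain k where k: "a = of_nat k" "1 \<le> k" "k \<le> Suc D" using a by auto
        have "norm (x + a *s e) \<le> norm x + k"
          using norm_triangle_ineq[of x "a *s e"] e k by (simp add: norm_scalar_mult)
        then have "cmod (poly p a) \<le> K * M" using bound[of "x + a *s e"] k x p(2) by simp
        moreover have "cmod c \<le> K * M" using bound[of x] x fx by simp
        moreover have "a * poly s a = poly p a - c" using s by simp
        then have "cmod a * cmod (poly s a) \<le> cmod (poly p a) + cmod c"
          by (metis norm_mult norm_triangle_ineq4)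
        moreover have "1 * cmod (poly s a) \<le> cmod a * cmod (poly s a)"
          using k by (intro mult_right_mono) auto
        ultimately show ?thesis by simp
      qed
    qed auto
    moreover have "f (x + v) - f x = norm v * poly s (norm v)"
      using p(2)[of "norm v"] v_eq fx s by simp
    ultimately have "cmod (f (x + v) - f x) \<le> norm v * (L * M)"
      by (simp only: norm_mult norm_of_real abs_norm_cancel) (intro mult_left_mono; simp add: L_def mult_ac)
    then show ?thesis by (simp add: mult_ac)
  qed simp
  ultimately show ?thesis by blast
qed

section \<open>Separated points of a zero set\<close>

lemma norm_grid: "norm b \<le> real CARD('n) * D" if "b \<in> grid D" for b :: "complex ^ 'n"
proof -
  have "norm b \<le> (\<Sum>i\<in>UNIV. norm (b $ i))"
    unfolding norm_vec_def by (rule L2_set_le_sum) simp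
  also have "\<dots> \<le> (\<Sum>i\<in>(UNIV :: 'n set). real D)"
  proof (rule sum_mono)
    fix i
    have "b $ i \<in> of_nat ` {..D}" using that by (simp add: grid_def)
    then show "norm (b $ i) \<le> real D" by auto
  qed
  finally show ?thesis by simp
qed

lemma one_le_norm_grid: "1 \<le> norm b" if "b \<in> grid D" "b \<noteq> 0" for b :: "complex ^ 'n"
proof -
  have "\<exists>i. b $ i \<noteq> 0" using that by (auto simp: vec_eq_iff)
  then obtain i where i: "b $ i \<noteq> 0" by blast
  have "\<exists>k :: nat. b $ i = of_nat k" using that by (auto simp: grid_def)
  then obtain k :: nat where "b $ i = of_nat k" by blast
  then have "1 \<le> norm (b $ i)" using i by simp
  then show ?thesis using Finite_Cartesian_Product.norm_nth_le[of b i] by simp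
qed

text \<open>The key point of the area estimate: near a zero, there is a direction \<open>b\<close> out of a finite set
depending only on the degree such that the zero set meets every line in direction \<open>b\<close> that passes
near the zero, with a lower bound for "near" that depends on nothing but the degree and the
dimension. For \<open>b\<close> one takes the grid point at which \<open>|f|\<close> is largest: on the line \<open>t b\<close> the
function is then bounded below on some small circle, it varies by a controlled amount when the
line is moved, and so its zero at the centre persists.\<close>

lemma zeros_on_nearby_lines:
  fixes D :: nat
  shows "\<exists>c>0. c \<le> 1 \<and> (\<forall>f :: complex ^ 'n \<Rightarrow> complex. line_poly D f \<longrightarrow> f 0 = 0 \<longrightarrow>
     (\<exists>z. f z \<noteq> 0) \<longrightarrow> (\<exists>b\<in>grid D. 1 \<le> norm b \<and> (\<forall>v. norm v < c \<longrightarrow>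
       (\<exists>t. norm (v + t *s b) < 1 / 2 \<and> f (v + t *s b) = 0) \<and> (\<exists>t. f (v + t *s b) \<noteq> 0))))"
proof -
  obtain L where L: "L > 0" "\<And>(f :: complex ^ 'n \<Rightarrow> complex) M x v. line_poly D f \<Longrightarrow>
     (\<forall>z\<in>grid D. cmod (f z) \<le> M) \<Longrightarrow> norm x \<le> 1 \<Longrightarrow> norm v \<le> 1 \<Longrightarrow>
     cmod (f (x + v) - f x) \<le> L * M * norm v"
    using line_poly_Lipschitz[where 'n = 'n, of D] by blast
  \<comment> \<open>Chosen so that \<open>|t b| \<le> 1 / 8\<close> whenever \<open>|t| \<le> s\<close> and \<open>b\<close> is a grid point.\<close>
  define s where "s = 1 / (8 * (1 + real CARD('n) * D))"
  have s: "0 < s" "s \<le> 1" "s * (real CARD('n) * D) \<le> 1 / 8"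
  proof -
    define X where "X = real CARD('n) * D"
    have "X \<ge> 0" by (simp add: X_def)
    then have "0 < 1 / (8 * (1 + X)) \<and> 1 / (8 * (1 + X)) \<le> 1 \<and> 1 / (8 * (1 + X)) * X \<le> 1 / 8"
      by (simp add: divide_simps)
    then show "0 < s" "s \<le> 1" "s * (real CARD('n) * D) \<le> 1 / 8"
      by (auto simp: s_def X_def)
  qed
  define m where "m = 1 / (2 * real (Suc D) * (2 * real (Suc D) / s) ^ D)"
  have m: "m > 0" unfolding m_def using s by (intro divide_pos_pos mult_pos_pos zero_less_power) auto
  \<comment> \<open>The second entry makes the variation of \<open>f\<close> less than half of its lower bound on the circle.\<close>
  define c where "c = min (1 / 8) (m / (2 * L))"
  have c: "0 < c" "c \<le> 1 / 8" "L * c \<le> m / 2"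
  proof -
    have "c \<le> m / (2 * L)" by (simp add: c_def)
    then have "L * c \<le> L * (m / (2 * L))" using L by (intro mult_left_mono) auto
    then show "L * c \<le> m / 2" using L by simp
  qed (use m L in \<open>auto simp: c_def\<close>)
  have "\<exists>b\<in>grid D. 1 \<le> norm b \<and> (\<forall>v. norm v < c \<longrightarrow>
       (\<exists>t. norm (v + t *s b) < 1 / 2 \<and> f (v + t *s b) = 0) \<and> (\<exists>t. f (v + t *s b) \<noteq> 0))"
    if f: "line_poly D f" and f0: "f 0 = 0" and nz: "\<exists>z. f z \<noteq> 0" for f :: "complex ^ 'n \<Rightarrow> complex"
  proof -
    define M where "M = Max ((\<lambda>z. cmod (f z)) ` grid D)"
    have "0 \<in> (grid D :: (complex ^ 'n) set)" by (auto simp: grid_def)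
    then have M_in: "M \<in> (\<lambda>z. cmod (f z)) ` grid D"
      unfolding M_def using finite_grid by (intro Max_in) auto
    have M: "cmod (f z) \<le> M" if "z \<in> grid D" for z
      unfolding M_def using finite_grid that by (intro Max_ge) auto
    obtain b where b: "b \<in> grid D" "M = cmod (f b)" using M_in by auto
    have "f b \<noteq> 0"
    proof
      assume "f b = 0"
      then have "cmod (f z) \<le> 0" if "z \<in> grid D" for z using M[OF that] b by simp
      from grid_bound[OF f this, where R = "norm z" and z = z for z] have "f z = 0" for z
        using Finite_Cartesian_Product.norm_nth_le[of z] by (fastforce dest: meta_spec[of _ z])
      then show False using nz by simp
    qed
    then have "b \<noteq> 0" using f0 by auto
    then have norm_b: "1 \<le> norm b" using one_le_norm_grid b by blast
    have Mpos: "M > 0" using b \<open>f b \<noteq> 0\<close> by simp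
    obtain p where p: "degree p \<le> D" "\<And>t. f (0 + t *s b) = poly p t"
      using f unfolding line_poly_def by blast
    have p1: "cmod (poly p 1) = M" using p(2)[of 1] b by simp
    have p0: "poly p 0 = 0" using p(2)[of 0] f0 by simp
    obtain \<rho> where \<rho>: "0 < \<rho>" "\<rho> \<le> s" "\<And>t. cmod t = \<rho> \<Longrightarrow> M * m \<le> cmod (poly p t)"
      using circle_lower_bound[OF p(1) s(1,2)] p1 unfolding m_def by auto
    have small: "norm (t *s b) \<le> 1 / 8" if "cmod t \<le> \<rho>" for t
    proof -
      have "norm (t *s b) \<le> s * (real CARD('n) * D)"
        unfolding norm_scalar_mult using that \<rho> s norm_grid[OF b(1)] by (intro mult_mono) auto
      then show ?thesis using s by simp
    qed
    have "(\<exists>t. norm (v + t *s b) < 1 / 2 \<and> f (v + t *s b) = 0) \<and> (\<exists>t. f (v + t *s b) \<noteq> 0)"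
      if v: "norm v < c" for v
    proof -
      obtain q where q: "degree q \<le> D" "\<And>t. f (v + t *s b) = poly q t"
        using f unfolding line_poly_def by blast
      have close: "cmod (poly q t - poly p t) < M * m / 2" if t: "cmod t \<le> \<rho>" for t
      proof -
        have "cmod (f (t *s b + v) - f (t *s b)) \<le> L * M * norm v"
          using M small[OF t] v c by (intro L(2)[OF f]) auto
        also have "\<dots> < L * M * c" using L Mpos v by (intro mult_strict_left_mono) auto
        also have "\<dots> = M * (L * c)" by simp
        also have "\<dots> \<le> M * (m / 2)" using c Mpos by (intro mult_left_mono) auto
        finally show ?thesis using p(2)[of t] q(2)[of t] by (simp add: add.commute)
      qed
      obtain t where t: "cmod t \<le> \<rho>" "poly q t = 0"
        using zero_persists[OF \<rho>(1) p0 \<rho>(3) close] by auto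
      have "norm (v + t *s b) < 1 / 2"
        using norm_triangle_ineq[of v "t *s b"] small[OF t(1)] v c by linarith
      moreover have "poly q (of_real \<rho>) \<noteq> 0"
      proof
        assume "poly q (of_real \<rho>) = 0"
        then have "M * m < M * m / 2"
          using close[of "of_real \<rho>"] \<rho>(3)[of "of_real \<rho>"] \<rho>(1) by simp
        then show False using mult_pos_pos[OF Mpos m] by linarith
      qed
      ultimately show ?thesis using q t by metis
    qed
    then show ?thesis using b norm_b by blast
  qed
  then show ?thesis using c by (intro exI[of _ c]) auto
qed

lemma sum_measure_le_overlap:
  assumes fin: "finite I" and A: "\<And>i. i \<in> I \<Longrightarrow> A i \<in> sets M" "\<And>i. i \<in> I \<Longrightarrow> A i \<subseteq> X"
    and X: "X \<in> sets M" and overlap: "\<And>z. z \<in> X \<Longrightarrow> card {i \<in> I. z \<in> A i} \<le> D"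
  shows "(\<Sum>i\<in>I. emeasure M (A i)) \<le> of_nat D * emeasure M X"
proof -
  have "(\<Sum>i\<in>I. emeasure M (A i)) = (\<integral>\<^sup>+z. (\<Sum>i\<in>I. indicator (A i) z) \<partial>M)"
    using A by (simp add: nn_integral_sum)
  also have "\<dots> \<le> (\<integral>\<^sup>+z. of_nat D * indicator X z \<partial>M)"
  proof (rule nn_integral_mono)
    fix z
    have "(\<Sum>i\<in>I. indicator (A i) z) = (of_nat (card {i \<in> I. z \<in> A i}) :: ennreal)"
      using fin by (simp add: indicator_def sum.If_cases Int_def)
    moreover have "\<dots> \<le> of_nat D" if "z \<in> X" using overlap[OF that] by simp
    moreover have "{i \<in> I. z \<in> A i} = {}" if "z \<notin> X" using A that by auto
    ultimately show "(\<Sum>i\<in>I. indicator (A i) z) \<le> (of_nat D * indicator X z :: ennreal)"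
      by (cases "z \<in> X") auto
  qed
  also have "\<dots> = of_nat D * emeasure M X" using X by (simp add: nn_integral_cmult)
  finally show ?thesis .
qed

text \<open>Translate the balls of radius \<open>c \<delta>\<close> around the points of \<open>F\<close> along \<open>b\<close>, through a square grid
of about \<open>(r / (c \<delta>))\<^sup>2\<close> disjoint positions in the complex line. A point \<open>z\<close> in one of these
balls determines a zero on the line \<open>z + \<complex> b\<close> at distance less than \<open>\<delta> / 2\<close> from the
corresponding point of \<open>F\<close>. As \<open>F\<close> is \<open>\<delta>\<close>-separated, different points of \<open>F\<close> yield different
zeros, and the line carries at most \<open>D\<close> of them. Hence the balls cover no point more than \<open>D\<close>
times, and comparing volumes gives the bound.\<close>

lemma packing_one_direction:
  fixes P :: "complex ^ 'n \<Rightarrow> complex" and F :: "(complex ^ 'n) set"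
  assumes P: "line_poly D P" and c: "0 < c" "c \<le> 1" and b: "b \<noteq> 0"
    and \<delta>: "0 < \<delta>" "\<delta> \<le> r" and F: "finite F" "F \<subseteq> cball a r"
    and sep: "\<And>x y. x \<in> F \<Longrightarrow> y \<in> F \<Longrightarrow> x \<noteq> y \<Longrightarrow> \<delta> \<le> dist x y"
    and zeros: "\<And>w v. w \<in> F \<Longrightarrow> norm v < c \<Longrightarrow>
       (\<exists>t. norm (v + t *s b) < 1 / 2 \<and> P (w + \<delta> *\<^sub>R (v + t *s b)) = 0) \<and>
       (\<exists>t. P (w + \<delta> *\<^sub>R (v + t *s b)) \<noteq> 0)"
  shows "real (card F) * c ^ (2 * CARD('n)) * \<delta> ^ (2 * CARD('n) - 2)
    \<le> 16 * real D * c\<^sup>2 * 4 ^ (2 * CARD('n)) * r ^ (2 * CARD('n) - 2)"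
proof -
  define e where "e = complex_of_real (1 / norm b) *s b"
  have e: "norm e = 1" using b by (simp add: e_def norm_scalar_mult norm_divide)
  \<comment> \<open>The grid has \<open>(N + 1)\<^sup>2\<close> positions with spacing \<open>2 c \<delta>\<close>, all within distance \<open>r\<close> of the starting point.\<close>
  define N where "N = nat \<lfloor>r / (4 * c * \<delta>)\<rfloor>"
  have N: "real N \<le> r / (4 * c * \<delta>)" "r / (4 * c * \<delta>) \<le> real (Suc N)"
    using c \<delta> by (auto simp: N_def intro!: of_nat_floor) linarith
  define I where "I = F \<times> {..N} \<times> {..N}"
  define s where "s k = complex_of_real (2 * c * \<delta>) * Complex (real (fst k)) (real (snd k))" for k :: "nat \<times> nat"
  define x where "x i = fst i + s (snd i) *s e" for i
  have s_dist: "2 * c * \<delta> \<le> cmod (s k - s l)" if "k \<noteq> l" for k l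
  proof -
    have *: "1 \<le> \<bar>real i - real j\<bar>" if "i \<noteq> j" for i j :: nat using that by auto
    have "1 \<le> cmod (Complex (real (fst k)) (real (snd k)) - Complex (real (fst l)) (real (snd l)))"
    proof (cases "fst k = fst l")
      case True
      then have "snd k \<noteq> snd l" using that by (auto simp: prod_eq_iff)
      from order_trans[OF *[OF this] order_trans[OF _ abs_Im_le_cmod]] show ?thesis by simp
    next
      case False
      from order_trans[OF *[OF this] order_trans[OF _ abs_Re_le_cmod]] show ?thesis by simp
    qed
    then have "2 * c * \<delta> * 1 \<le> 2 * c * \<delta> * cmod (Complex (real (fst k)) (real (snd k)) - Complex (real (fst l)) (real (snd l)))"
      using c \<delta> by (intro mult_left_mono) auto
    also have "\<dots> = cmod (s k - s l)"
      using c \<delta> by (simp add: s_def right_diff_distrib[symmetric] norm_mult)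
    finally show ?thesis by simp
  qed
  have s_norm: "cmod (s k) \<le> r" if "k \<in> {..N} \<times> {..N}" for k
  proof -
    have "cmod (Complex (real (fst k)) (real (snd k))) \<le> real (fst k) + real (snd k)"
      using cmod_le[of "Complex (real (fst k)) (real (snd k))"] by simp
    also have "\<dots> \<le> 2 * real N" using that by auto
    also have "\<dots> \<le> 2 * (r / (4 * c * \<delta>))" using N(1) by (intro mult_left_mono) auto
    finally have "2 * c * \<delta> * cmod (Complex (real (fst k)) (real (snd k))) \<le> 2 * c * \<delta> * (2 * (r / (4 * c * \<delta>)))"
      using c \<delta> by (intro mult_left_mono) auto
    also have "\<dots> = r" using c \<delta> by simp
    finally show ?thesis using c \<delta> by (simp add: s_def norm_mult)
  qed
  have cd: "c * \<delta> \<le> r"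
    using mult_mono[OF c(2) \<delta>(2)] c \<delta> by simp
  have "(\<Sum>i\<in>I. emeasure lborel (ball (x i) (c * \<delta>))) \<le> of_nat D * emeasure lborel (ball a (4 * r))"
  proof (rule sum_measure_le_overlap)
    show "finite I" using F by (simp add: I_def)
    show "ball (x i) (c * \<delta>) \<subseteq> ball a (4 * r)" if "i \<in> I" for i
    proof
      fix z assume z: "z \<in> ball (x i) (c * \<delta>)"
      have "dist a (fst i) \<le> r" using that F by (auto simp: I_def)
      moreover have "dist (fst i) (x i) \<le> r"
        using that s_norm e by (auto simp: I_def x_def dist_norm norm_scalar_mult)
      moreover have "dist (x i) z < c * \<delta>" using z by simp
      ultimately have "dist a z < 4 * r"
        using dist_triangle[of a z "x i"] dist_triangle[of a "x i" "fst i"] cd \<delta> by linarith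
      then show "z \<in> ball a (4 * r)" by simp
    qed
    fix z :: "complex ^ 'n"
    define J where "J = {i \<in> I. z \<in> ball (x i) (c * \<delta>)}"
    have finJ: "finite J" using F by (simp add: J_def I_def)
    obtain p where p: "degree p \<le> D" "\<And>t. P (z + t *s b) = poly p t"
      using P unfolding line_poly_def by blast
    have J: "\<exists>\<tau>. poly p \<tau> = 0 \<and> dist (fst i) (z + \<tau> *s b) < \<delta> / 2" "\<exists>\<tau>. poly p \<tau> \<noteq> 0"
      if i: "i \<in> J" for i
    proof -
      define v where "v = (1 / \<delta>) *\<^sub>R (z - x i)"
      have z_eq: "z = x i + \<delta> *\<^sub>R v" using \<delta> by (simp add: v_def)
      have "norm (z - x i) < c * \<delta>" using i by (simp add: J_def dist_norm norm_minus_commute)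
      then have v: "norm v < c" using \<delta> by (simp add: v_def divide_simps mult_ac)
      have w: "fst i \<in> F" using i by (auto simp: J_def I_def)
      define \<sigma> where "\<sigma> = s (snd i) / complex_of_real (norm b)"
      have xi: "x i = fst i + \<sigma> *s b"
        by (simp add: x_def e_def \<sigma>_def vector_smult_assoc)
      \<comment> \<open>In the coordinate of the line through \<open>z\<close>, the zeros near the point of \<open>F\<close> are seen after a shift by \<open>\<sigma>\<close>.\<close>
      have eq: "fst i + \<delta> *\<^sub>R (v + t *s b) = z + (complex_of_real \<delta> * t - \<sigma>) *s b" for t
        unfolding z_eq xi by (simp add: vec_eq_iff scaleR_conv_of_real[where 'a = complex] algebra_simps)
      obtain t where t: "norm (v + t *s b) < 1 / 2" "P (fst i + \<delta> *\<^sub>R (v + t *s b)) = 0"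
        using zeros[OF w v] by blast
      obtain t' where t': "P (fst i + \<delta> *\<^sub>R (v + t' *s b)) \<noteq> 0"
        using zeros[OF w v] by blast
      have "dist (fst i) (fst i + \<delta> *\<^sub>R (v + t *s b)) < \<delta> / 2"
        using t \<delta> by (simp add: dist_norm)
      then show "\<exists>\<tau>. poly p \<tau> = 0 \<and> dist (fst i) (z + \<tau> *s b) < \<delta> / 2"
        using t(2) p(2)[of "complex_of_real \<delta> * t - \<sigma>"] unfolding eq by (intro exI[of _ "complex_of_real \<delta> * t - \<sigma>"]) simp
      show "\<exists>\<tau>. poly p \<tau> \<noteq> 0" using t' p(2)[of "complex_of_real \<delta> * t' - \<sigma>"] unfolding eq by (intro exI[of _ "complex_of_real \<delta> * t' - \<sigma>"]) simp
    qed
    obtain \<tau> where \<tau>: "\<And>i. i \<in> J \<Longrightarrow> poly p (\<tau> i) = 0" "\<And>i. i \<in> J \<Longrightarrow> dist (fst i) (z + \<tau> i *s b) < \<delta> / 2"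
      using J(1) by metis
    have "inj_on \<tau> J"
    proof (rule inj_onI)
      fix i j assume i: "i \<in> J" and j: "j \<in> J" and eq: "\<tau> i = \<tau> j"
      have "dist (fst i) (fst j) < \<delta>"
        using \<tau>(2)[OF i] \<tau>(2)[OF j] eq dist_triangle2[of "fst i" "fst j" "z + \<tau> j *s b"] by simp
      note lt = this
      have fst_eq: "fst i = fst j"
      proof (rule ccontr)
        assume "fst i \<noteq> fst j"
        moreover have "fst i \<in> F" "fst j \<in> F" using i j by (auto simp: J_def I_def)
        ultimately show False using sep[of "fst i" "fst j"] lt by linarith
      qed
      have "dist (x i) (x j) < 2 * c * \<delta>"
        using i j dist_triangle2[of "x i" "x j" z] by (simp add: J_def)
      moreover have "dist (x i) (x j) = cmod (s (snd i) - s (snd j))"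
      proof -
        have "x i - x j = (s (snd i) - s (snd j)) *s e"
          using fst_eq by (simp add: x_def vector_sub_rdistrib)
        then show ?thesis using e unfolding dist_norm by (simp only: norm_scalar_mult mult_1_right)
      qed
      ultimately have "snd i = snd j" using s_dist[of "snd i" "snd j"] by (cases "snd i = snd j") auto
      then show "i = j" using fst_eq by (simp add: prod_eq_iff)
    qed
    show "card {i \<in> I. z \<in> ball (x i) (c * \<delta>)} \<le> D"
    proof (cases "J = {}")
      case True
      then show ?thesis unfolding J_def by (metis card.empty zero_le)
    next
      case False
      then have "p \<noteq> 0" using J(2) by auto
      have "card J = card (\<tau> ` J)" using \<open>inj_on \<tau> J\<close> by (simp add: card_image)
      also have "\<dots> \<le> card {t. poly p t = 0}"
        using \<tau>(1) poly_roots_finite[OF \<open>p \<noteq> 0\<close>] by (intro card_mono) auto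
      also have "\<dots> \<le> D" using card_poly_roots_bound[OF \<open>p \<noteq> 0\<close>] p(1) by linarith
      finally show ?thesis by (simp add: J_def)
    qed
  qed auto
  define V where "V = unit_ball_vol (real (2 * CARD('n)))"
  have V: "V > 0" by (simp add: V_def)
  have vol: "emeasure lborel (ball y t) = ennreal (V * t ^ (2 * CARD('n)))" if "t \<ge> 0" for y :: "complex ^ 'n" and t
    using that by (simp add: emeasure_ball V_def mult.commute)
  have "real (card I) * (V * (c * \<delta>) ^ (2 * CARD('n))) \<le> real D * (V * (4 * r) ^ (2 * CARD('n)))"
  proof -
    have "(\<Sum>i\<in>I. emeasure lborel (ball (x i) (c * \<delta>))) = ennreal (real (card I) * (V * (c * \<delta>) ^ (2 * CARD('n))))"
      using c \<delta> V by (simp add: vol ennreal_mult ennreal_of_nat_eq_real_of_nat)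
    moreover have "of_nat D * emeasure lborel (ball a (4 * r)) = ennreal (real D * (V * (4 * r) ^ (2 * CARD('n))))"
      using c \<delta> V by (simp add: vol ennreal_mult ennreal_of_nat_eq_real_of_nat)
    ultimately show ?thesis
      using \<open>(\<Sum>i\<in>I. _ i) \<le> _\<close> V \<delta> by (simp add: ennreal_le_iff)
  qed
  then have main: "real (card I) * (c * \<delta>) ^ (2 * CARD('n)) \<le> real D * (4 * r) ^ (2 * CARD('n))"
    using V by (simp add: mult.left_commute)
  have "real (card F) * (r / (4 * c * \<delta>))\<^sup>2 \<le> real (card I)"
  proof -
    have "(r / (4 * c * \<delta>))\<^sup>2 \<le> (real (Suc N))\<^sup>2"
      using N(2) c \<delta> by (intro power_mono) auto
    then have "real (card F) * (r / (4 * c * \<delta>))\<^sup>2 \<le> real (card F) * (real (Suc N))\<^sup>2"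
      by (intro mult_left_mono) auto
    also have "\<dots> = real (card I)" by (simp add: I_def card_cartesian_product power2_eq_square algebra_simps)
    finally show ?thesis .
  qed
  then have vol_bound: "real (card F) * (r / (4 * c * \<delta>))\<^sup>2 * (c * \<delta>) ^ (2 * CARD('n)) \<le> real D * (4 * r) ^ (2 * CARD('n))"
    using main c \<delta> by (intro order_trans[OF mult_right_mono main]) auto
  obtain k where k: "CARD('n) = Suc k"
    using zero_less_card_finite[where 'a = 'n] gr0_implies_Suc by blast
  have pow: "y ^ (2 * CARD('n)) = y\<^sup>2 * y ^ (2 * k)" for y :: real
    by (simp add: k power_add power2_eq_square)
  have "r > 0" using \<delta> by simp
  have cancel: "(r / (4 * x))\<^sup>2 * (x\<^sup>2 * y) = r\<^sup>2 * (y / 16)" if "x \<noteq> 0" for x y :: real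
    using that by (simp add: power_divide power_mult_distrib)
  have "(r / (4 * c * \<delta>))\<^sup>2 * (c * \<delta>) ^ (2 * CARD('n)) = r\<^sup>2 * ((c * \<delta>) ^ (2 * k) / 16)"
    unfolding pow mult.assoc[of 4] by (rule cancel) (use c \<delta> in auto)
  then have "r\<^sup>2 * (real (card F) * (c * \<delta>) ^ (2 * k) / 16) =
      real (card F) * ((r / (4 * c * \<delta>))\<^sup>2 * (c * \<delta>) ^ (2 * CARD('n)))" by simp
  also have "\<dots> \<le> real D * (4 * r) ^ (2 * CARD('n))"
    using vol_bound by (simp only: mult.assoc)
  also have "\<dots> = r\<^sup>2 * (real D * 4 ^ (2 * CARD('n)) * r ^ (2 * k))"
    unfolding power_mult_distrib pow[of r] by simp
  finally have "real (card F) * (c * \<delta>) ^ (2 * k) / 16 \<le> real D * 4 ^ (2 * CARD('n)) * r ^ (2 * k)"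
    using \<open>r > 0\<close> by (simp only: mult_le_cancel_left_pos zero_less_power)
  then have "c\<^sup>2 * (real (card F) * (c * \<delta>) ^ (2 * k)) \<le> c\<^sup>2 * (16 * (real D * 4 ^ (2 * CARD('n)) * r ^ (2 * k)))"
    by (intro mult_left_mono) auto
  moreover have "2 * CARD('n) - 2 = 2 * k" using k by simp
  ultimately show ?thesis unfolding pow[of c] power_mult_distrib by (simp only: mult_ac)
qed

lemma line_poly_affine:
  assumes "line_poly D P"
  shows "line_poly D (\<lambda>z. P (w + \<delta> *\<^sub>R z))"
  unfolding line_poly_def
proof (intro allI)
  fix a b
  obtain p where p: "degree p \<le> D" "\<And>t. P ((w + \<delta> *\<^sub>R a) + t *s (\<delta> *\<^sub>R b)) = poly p t"
    using assms unfolding line_poly_def by blast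
  have "w + \<delta> *\<^sub>R (a + t *s b) = (w + \<delta> *\<^sub>R a) + t *s (\<delta> *\<^sub>R b)" for t
    by (simp add: vec_eq_iff algebra_simps)
  then show "\<exists>p. degree p \<le> D \<and> (\<forall>t. P (w + \<delta> *\<^sub>R (a + t *s b)) = poly p t)"
    using p(1) by (intro exI[of _ p]) (simp only: p(2) simp_thms)
qed

text \<open>A \<open>\<delta>\<close>-separated subset of a zero set in a ball of radius \<open>r\<close> has at most
\<open>C (r / \<delta>)\<^bsup>2n-2\<^esup>\<close> points: each of them has a good direction, and there are finitely many
directions.\<close>

lemma packing:
  fixes D :: nat
  obtains C where "0 \<le> C"
    "\<And>(P :: complex ^ 'n \<Rightarrow> complex) a r \<delta> F. line_poly D P \<Longrightarrow> \<exists>z. P z \<noteq> 0 \<Longrightarrow>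
       0 < \<delta> \<Longrightarrow> \<delta> \<le> r \<Longrightarrow> finite F \<Longrightarrow> F \<subseteq> {z. P z = 0} \<inter> cball a r \<Longrightarrow>
       \<forall>x\<in>F. \<forall>y\<in>F. x \<noteq> y \<longrightarrow> \<delta> \<le> dist x y \<Longrightarrow>
       real (card F) * \<delta> ^ (2 * CARD('n) - 2) \<le> C * r ^ (2 * CARD('n) - 2)"
proof -
  obtain c where c: "c > 0" "c \<le> 1" "\<And>f :: complex ^ 'n \<Rightarrow> complex. line_poly D f \<Longrightarrow> f 0 = 0 \<Longrightarrow>
     (\<exists>z. f z \<noteq> 0) \<Longrightarrow> (\<exists>b\<in>grid D. 1 \<le> norm b \<and> (\<forall>v. norm v < c \<longrightarrow>
       (\<exists>t. norm (v + t *s b) < 1 / 2 \<and> f (v + t *s b) = 0) \<and> (\<exists>t. f (v + t *s b) \<noteq> 0)))"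
    using zeros_on_nearby_lines[where 'n = 'n, of D] by blast
  define G where "G = {b \<in> (grid D :: (complex ^ 'n) set). 1 \<le> norm b}"
  have finG: "finite G" unfolding G_def by (rule finite_subset[OF _ finite_grid[of D]]) auto
  let ?d = "2 * CARD('n) - 2"
  define C1 where "C1 = 16 * real D * c\<^sup>2 * 4 ^ (2 * CARD('n)) / c ^ (2 * CARD('n))"
  have C1: "C1 \<ge> 0" by (simp add: C1_def)
  have *: "real (card F) * \<delta> ^ ?d \<le> (real (card G) * C1) * r ^ ?d"
    if P: "line_poly D P" "\<exists>z. P z \<noteq> 0" and \<delta>: "0 < \<delta>" "\<delta> \<le> r"
      and F: "finite F" "F \<subseteq> {z. P z = 0} \<inter> cball a r"
      and sep: "\<forall>x\<in>F. \<forall>y\<in>F. x \<noteq> y \<longrightarrow> \<delta> \<le> dist x y"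
    for P :: "complex ^ 'n \<Rightarrow> complex" and a r \<delta> F
  proof -
    define good where "good b w \<longleftrightarrow> (\<forall>v. norm v < c \<longrightarrow>
       (\<exists>t. norm (v + t *s b) < 1 / 2 \<and> P (w + \<delta> *\<^sub>R (v + t *s b)) = 0) \<and>
       (\<exists>t. P (w + \<delta> *\<^sub>R (v + t *s b)) \<noteq> 0))" for b w
    have "\<exists>b\<in>G. good b w" if "w \<in> F" for w
    proof -
      obtain z where z: "P z \<noteq> 0" using P by blast
      have "P (w + \<delta> *\<^sub>R ((1 / \<delta>) *\<^sub>R (z - w))) \<noteq> 0" using z \<delta> by simp
      then show ?thesis
        using c(3)[OF line_poly_affine[OF P(1), of w \<delta>]] F that unfolding G_def good_def by fastforce
    qed
    then obtain \<beta> where \<beta>: "\<And>w. w \<in> F \<Longrightarrow> \<beta> w \<in> G" "\<And>w. w \<in> F \<Longrightarrow> good (\<beta> w) w"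
      by metis
    have one: "real (card {w \<in> F. \<beta> w = b}) * \<delta> ^ ?d \<le> C1 * r ^ ?d" if b: "b \<in> G" for b
    proof -
      have "real (card {w \<in> F. \<beta> w = b}) * c ^ (2 * CARD('n)) * \<delta> ^ ?d
        \<le> 16 * real D * c\<^sup>2 * 4 ^ (2 * CARD('n)) * r ^ ?d"
      proof (rule packing_one_direction[OF P(1) c(1,2) _ \<delta>, where b = b and a = a])
        show "b \<noteq> 0" using b by (auto simp: G_def)
        show "(\<exists>t. norm (v + t *s b) < 1 / 2 \<and> P (w + \<delta> *\<^sub>R (v + t *s b)) = 0) \<and>
           (\<exists>t. P (w + \<delta> *\<^sub>R (v + t *s b)) \<noteq> 0)" if "w \<in> {w \<in> F. \<beta> w = b}" "norm v < c" for w v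
          using \<beta>(2)[of w] that unfolding good_def by blast
      qed (use F sep in auto)
      then show ?thesis using c(1) by (simp add: C1_def divide_simps mult_ac)
    qed
    have "F = (\<Union>b\<in>G. {w \<in> F. \<beta> w = b})" using \<beta>(1) by auto
    then have "card F \<le> (\<Sum>b\<in>G. card {w \<in> F. \<beta> w = b})"
      using card_UN_le[OF finG, of "\<lambda>b. {w \<in> F. \<beta> w = b}"] by simp
    then have "real (card F) * \<delta> ^ ?d \<le> real (\<Sum>b\<in>G. card {w \<in> F. \<beta> w = b}) * \<delta> ^ ?d"
      using \<delta> by (intro mult_right_mono of_nat_mono) auto
    also have "\<dots> = (\<Sum>b\<in>G. real (card {w \<in> F. \<beta> w = b}) * \<delta> ^ ?d)"
      by (simp add: sum_distrib_right)
    also have "\<dots> \<le> (\<Sum>b\<in>G. C1 * r ^ ?d)" by (intro sum_mono one)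
    finally show ?thesis by (simp add: mult.assoc)
  qed
  have "0 \<le> real (card G) * C1" using C1 by simp
  then show thesis using * by (rule that)
qed

section \<open>Area growth of algebraic hypersurfaces\<close>

lemma maximal_separated_subset:
  fixes A :: "'a::metric_space set"
  assumes bound: "\<And>F. finite F \<Longrightarrow> F \<subseteq> A \<Longrightarrow> (\<forall>x\<in>F. \<forall>y\<in>F. x \<noteq> y \<longrightarrow> \<delta> \<le> dist x y) \<Longrightarrow> card F \<le> N"
    and \<delta>: "0 < \<delta>"
  obtains F where "finite F" "F \<subseteq> A" "\<forall>x\<in>F. \<forall>y\<in>F. x \<noteq> y \<longrightarrow> \<delta> \<le> dist x y" "A \<subseteq> (\<Union>x\<in>F. cball x \<delta>)"
proof -
  define sep where "sep F \<longleftrightarrow> finite F \<and> F \<subseteq> A \<and> (\<forall>x\<in>F. \<forall>y\<in>F. x \<noteq> y \<longrightarrow> \<delta> \<le> dist x y)" for F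
  have "sep {}" by (simp add: sep_def)
  moreover have "\<forall>F. sep F \<longrightarrow> card F < Suc N" using bound by (auto simp: sep_def less_Suc_eq_le)
  ultimately obtain F where F: "sep F" "\<And>F'. sep F' \<Longrightarrow> card F' \<le> card F"
    using ex_has_greatest_nat[of sep "{}" card "Suc N"] by blast
  have "A \<subseteq> (\<Union>x\<in>F. cball x \<delta>)"
  proof (rule ccontr)
    assume "\<not> ?thesis"
    then obtain a where a: "a \<in> A" "\<And>x. x \<in> F \<Longrightarrow> \<delta> < dist x a" by (force simp: not_le)
    then have "a \<notin> F" using \<delta> by force
    moreover have "sep (insert a F)"
      using F(1) a by (auto simp: sep_def dist_commute intro: less_imp_le)
    ultimately show False using F(2)[of "insert a F"] F(1) by (simp add: sep_def)
  qed
  then show thesis using that F(1) by (auto simp: sep_def)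
qed

lemma hausdorff_premeasure_le_cover:
  fixes A :: "'a::{euclidean_space} set"
  assumes F: "finite F" "A \<subseteq> (\<Union>x\<in>F. cball x \<delta>)" and \<delta>: "0 < \<delta>" "2 * \<delta> \<le> \<delta>'"
  shows "hausdorff_premeasure d \<delta>' A \<le> ennreal (real (card F) * (unit_ball_vol (real d) * \<delta> ^ d))"
proof -
  obtain h where "bij_betw h {0..<card F} F" using ex_bij_betw_nat_finite[OF F(1)] by blast
  then have h: "h ` {0..<card F} = F" by (simp add: bij_betw_def)
  define C where "C i = (if i < card F then cball (h i) \<delta> else {})" for i
  have cover: "A \<subseteq> (\<Union>i. C i)"
  proof
    fix a assume "a \<in> A"
    then obtain x where x: "x \<in> F" "a \<in> cball x \<delta>" using F(2) by blast
    have "x \<in> h ` {0..<card F}" using x(1) by (simp only: h)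
    then obtain i where i: "i < card F" "x = h i" by auto
    have "a \<in> C i" using x i by (simp add: C_def)
    then show "a \<in> (\<Union>i. C i)" by blast
  qed
  have "hausdorff_premeasure d \<delta>' A \<le> (\<Sum>i. if C i = {} then 0
                else ennreal (unit_ball_vol (real d) * (diameter (C i) / 2) ^ d))"
    unfolding hausdorff_premeasure_def
  proof (rule Inf_lower, rule CollectI, intro exI[of _ C] conjI refl allI cover)
    show "bounded (C i)" "diameter (C i) \<le> \<delta>'" for i using \<delta> by (auto simp: C_def)
  qed
  also have "\<dots> = (\<Sum>i<card F. if C i = {} then 0
                else ennreal (unit_ball_vol (real d) * (diameter (C i) / 2) ^ d))"
    by (intro suminf_finite) (auto simp: C_def)
  also have "\<dots> = (\<Sum>i<card F. ennreal (unit_ball_vol (real d) * \<delta> ^ d))"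
    using \<delta> by (intro sum.cong) (auto simp: C_def)
  also have "\<dots> = ennreal (real (card F) * (unit_ball_vol (real d) * \<delta> ^ d))"
    using \<delta> by (simp add: ennreal_mult ennreal_of_nat_eq_real_of_nat)
  finally show ?thesis .
qed

text \<open>The left-hand side is either the value of the set function on the right or, by the convention for
set functions that are not measures, \<open>0\<close>.\<close>

lemma emeasure_hausdorff_le:
  "emeasure (hausdorff_measure d) A \<le> (SUP \<delta>\<in>{0<..}. hausdorff_premeasure d \<delta> A)"
  unfolding hausdorff_measure_def by (simp add: emeasure_measure_of_conv)

text \<open>The balls of radius \<open>\<delta>\<close> around a maximal \<open>\<delta>\<close>-separated subset cover, and their number is
controlled by the packing bound. The constant does not depend on the centre; this uniformity is
what the theorem needs.\<close>

lemma zero_set_area_growth: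
  fixes P :: "complex ^ 'n \<Rightarrow> complex"
  assumes P: "line_poly D P" and nz: "\<exists>z. P z \<noteq> 0"
  shows "\<exists>C\<ge>0. \<forall>a. \<forall>r>0. emeasure (hausdorff_measure (2 * (CARD('n) - 1))) ({z. P z = 0} \<inter> cball a r)
            \<le> ennreal (C * r ^ (2 * (CARD('n) - 1)))"
proof -
  let ?d = "2 * (CARD('n) - 1)"
  have d: "2 * CARD('n) - 2 = ?d" by simp
  obtain C where C0: "0 \<le> C"
    and pack: "\<And>(P :: complex ^ 'n \<Rightarrow> complex) a r \<delta> F. line_poly D P \<Longrightarrow> \<exists>z. P z \<noteq> 0 \<Longrightarrow>
       0 < \<delta> \<Longrightarrow> \<delta> \<le> r \<Longrightarrow> finite F \<Longrightarrow> F \<subseteq> {z. P z = 0} \<inter> cball a r \<Longrightarrow>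
       \<forall>x\<in>F. \<forall>y\<in>F. x \<noteq> y \<longrightarrow> \<delta> \<le> dist x y \<Longrightarrow>
       real (card F) * \<delta> ^ (2 * CARD('n) - 2) \<le> C * r ^ (2 * CARD('n) - 2)"
    by (fact packing[where D = D and 'n = 'n])
  note C = C0 pack[OF P nz, unfolded d]
  define V where "V = unit_ball_vol (real ?d)"
  have V: "V \<ge> 0" by (simp add: V_def)
  have "emeasure (hausdorff_measure ?d) ({z. P z = 0} \<inter> cball a r) \<le> ennreal (C * V * r ^ ?d)"
    if r: "r > 0" for a r
  proof (rule order_trans[OF emeasure_hausdorff_le], rule SUP_least)
    fix \<delta>' :: real assume "\<delta>' \<in> {0<..}"
    define \<delta> where "\<delta> = min (\<delta>' / 2) r"
    have \<delta>: "0 < \<delta>" "\<delta> \<le> r" "2 * \<delta> \<le> \<delta>'" using r \<open>\<delta>' \<in> {0<..}\<close> by (auto simp: \<delta>_def)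
    let ?A = "{z. P z = 0} \<inter> cball a r"
    have "card F \<le> nat \<lfloor>C * r ^ ?d / \<delta> ^ ?d\<rfloor>"
      if "finite F" "F \<subseteq> ?A" "\<forall>x\<in>F. \<forall>y\<in>F. x \<noteq> y \<longrightarrow> \<delta> \<le> dist x y" for F
      using C(2)[OF \<delta>(1,2) that] \<delta>(1) by (intro le_nat_floor) (simp add: le_divide_eq)
    then obtain F where F: "finite F" "F \<subseteq> ?A" "\<forall>x\<in>F. \<forall>y\<in>F. x \<noteq> y \<longrightarrow> \<delta> \<le> dist x y"
        "?A \<subseteq> (\<Union>x\<in>F. cball x \<delta>)"
      using maximal_separated_subset[of ?A \<delta> "nat \<lfloor>C * r ^ ?d / \<delta> ^ ?d\<rfloor>"] \<delta>(1) by metis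
    have "hausdorff_premeasure ?d \<delta>' ?A \<le> ennreal (real (card F) * (V * \<delta> ^ ?d))"
      unfolding V_def by (rule hausdorff_premeasure_le_cover[OF F(1,4) \<delta>(1,3)])
    also have "\<dots> \<le> ennreal (C * V * r ^ ?d)"
      using mult_left_mono[OF C(2)[OF \<delta>(1,2) F(1-3)] V] by (intro ennreal_leI) (simp add: mult_ac)
    finally show "hausdorff_premeasure ?d \<delta>' ?A \<le> ennreal (C * V * r ^ ?d)" .
  qed
  then show ?thesis using C(1) V by (intro exI[of _ "C * V"]) auto
qed

lemma polynomial_map_line_poly:
  fixes P :: "complex ^ 'n \<Rightarrow> complex"
  assumes "polynomial_map P"
  shows "\<exists>D. line_poly D P"
proof -
  obtain S c where S: "finite S" "\<And>z. P z = (\<Sum>m\<in>S. c m * (\<Prod>i\<in>UNIV. (z $ i) ^ m i))"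
    using assms unfolding polynomial_map_def by blast
  define D where "D = (\<Sum>m\<in>S. \<Sum>i\<in>UNIV. m i)"
  have "line_poly D P"
    unfolding line_poly_def
  proof (intro allI)
    fix a b
    define q :: "('n \<Rightarrow> nat) \<Rightarrow> complex poly" where "q m = (\<Prod>i\<in>UNIV. [:a $ i, b $ i:] ^ m i)" for m
    define p where "p = (\<Sum>m\<in>S. smult (c m) (q m))"
    have "degree (q m) \<le> D" if "m \<in> S" for m
    proof -
      have "degree (q m) \<le> (\<Sum>i\<in>UNIV. degree ([:a $ i, b $ i:] ^ m i))"
        unfolding q_def by (rule degree_prod_sum_le[unfolded o_def]) simp
      also have "\<dots> \<le> (\<Sum>i\<in>UNIV. m i)"
      proof (rule sum_mono)
        fix i
        have "degree ([:a $ i, b $ i:] ^ m i) \<le> degree [:a $ i, b $ i:] * m i" by (rule degree_power_le)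
        also have "\<dots> \<le> 1 * m i" by (intro mult_right_mono) auto
        finally show "degree ([:a $ i, b $ i:] ^ m i) \<le> m i" by simp
      qed
      also have "\<dots> \<le> D" unfolding D_def using S(1) that by (intro member_le_sum) auto
      finally show ?thesis .
    qed
    then have "degree p \<le> D" unfolding p_def
      by (intro degree_sum_le S) (auto intro: order_trans[OF degree_smult_le])
    moreover have "P (a + t *s b) = poly p t" for t
      by (simp add: S(2) p_def q_def poly_sum poly_prod mult.commute)
    ultimately show "\<exists>p. degree p \<le> D \<and> (\<forall>t. P (a + t *s b) = poly p t)" by blast
  qed
  then show ?thesis ..
qed

lemma continuous_polynomial_map:
  fixes P :: "complex ^ 'n \<Rightarrow> complex"
  assumes "polynomial_map P"
  shows "continuous_on UNIV P"
proof -
  obtain S c where S: "\<And>z. P z = (\<Sum>m\<in>S. c m * (\<Prod>i\<in>UNIV. (z $ i) ^ m i))"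
    using assms unfolding polynomial_map_def by blast
  show ?thesis unfolding S[abs_def] by (intro continuous_intros)
qed

section \<open>Convolutions of test functions\<close>

text \<open>Test functions are handled through their directional derivatives, and averages over balls are
convolutions with a kernel. Kernels are only required to be locally integrable: besides the
normalised indicator of a ball, \<open>|w|\<^sup>2\<close> will serve as a kernel.\<close>

definition ddir :: "'a::real_normed_vector \<Rightarrow> ('a \<Rightarrow> complex) \<Rightarrow> 'a \<Rightarrow> complex" where
  "ddir v u x = frechet_derivative u (at x) v"

definition test_fun :: "('a::real_normed_vector \<Rightarrow> complex) \<Rightarrow> bool" where
  "test_fun u \<longleftrightarrow> (\<forall>k. C_k k u) \<and> (\<exists>K. \<forall>x. K < norm x \<longrightarrow> u x = 0)"

definition loc_integrable :: "('a::euclidean_space \<Rightarrow> real) \<Rightarrow> bool" where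
  "loc_integrable k \<longleftrightarrow> k \<in> borel_measurable borel \<and> (\<forall>R. set_integrable lborel (cball 0 R) k)"

definition conv :: "('a::euclidean_space \<Rightarrow> real) \<Rightarrow> ('a \<Rightarrow> complex) \<Rightarrow> 'a \<Rightarrow> complex" where
  "conv k u x = (LINT w|lborel. k w *\<^sub>R u (x - w))"

lemma test_fun_C_k: "test_fun u \<Longrightarrow> C_k k u"
  by (simp add: test_fun_def)

lemma test_fun_differentiable: "test_fun u \<Longrightarrow> u differentiable (at x)"
  using test_fun_C_k[of u "Suc 0"] by simp

lemma test_fun_has_derivative:
  "test_fun u \<Longrightarrow> (u has_derivative (\<lambda>v. ddir v u x)) (at x)"
  unfolding ddir_def by (metis frechet_derivative_works test_fun_differentiable)

lemma test_fun_continuous: "test_fun u \<Longrightarrow> continuous_on UNIV u"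
  using test_fun_C_k[of u 0] by simp

lemma test_fun_support:
  assumes "test_fun u"
  obtains K where "0 < K" "\<And>x. K < norm x \<Longrightarrow> u x = 0"
proof -
  obtain K where K: "\<And>x. K < norm x \<Longrightarrow> u x = 0" using assms by (auto simp: test_fun_def)
  show thesis by (rule that[of "max K 1"]) (use K in auto)
qed

lemma ddir_eq_0_outside_support:
  assumes u: "test_fun u" and K: "\<And>x. K < norm x \<Longrightarrow> u x = 0" and x: "K < norm x"
  shows "ddir v u x = 0"
proof -
  have "((\<lambda>_. 0) has_derivative (\<lambda>_. 0)) (at x)" by (rule has_derivative_const)
  then have "(u has_derivative (\<lambda>_. 0)) (at x)"
  proof (rule has_derivative_transform_within_open)
    show "open (- cball (0::'a) K)" by (simp add: open_Compl)
  qed (use x K in auto)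
  then have "(\<lambda>v. ddir v u x) = (\<lambda>_. 0)"
    using test_fun_has_derivative[OF u] has_derivative_unique by blast
  then show ?thesis by meson
qed

lemma test_fun_ddir:
  assumes "test_fun u"
  shows "test_fun (ddir v u)"
proof -
  obtain K where K: "0 < K" "\<And>x. K < norm x \<Longrightarrow> u x = 0" using test_fun_support[OF assms] by blast
  have "ddir v u x = 0" if "K < norm x" for x
    using ddir_eq_0_outside_support[OF assms K(2) that] .
  moreover have "C_k k (ddir v u)" for k
    using test_fun_C_k[OF assms, of "Suc k"] by (simp add: ddir_def[abs_def])
  ultimately show ?thesis unfolding test_fun_def by blast
qed

lemma C_k_add: "C_k k u \<Longrightarrow> C_k k v \<Longrightarrow> C_k k (\<lambda>x. u x + v x)"
proof (induction k arbitrary: u v)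
  case (Suc k)
  have "frechet_derivative (\<lambda>x. u x + v x) (at x) = (\<lambda>h. frechet_derivative u (at x) h + frechet_derivative v (at x) h)" for x
    using Suc.prems by (intro frechet_derivative_at[symmetric] has_derivative_add)
      (auto simp: frechet_derivative_works[symmetric])
  then show ?case using Suc by (auto intro!: derivative_intros)
qed (auto intro: continuous_intros)

lemma C_k_cmult: "C_k k u \<Longrightarrow> C_k k (\<lambda>x. c * u x)" for u :: "'a::real_normed_vector \<Rightarrow> complex"
proof (induction k arbitrary: u)
  case (Suc k)
  have "frechet_derivative (\<lambda>x. c * u x) (at x) = (\<lambda>h. c * frechet_derivative u (at x) h)" for x
    using Suc.prems by (intro frechet_derivative_at[symmetric] has_derivative_mult_right)
      (auto simp: frechet_derivative_works[symmetric])
  then show ?case using Suc by (auto intro!: derivative_intros)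
qed (auto intro: continuous_intros)

lemma test_fun_cmult: "test_fun u \<Longrightarrow> test_fun (\<lambda>x. c * u x)"
  unfolding test_fun_def by (auto intro: C_k_cmult)

lemma test_fun_add:
  assumes "test_fun u" "test_fun v"
  shows "test_fun (\<lambda>x. u x + v x)"
proof -
  obtain K where K: "0 < K" "\<And>x. K < norm x \<Longrightarrow> u x = 0" using test_fun_support[OF assms(1)] by blast
  obtain L where L: "0 < L" "\<And>x. L < norm x \<Longrightarrow> v x = 0" using test_fun_support[OF assms(2)] by blast
  have "\<forall>x. max K L < norm x \<longrightarrow> u x + v x = 0" using K L by auto
  then show ?thesis using assms C_k_add unfolding test_fun_def by blast
qed

lemma test_fun_zero: "test_fun (\<lambda>x::'a::real_normed_vector. 0)"
proof -
  have "C_k k (\<lambda>x::'a. 0 :: complex)" for k by (induction k) auto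
  then have "\<forall>k. C_k k (\<lambda>x::'a. 0 :: complex)" by blast
  then show ?thesis unfolding test_fun_def by auto
qed

lemma test_fun_sum: "(\<And>i. i \<in> I \<Longrightarrow> test_fun (u i)) \<Longrightarrow> test_fun (\<lambda>x. \<Sum>i\<in>I. u i x)"
  by (induction I rule: infinite_finite_induct) (simp_all add: test_fun_zero test_fun_add)

text \<open>One operator for both parts of the differential: \<open>c = - \<i>\<close> gives the complex linear part and
\<open>c = \<i>\<close> the conjugate linear part.\<close>

definition wirtinger :: "complex \<Rightarrow> (complex ^ 'n \<Rightarrow> complex) \<Rightarrow> complex ^ 'n \<Rightarrow> complex ^ 'n \<Rightarrow> complex" where
  "wirtinger c u z v = 1 / 2 * ddir v u z + c / 2 * ddir (\<i> *s v) u z"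

lemma del_fun_eq: "del_fun u z v = wirtinger (- \<i>) u z v"
  and delbar_fun_eq: "delbar_fun u z v = wirtinger \<i> u z v"
  by (simp_all add: del_fun_def delbar_fun_def ddir_def wirtinger_def diff_divide_distrib add_divide_distrib)

lemma test_fun_wirtinger: "test_fun u \<Longrightarrow> test_fun (\<lambda>z. wirtinger c u z v)"
  unfolding wirtinger_def by (intro test_fun_add test_fun_cmult test_fun_ddir)

lemma continuous_compact_support_bounded:
  fixes u :: "'a::euclidean_space \<Rightarrow> complex"
  assumes u: "continuous_on UNIV u" and K: "\<And>x. K < norm x \<Longrightarrow> u x = 0"
  obtains B where "0 < B" "\<And>x. norm (u x) \<le> B"
proof -
  have "compact (u ` cball 0 K)" by (intro compact_continuous_image continuous_on_subset[OF u]) auto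
  then obtain B where B: "B > 0" "\<forall>y\<in>u ` cball 0 K. norm y \<le> B"
    using compact_imp_bounded bounded_pos by metis
  have "norm (u x) \<le> B" for x
    using B K[of x] by (cases "K < norm x") (auto simp: less_imp_le)
  then show thesis using that B by blast
qed

lemma weighted_integrable:
  fixes u :: "'a::euclidean_space \<Rightarrow> complex"
  assumes k: "loc_integrable k" and u: "continuous_on UNIV u" and K: "\<And>x. K < norm x \<Longrightarrow> u x = 0"
  shows "integrable lborel (\<lambda>w. k w *\<^sub>R u w)"
proof -
  obtain B where B: "0 < B" "\<And>x. norm (u x) \<le> B"
    using continuous_compact_support_bounded[OF u K] by blast
  have [measurable]: "u \<in> borel_measurable borel" "k \<in> borel_measurable borel"
    using u k by (auto simp: borel_measurable_continuous_onI loc_integrable_def)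
  have "integrable lborel (\<lambda>w. B * (indicat_real (cball 0 K) w *\<^sub>R k w))"
    using k unfolding loc_integrable_def set_integrable_def by (intro integrable_mult_right) auto
  then show ?thesis
  proof (rule Bochner_Integration.integrable_bound)
    show "AE w in lborel. norm (k w *\<^sub>R u w) \<le> norm (B * (indicat_real (cball 0 K) w *\<^sub>R k w))"
    proof (rule AE_I2)
      fix w
      show "norm (k w *\<^sub>R u w) \<le> norm (B * (indicat_real (cball 0 K) w *\<^sub>R k w))"
        using B(2)[of w] B(1) K[of w]
        by (cases "norm w \<le> K") (auto simp: abs_mult mult.commute[of B] intro: mult_left_mono)
    qed
  qed measurable
qed

lemma loc_integrable_bounded:
  fixes k :: "'a::euclidean_space \<Rightarrow> real"
  assumes k: "k \<in> borel_measurable borel" and B: "\<And>w. \<bar>k w\<bar> \<le> B"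
  shows "loc_integrable k"
  unfolding loc_integrable_def set_integrable_def
proof (intro conjI k allI)
  fix R
  have "integrable lborel (\<lambda>w::'a. B * indicat_real (cball 0 R) w)"
    by (auto intro!: integrable_real_indicator emeasure_lborel_cball_finite[unfolded infinity_ennreal_def])
  then show "integrable lborel (\<lambda>w. indicat_real (cball 0 R) w *\<^sub>R k w)"
  proof (rule Bochner_Integration.integrable_bound)
    show "(\<lambda>w. indicat_real (cball 0 R) w *\<^sub>R k w) \<in> borel_measurable lborel"
      using k by (intro borel_measurable_scaleR borel_measurable_indicator) auto
    show "AE w in lborel. norm (indicat_real (cball 0 R) w *\<^sub>R k w) \<le> norm (B * indicat_real (cball 0 R) w)"
      using B order_trans[OF B abs_ge_self] by (intro AE_I2) (simp add: indicator_def)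
  qed
qed

lemma conv_integrable:
  fixes u :: "'a::euclidean_space \<Rightarrow> complex"
  assumes k: "loc_integrable k" and u: "test_fun u"
  shows "integrable lborel (\<lambda>w. k w *\<^sub>R u (x - w))"
proof -
  obtain K where K: "0 < K" "\<And>x. K < norm x \<Longrightarrow> u x = 0" using test_fun_support[OF u] by blast
  show ?thesis
  proof (rule weighted_integrable[OF k, where K = "norm x + K"])
    show "continuous_on UNIV (\<lambda>w. u (x - w))"
      by (intro continuous_on_compose2[OF test_fun_continuous[OF u]] continuous_intros) auto
    show "u (x - w) = 0" if "norm x + K < norm w" for w
    proof (rule K(2))
      show "K < norm (x - w)" using that norm_triangle_ineq2[of w x] by (simp add: norm_minus_commute)
    qed
  qed
qed

lemma test_fun_weighted_integrable:
  assumes "loc_integrable k" "test_fun u"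
  shows "integrable lborel (\<lambda>w. k w *\<^sub>R u w)"
  by (rule test_fun_support[OF assms(2)]) (rule weighted_integrable[OF assms(1) test_fun_continuous[OF assms(2)]])

lemma test_fun_integrable: "test_fun u \<Longrightarrow> integrable lborel u" for u :: "'a::euclidean_space \<Rightarrow> complex"
  using test_fun_weighted_integrable[OF loc_integrable_bounded[of "\<lambda>_. 1" 1], of u] by simp

lemma lborel_reflect: "distr lborel borel (\<lambda>w::'a::euclidean_space. t - w) = lborel"
proof -
  show ?thesis using lborel_affine[of "-1::real" t] by (simp add: density_1)
qed

lemma integral_reflect:
  fixes f :: "'a::euclidean_space \<Rightarrow> 'b::{banach, second_countable_topology}"
  assumes "f \<in> borel_measurable borel"
  shows "(LINT w|lborel. f (t - w)) = (LINT w|lborel. f w)"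
proof -
  have "(LINT w|lborel. f w) = (LINT w|distr lborel borel (\<lambda>w. t - w). f w)"
    by (simp only: lborel_reflect)
  also have "\<dots> = (LINT w|lborel. f (t - w))"
    using assms by (intro integral_distr) auto
  finally show ?thesis by simp
qed

text \<open>The partial derivatives are uniformly continuous because of their compact support, so the
mean value inequality gives a remainder estimate that is uniform in \<open>x\<close>.\<close>

lemma test_fun_uniform_derivative:
  fixes u :: "'a::euclidean_space \<Rightarrow> complex"
  assumes u: "test_fun u" and e: "e > 0"
  shows "\<exists>d>0. \<forall>x h. norm h < d \<longrightarrow> norm (u (x + h) - u x - ddir h u x) \<le> e * norm h"
proof -
  have der: "(u has_derivative (\<lambda>v. ddir v u x)) (at x)" for x using test_fun_has_derivative[OF u] .
  have lin: "bounded_linear (\<lambda>v. ddir v u x)" for x using der has_derivative_bounded_linear by blast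
  define n where "n = real DIM('a)"
  have n: "n > 0" by (simp add: n_def)
  have "\<exists>d>0. \<forall>x y. dist y x < d \<longrightarrow> norm (ddir b u y - ddir b u x) \<le> e / n" for b
  proof -
    have tb: "test_fun (ddir b u)" using test_fun_ddir[OF u] .
    obtain K where K: "0 < K" "\<And>x. K < norm x \<Longrightarrow> ddir b u x = 0" using test_fun_support[OF tb] by blast
    have "uniformly_continuous_on (cball 0 (K + 1)) (ddir b u)"
      by (rule compact_uniformly_continuous[OF continuous_on_subset[OF test_fun_continuous[OF tb]]]) auto
    then obtain d where d: "d > 0" "\<And>x y. x \<in> cball 0 (K+1) \<Longrightarrow> y \<in> cball 0 (K+1) \<Longrightarrow> dist y x < d \<Longrightarrow>
        dist (ddir b u y) (ddir b u x) < e / n"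
      unfolding uniformly_continuous_on_def using divide_pos_pos[OF e n] by blast
    have "norm (ddir b u y - ddir b u x) \<le> e / n" if xy: "dist y x < min d 1" for x y
    proof (cases "norm x \<le> K \<or> norm y \<le> K")
      case True
      have "norm x \<le> norm y + dist y x" "norm y \<le> norm x + dist y x"
        using norm_triangle_ineq2[of x y] norm_triangle_ineq2[of y x] by (auto simp: dist_norm norm_minus_commute)
      then have "x \<in> cball 0 (K+1)" "y \<in> cball 0 (K+1)" using True xy by auto
      then show ?thesis using d xy by (auto simp: dist_norm less_imp_le)
    next
      case False
      then show ?thesis using K e n by simp
    qed
    then show ?thesis using d by (intro exI[of _ "min d 1"]) auto
  qed
  then obtain d where d: "\<And>b. d b > 0" "\<And>b x y. dist y x < d b \<Longrightarrow> norm (ddir b u y - ddir b u x) \<le> e / n"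
    by metis
  define d0 where "d0 = Min (d ` Basis)"
  have d0: "d0 > 0" "\<And>b. b \<in> Basis \<Longrightarrow> d0 \<le> d b" using d(1) by (auto simp: d0_def)
  have "norm (u (x + h) - u x - ddir h u x) \<le> e * norm h" if h: "norm h < d0" for x h
  proof -
    have "norm (u (x + h) - u x - (\<lambda>v. ddir v u x) (x + h - x)) \<le> norm (x + h - x) * e"
    proof (rule differentiable_bound_linearization[where S = "ball x d0" and f' = "\<lambda>y v. ddir v u y"])
      show "x + t *\<^sub>R (x + h - x) \<in> ball x d0" if "t \<in> {0..1}" for t
      proof -
        have "norm (t *\<^sub>R h) \<le> norm h" using that by (simp add: mult_left_le_one_le)
        then show ?thesis using h by (simp add: dist_norm)
      qed
      show "(u has_derivative (\<lambda>v. ddir v u y)) (at y within ball x d0)" for y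
        using der by (rule has_derivative_at_withinI)
      show "x \<in> ball x d0" using d0 by simp
      fix y assume near: "y \<in> ball x d0"
      show "onorm ((\<lambda>v. ddir v u y) - (\<lambda>v. ddir v u x)) \<le> e"
        unfolding fun_diff_def
      proof (rule onorm_le)
        fix v :: 'a
        have rep: "ddir v u z = (\<Sum>b\<in>Basis. (v \<bullet> b) *\<^sub>R ddir b u z)" for z
        proof -
          have "ddir (\<Sum>b\<in>Basis. (v \<bullet> b) *\<^sub>R b) u z = (\<Sum>b\<in>Basis. (v \<bullet> b) *\<^sub>R ddir b u z)"
            using linear_sum[OF bounded_linear.linear[OF lin[of z]], of "\<lambda>b. (v \<bullet> b) *\<^sub>R b" Basis]
              linear_cmul[OF bounded_linear.linear[OF lin[of z]]] by simp
          then show ?thesis by (simp only: euclidean_representation)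
        qed
        have "ddir v u y - ddir v u x = (\<Sum>b\<in>Basis. (v \<bullet> b) *\<^sub>R (ddir b u y - ddir b u x))"
          by (simp only: rep scaleR_diff_right sum_subtractf)
        also have "norm \<dots> \<le> (\<Sum>b\<in>(Basis::'a set). norm v * (e / n))"
        proof (rule order_trans[OF norm_sum], rule sum_mono)
          fix b :: 'a assume b: "b \<in> Basis"
          have "dist y x < d b" using near d0(2)[OF b] by (simp add: dist_commute)
          then show "norm ((v \<bullet> b) *\<^sub>R (ddir b u y - ddir b u x)) \<le> norm v * (e / n)"
            unfolding norm_scaleR by (intro mult_mono d(2)) (auto simp: Basis_le_norm[OF b])
        qed
        also have "\<dots> = e * norm v" using n by (simp add: n_def)
        finally show "norm (ddir v u y - ddir v u x) \<le> e * norm v" .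
      qed
    qed
    then show ?thesis by (simp add: mult.commute)
  qed
  then show ?thesis using d0(1) by blast
qed

text \<open>The uniform remainder estimate is integrated against the kernel; only the part of the kernel on a
fixed ball is involved, and it has finite mass \<open>I\<close>.\<close>

lemma conv_has_derivative:
  fixes u :: "'a::euclidean_space \<Rightarrow> complex"
  assumes k: "loc_integrable k" and u: "test_fun u"
  shows "(conv k u has_derivative (\<lambda>h. conv k (ddir h u) x)) (at x)"
  unfolding has_derivative_within_alt
proof (intro conjI allI impI)
  have der: "(u has_derivative (\<lambda>v. ddir v u x)) (at x)" for x using test_fun_has_derivative[OF u] .
  have lin: "linear (\<lambda>v. ddir v u x)" for x using der has_derivative_linear by blast
  have int: "integrable lborel (\<lambda>w. k w *\<^sub>R ddir h u (y - w))" for h y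
    using conv_integrable[OF k test_fun_ddir[OF u]] .
  have "linear (\<lambda>h. conv k (ddir h u) x)"
  proof (rule linearI)
    show "conv k (ddir (a + b) u) x = conv k (ddir a u) x + conv k (ddir b u) x" for a b
      unfolding conv_def using int by (simp add: linear_add[OF lin] scaleR_add_right)
    show "conv k (ddir (c *\<^sub>R a) u) x = c *\<^sub>R conv k (ddir a u) x" for a c
      unfolding conv_def by (simp only: linear_cmul[OF lin] scaleR_left_commute[of _ c] integral_scaleR_right)
  qed
  then show "bounded_linear (\<lambda>h. conv k (ddir h u) x)" by (simp add: linear_conv_bounded_linear)
  fix e :: real assume e: "e > 0"
  obtain K where K: "0 < K" "\<And>x. K < norm x \<Longrightarrow> u x = 0" using test_fun_support[OF u] by blast
  have K': "ddir h u x = 0" if "K < norm x" for h x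
    using ddir_eq_0_outside_support[OF u K(2) that] .
  \<comment> \<open>For \<open>y\<close> within distance 1 of \<open>x\<close>, all terms vanish for \<open>w\<close> outside the ball of radius \<open>R\<close>.\<close>
  define R where "R = norm x + 1 + K"
  define I where "I = (LINT w|lborel. indicat_real (cball 0 R) w *\<^sub>R \<bar>k w\<bar>)"
  have kint: "integrable lborel (\<lambda>w. indicat_real (cball 0 R) w *\<^sub>R \<bar>k w\<bar>)"
  proof -
    have "set_integrable lborel (cball 0 R) k" using k unfolding loc_integrable_def by blast
    from set_integrable_abs[OF this] show ?thesis unfolding set_integrable_def .
  qed
  have I: "I \<ge> 0" unfolding I_def by (intro integral_nonneg_AE) (auto simp: indicator_def)
  obtain d where d: "d > 0" "\<And>x h. norm h < d \<Longrightarrow> norm (u (x + h) - u x - ddir h u x) \<le> e / (I + 1) * norm h"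
    using test_fun_uniform_derivative[OF u, of "e / (I + 1)"] e I by (auto simp: divide_simps)
  show "\<exists>d>0. \<forall>y\<in>UNIV. norm (y - x) < d \<longrightarrow>
      norm (conv k u y - conv k u x - conv k (ddir (y - x) u) x) \<le> e * norm (y - x)"
  proof (intro exI[of _ "min d 1"] conjI ballI impI)
    fix y assume y: "norm (y - x) < min d 1"
    define h where "h = y - x"
    have "conv k u y - conv k u x - conv k (ddir h u) x =
      (LINT w|lborel. k w *\<^sub>R (u (y - w) - u (x - w) - ddir h u (x - w)))"
      unfolding conv_def using int conv_integrable[OF k u] by (simp add: scaleR_diff_right)
    also have "norm \<dots> \<le> (LINT w|lborel. (e / (I + 1) * norm h) * (indicat_real (cball 0 R) w *\<^sub>R \<bar>k w\<bar>))"
    proof (rule Bochner_Integration.integral_norm_bound_integral)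
      show "integrable lborel (\<lambda>w. k w *\<^sub>R (u (y - w) - u (x - w) - ddir h u (x - w)))"
        unfolding scaleR_diff_right using int conv_integrable[OF k u] by (intro Bochner_Integration.integrable_diff) auto
      show "integrable lborel (\<lambda>w. (e / (I + 1) * norm h) * (indicat_real (cball 0 R) w *\<^sub>R \<bar>k w\<bar>))"
        using kint by (rule integrable_mult_right)
      fix w
      show "norm (k w *\<^sub>R (u (y - w) - u (x - w) - ddir h u (x - w)))
         \<le> (e / (I + 1) * norm h) * (indicat_real (cball 0 R) w *\<^sub>R \<bar>k w\<bar>)"
      proof (cases "w \<in> cball 0 R")
        case True
        have "norm (u ((x - w) + h) - u (x - w) - ddir h u (x - w)) \<le> e / (I + 1) * norm h"
          using d(2)[of h "x - w"] y unfolding h_def by linarith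
        moreover have "(x - w) + h = y - w" by (simp add: h_def)
        ultimately have "norm (u (y - w) - u (x - w) - ddir h u (x - w)) \<le> e / (I + 1) * norm h"
          by simp
        then have "\<bar>k w\<bar> * norm (u (y - w) - u (x - w) - ddir h u (x - w)) \<le> \<bar>k w\<bar> * (e / (I + 1) * norm h)"
          by (rule mult_left_mono) simp
        then show ?thesis using True by (simp add: mult_ac)
      next
        case False
        then have "R < norm w" by simp
        moreover have "norm w \<le> norm (x - w) + norm x" "norm w \<le> norm (y - w) + norm y" "norm y \<le> norm x + norm (y - x)"
          using norm_triangle_ineq2[of w x] norm_triangle_ineq2[of w y] norm_triangle_ineq2[of y x]
          by (auto simp: norm_minus_commute)
        ultimately have "K < norm (x - w)" "K < norm (y - w)" using y by (auto simp: R_def)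
        then show ?thesis using K K' False by simp
      qed
    qed
    also have "\<dots> = e * norm h * (I / (I + 1))" unfolding I_def[symmetric] by (subst integral_mult_right_zero) (simp add: I_def)
    also have "\<dots> \<le> e * norm h * 1" using e I by (intro mult_left_mono) auto
    finally show "norm (conv k u y - conv k u x - conv k (ddir (y - x) u) x) \<le> e * norm (y - x)"
      by (simp add: h_def)
  qed (use d in auto)
qed

lemma ddir_conv:
  assumes "loc_integrable k" "test_fun u"
  shows "ddir v (conv k u) = conv k (ddir v u)"
proof
  fix x
  show "ddir v (conv k u) x = conv k (ddir v u) x"
    unfolding ddir_def[of v "conv k u"]
    using frechet_derivative_at[OF conv_has_derivative[OF assms, of x]] by metis
qed

lemma C_k_conv: "loc_integrable k \<Longrightarrow> test_fun u \<Longrightarrow> C_k m (conv k u)"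
proof (induction m arbitrary: u)
  case 0
  then show ?case using conv_has_derivative
    by (auto intro!: continuous_at_imp_continuous_on has_derivative_continuous)
next
  case (Suc m)
  have "(\<lambda>x. frechet_derivative (conv k u) (at x) v) = conv k (ddir v u)" for v
    using ddir_conv[OF Suc.prems, of v] by (auto simp: ddir_def[abs_def])
  then show ?case using Suc test_fun_ddir[OF Suc.prems(2)] conv_has_derivative[OF Suc.prems]
    by (simp add: differentiableI[OF conv_has_derivative[OF Suc.prems]])
qed

lemma conv_lincomb:
  assumes "loc_integrable k" "test_fun u" "test_fun v"
  shows "conv k (\<lambda>x. a * u x + b * v x) z = a * conv k u z + b * conv k v z"
proof -
  have "conv k (\<lambda>x. a * u x + b * v x) z
      = (LINT w|lborel. a * (k w *\<^sub>R u (z - w)) + b * (k w *\<^sub>R v (z - w)))"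
    unfolding conv_def by (simp add: scaleR_add_right mult_scaleR_right)
  also have "\<dots> = a * conv k u z + b * conv k v z"
    using Bochner_Integration.integral_add[OF integrable_mult_right[OF conv_integrable[OF assms(1,2)], of a z]
        integrable_mult_right[OF conv_integrable[OF assms(1,3)], of b z]]
    by (simp only: conv_def integral_mult_right_zero)
  finally show ?thesis .
qed

lemma conv_sum:
  assumes k: "loc_integrable k" and "\<And>i. i \<in> I \<Longrightarrow> test_fun (u i)"
  shows "conv k (\<lambda>x. \<Sum>i\<in>I. c i * u i x) z = (\<Sum>i\<in>I. c i * conv k (u i) z)"
  using assms(2)
proof (induction I rule: infinite_finite_induct)
  case (insert i I)
  have "test_fun (\<lambda>x. \<Sum>i\<in>I. c i * u i x)"
    using insert by (intro test_fun_sum test_fun_cmult) auto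
  from conv_lincomb[OF k _ this, of "u i" "c i" 1 z] insert show ?case by simp
qed (auto simp: conv_def)

lemma wirtinger_conv:
  assumes "loc_integrable k" "test_fun u"
  shows "wirtinger c (conv k u) z v = conv k (\<lambda>w. wirtinger c u w v) z"
  unfolding wirtinger_def ddir_conv[OF assms]
  by (rule conv_lincomb[symmetric]) (auto intro: assms test_fun_ddir)

section \<open>Averages of differential forms\<close>

lemma length_remove_nth: "i < length xs \<Longrightarrow> length (remove_nth i xs) = length xs - 1"
  by (simp add: remove_nth_def)

definition smooth_form :: "nat \<Rightarrow> ('n::finite) form \<Rightarrow> bool" where
  "smooth_form m \<eta> \<longleftrightarrow> (\<forall>vs. length vs = m \<longrightarrow> test_fun (\<lambda>z. \<eta> z vs))"

definition wirtinger_form :: "complex \<Rightarrow> ('n::finite) form \<Rightarrow> 'n form" where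
  "wirtinger_form c \<eta> z vs =
     (\<Sum>i<length vs. (- 1) ^ i * wirtinger c (\<lambda>x. \<eta> x (remove_nth i vs)) z (vs ! i))"

lemma del_eq: "del = wirtinger_form (- \<i>)"
  and delbar_eq: "delbar = wirtinger_form \<i>"
  by (simp_all add: fun_eq_iff del_def delbar_def wirtinger_form_def del_fun_eq delbar_fun_eq)

lemma smooth_form_wirtinger: "smooth_form m \<eta> \<Longrightarrow> smooth_form (Suc m) (wirtinger_form c \<eta>)"
  unfolding smooth_form_def wirtinger_form_def
  by (intro allI impI test_fun_sum test_fun_cmult test_fun_wirtinger) (auto simp: length_remove_nth)

text \<open>Differential operators with constant coefficients commute with convolutions. The hypothesis on
\<open>\<eta>'\<close> concerns only lists of the length \<open>m\<close>, because a form has no meaning on other lists.\<close>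

lemma wirtinger_form_conv:
  assumes k: "loc_integrable k" and \<eta>: "smooth_form m \<eta>" and vs: "length vs = Suc m"
    and \<eta>': "\<And>z ws. length ws = m \<Longrightarrow> \<eta>' z ws = conv k (\<lambda>w. \<eta> w ws) z"
  shows "wirtinger_form c \<eta>' z vs = conv k (\<lambda>w. wirtinger_form c \<eta> w vs) z"
proof -
  have len: "length (remove_nth i vs) = m" if "i < length vs" for i
    using that vs by (simp add: length_remove_nth)
  have t: "test_fun (\<lambda>w. \<eta> w (remove_nth i vs))" if "i < length vs" for i
    using \<eta> len[OF that] by (simp add: smooth_form_def)
  have "wirtinger_form c \<eta>' z vs =
      (\<Sum>i<length vs. (- 1) ^ i * conv k (\<lambda>w. wirtinger c (\<lambda>x. \<eta> x (remove_nth i vs)) w (vs ! i)) z)"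
    unfolding wirtinger_form_def
  proof (rule sum.cong[OF refl])
    fix i assume i: "i \<in> {..<length vs}"
    then have "(\<lambda>x. \<eta>' x (remove_nth i vs)) = conv k (\<lambda>w. \<eta> w (remove_nth i vs))"
      using \<eta>' len by auto
    then show "(- 1) ^ i * wirtinger c (\<lambda>x. \<eta>' x (remove_nth i vs)) z (vs ! i) =
        (- 1) ^ i * conv k (\<lambda>w. wirtinger c (\<lambda>x. \<eta> x (remove_nth i vs)) w (vs ! i)) z"
      using wirtinger_conv[OF k t] i by simp
  qed
  also have "\<dots> = conv k (\<lambda>w. wirtinger_form c \<eta> w vs) z"
    unfolding wirtinger_form_def using t by (intro conv_sum[OF k, symmetric] test_fun_wirtinger) auto
  finally show ?thesis .
qed

definition ball_kernel :: "real \<Rightarrow> complex ^ 'n \<Rightarrow> real" where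
  "ball_kernel r w = indicat_real (ball 0 r) w / measure lborel (ball (0 :: complex ^ 'n) r)"

lemma ball_kernel_measurable [measurable]: "ball_kernel r \<in> borel_measurable borel"
  unfolding ball_kernel_def[abs_def]
  by (intro borel_measurable_divide borel_measurable_indicator borel_measurable_const) auto

lemma ball_kernel_minus: "ball_kernel r (- w) = ball_kernel r w"
  by (simp add: ball_kernel_def indicator_def)

lemma ball_kernel_nonneg: "0 \<le> ball_kernel r w"
  by (simp add: ball_kernel_def)

lemma ball_kernel_bound: "\<bar>ball_kernel r w\<bar> \<le> 1 / measure lborel (ball (0 :: complex ^ 'n) r)"
  for w :: "complex ^ 'n"
  by (simp add: ball_kernel_def indicator_def)

lemma loc_integrable_ball_kernel: "loc_integrable (ball_kernel r)"
  by (rule loc_integrable_bounded[OF ball_kernel_measurable ball_kernel_bound])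

lemma ball_average_conv:
  assumes "continuous_on UNIV u"
  shows "ball_average r u z = conv (ball_kernel r) u z"
proof -
  have [measurable]: "u \<in> borel_measurable borel" using assms by (rule borel_measurable_continuous_onI)
  show ?thesis
    unfolding ball_average_def conv_def ball_kernel_def[symmetric]
    using integral_reflect[of "\<lambda>w. ball_kernel r w *\<^sub>R u (z - w)" z] by simp
qed

lemma test_fun_conv_ball_kernel:
  assumes "test_fun u"
  shows "test_fun (conv (ball_kernel r) u)"
proof -
  obtain K where K: "0 < K" "\<And>x. K < norm x \<Longrightarrow> u x = 0" using test_fun_support[OF assms] by blast
  have "conv (ball_kernel r) u x = 0" if x: "K + r < norm x" for x
  proof -
    have "ball_kernel r w *\<^sub>R u (x - w) = 0" for w
    proof (cases "norm w < r")
      case True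
      then have "K < norm (x - w)" using x norm_triangle_ineq2[of x w] by simp
      then show ?thesis using K by simp
    qed (simp add: ball_kernel_def)
    then show ?thesis by (simp only: conv_def Bochner_Integration.integral_zero)
  qed
  then show ?thesis
    using C_k_conv[OF loc_integrable_ball_kernel assms] unfolding test_fun_def by blast
qed

lemma test_form_smooth: "test_form p q \<eta> \<Longrightarrow> smooth_form (p + q) \<eta>"
  unfolding smooth_form_def test_fun_def
proof (intro allI impI conjI)
  fix vs :: "(complex ^ 'a) list" assume \<eta>: "test_form p q \<eta>" and vs: "length vs = p + q"
  show "C_k k (\<lambda>z. \<eta> z vs)" for k using \<eta> vs by (simp add: test_form_def)
  obtain K where K: "compact K" "\<And>z. z \<notin> K \<Longrightarrow> \<eta> z vs = 0"
    using \<eta> vs unfolding test_form_def by blast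
  obtain R where "\<And>z. z \<in> K \<Longrightarrow> norm z \<le> R"
    using compact_imp_bounded[OF K(1)] unfolding bounded_iff by blast
  then show "\<exists>R. \<forall>x. R < norm x \<longrightarrow> \<eta> x vs = 0" using K(2) by (meson not_le)
qed

definition form_average :: "real \<Rightarrow> ('n::finite) form \<Rightarrow> 'n form" where
  "form_average r \<eta> = (\<lambda>z vs. ball_average r (\<lambda>w. \<eta> w vs) z)"

lemma form_average_conv:
  assumes "smooth_form m \<eta>" "length vs = m"
  shows "form_average r \<eta> z vs = conv (ball_kernel r) (\<lambda>w. \<eta> w vs) z"
  using assms unfolding form_average_def smooth_form_def
  by (intro ball_average_conv test_fun_continuous) auto

lemma smooth_form_average:
  assumes "smooth_form m \<eta>"
  shows "smooth_form m (form_average r \<eta>)"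
proof -
  have "(\<lambda>z. form_average r \<eta> z vs) = conv (ball_kernel r) (\<lambda>w. \<eta> w vs)" if "length vs = m" for vs
    using form_average_conv[OF assms that] by auto
  then show ?thesis using assms test_fun_conv_ball_kernel unfolding smooth_form_def by auto
qed

text \<open>Averages of test forms are again test forms, so that the hypothesis on \<open>\<phi>\<close> can be applied to
them.\<close>

lemma test_form_average:
  assumes \<eta>: "test_form p q \<eta>"
  shows "test_form p q (form_average r \<eta>)"
proof -
  have s: "smooth_form (p + q) \<eta>" using test_form_smooth[OF \<eta>] .
  have conv: "form_average r \<eta> z vs = conv (ball_kernel r) (\<lambda>w. \<eta> w vs) z" if "length vs = p + q" for z vs
    using form_average_conv[OF s that] .
  have t: "test_fun (\<lambda>w. \<eta> w vs)" if "length vs = p + q" for vs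
    using s that by (simp add: smooth_form_def)
  have alt: "alternating_multilinear (p + q) (\<eta> z)" for z
    using \<eta> by (simp add: test_form_def of_type_def)
  have ty: "\<eta> z (map (\<lambda>v. c *s v) vs) = c ^ p * cnj c ^ q * \<eta> z vs" if "length vs = p + q" for z c vs
    using \<eta> that by (simp add: test_form_def of_type_def)
  have "alternating_multilinear (p + q) (form_average r \<eta> z)" for z
    unfolding alternating_multilinear_def
  proof (intro conjI allI impI; elim conjE)
    fix vs :: "(complex ^ 'a) list" and i assume vs: "length vs = p + q" and i: "i < p + q"
    have lin: "linear (\<lambda>v. \<eta> w (vs[i := v]))" for w
      using alt[of w] vs i unfolding alternating_multilinear_def by blast
    show "linear (\<lambda>v. form_average r \<eta> z (vs[i := v]))"
    proof (rule linearI)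
      fix a b
      have "conv (ball_kernel r) (\<lambda>w. 1 * \<eta> w (vs[i := a]) + 1 * \<eta> w (vs[i := b])) z =
          1 * conv (ball_kernel r) (\<lambda>w. \<eta> w (vs[i := a])) z + 1 * conv (ball_kernel r) (\<lambda>w. \<eta> w (vs[i := b])) z"
        using vs by (intro conv_lincomb loc_integrable_ball_kernel t) auto
      then show "form_average r \<eta> z (vs[i := a + b]) = form_average r \<eta> z (vs[i := a]) + form_average r \<eta> z (vs[i := b])"
        using vs by (simp add: conv linear_add[OF lin])
    next
      fix c a
      have "conv (ball_kernel r) (\<lambda>w. of_real c * \<eta> w (vs[i := a]) + 0 * \<eta> w (vs[i := a])) z =
          of_real c * conv (ball_kernel r) (\<lambda>w. \<eta> w (vs[i := a])) z + 0 * conv (ball_kernel r) (\<lambda>w. \<eta> w (vs[i := a])) z"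
        using vs by (intro conv_lincomb loc_integrable_ball_kernel t) auto
      then show "form_average r \<eta> z (vs[i := c *\<^sub>R a]) = c *\<^sub>R form_average r \<eta> z (vs[i := a])"
        using vs by (simp add: conv linear_cmul[OF lin] scaleR_conv_of_real[where 'a = complex])
    qed
  next
    fix vs :: "(complex ^ 'a) list" and i j
    assume *: "length vs = p + q" "i < j" "j < p + q" "vs ! i = vs ! j"
    then have "\<eta> w vs = 0" for w using alt[of w] unfolding alternating_multilinear_def by blast
    then show "form_average r \<eta> z vs = 0" by (simp add: form_average_def ball_average_def)
  qed
  moreover have "form_average r \<eta> z (map (\<lambda>v. c *s v) vs) = c ^ p * cnj c ^ q * form_average r \<eta> z vs"
    if "length vs = p + q" for z c vs
  proof -
    have "conv (ball_kernel r) (\<lambda>w. (c ^ p * cnj c ^ q) * \<eta> w vs + 0 * \<eta> w vs) z =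
          (c ^ p * cnj c ^ q) * conv (ball_kernel r) (\<lambda>w. \<eta> w vs) z + 0 * conv (ball_kernel r) (\<lambda>w. \<eta> w vs) z"
      using that by (intro conv_lincomb loc_integrable_ball_kernel t) auto
    then show ?thesis using that by (simp add: conv ty)
  qed
  moreover have "C_k k (\<lambda>z. form_average r \<eta> z vs)" if "length vs = p + q" for k vs
    using smooth_form_average[OF s] that by (simp add: smooth_form_def test_fun_def)
  moreover have "\<exists>K. compact K \<and> (\<forall>z vs. z \<notin> K \<longrightarrow> length vs = p + q \<longrightarrow> form_average r \<eta> z vs = 0)"
  proof -
    obtain K where K: "compact K" "\<And>z vs. z \<notin> K \<Longrightarrow> length vs = p + q \<Longrightarrow> \<eta> z vs = 0"
      using \<eta> unfolding test_form_def by blast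
    obtain R where R: "\<And>z. z \<in> K \<Longrightarrow> norm z \<le> R"
      using compact_imp_bounded[OF K(1)] unfolding bounded_iff by blast
    have "form_average r \<eta> z vs = 0" if z: "z \<notin> cball 0 (R + r)" and vs: "length vs = p + q" for z vs
    proof -
      have "ball_kernel r w *\<^sub>R \<eta> (z - w) vs = 0" for w
      proof (cases "norm w < r")
        case True
        then have "R < norm (z - w)" using z norm_triangle_ineq2[of z w] by simp
        then have "z - w \<notin> K" using R by force
        then show ?thesis using K(2) vs by simp
      qed (simp add: ball_kernel_def)
      then show ?thesis by (simp only: conv[OF vs] conv_def Bochner_Integration.integral_zero)
    qed
    then show ?thesis by (intro exI[of _ "cball 0 (R + r)"]) auto
  qed
  ultimately show ?thesis unfolding test_form_def of_type_def by blast
qed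

lemma ball_average_nonneg_Reals:
  fixes u :: "complex ^ 'n \<Rightarrow> complex"
  assumes "\<And>w. u w \<in> \<real>\<^sub>\<ge>\<^sub>0"
  shows "ball_average r u z \<in> \<real>\<^sub>\<ge>\<^sub>0"
proof -
  have u: "u w = complex_of_real (Re (u w))" "0 \<le> Re (u w)" for w
    using assms[of w] by (auto simp: complex_nonneg_Reals_iff complex_eq_iff)
  have "ball_average r u z = (LINT w|lborel. complex_of_real (ball_kernel r (z - w) * Re (u w)))"
    unfolding ball_average_def ball_kernel_def[symmetric]
    by (subst (1) u(1)) (simp add: scaleR_conv_of_real)
  also have "\<dots> = complex_of_real (LINT w|lborel. ball_kernel r (z - w) * Re (u w))"
    by (rule integral_complex_of_real)
  finally show ?thesis
    using u(2) by (simp add: ball_kernel_nonneg integral_nonneg_AE)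
qed

section \<open>Pairings with averages and with the squared norm\<close>

lemma integrable_product_lborel:
  fixes a b :: "'a::euclidean_space \<Rightarrow> real"
  assumes a: "integrable lborel a" and b: "integrable lborel b"
  shows "integrable (lborel \<Otimes>\<^sub>M lborel) (\<lambda>(x, y). a x * b y)"
proof (rule lborel_pair.Fubini_integrable)
  have [measurable]: "a \<in> borel_measurable lborel" "b \<in> borel_measurable lborel" using a b by auto
  show "(\<lambda>(x, y). a x * b y) \<in> borel_measurable (lborel \<Otimes>\<^sub>M lborel)" by measurable
  have "integrable lborel (\<lambda>x. norm (a x) * (LINT y|lborel. norm (b y)))"
    using integrable_norm[OF a] by (rule integrable_mult_left)
  then show "integrable lborel (\<lambda>x. LINT y|lborel. norm (case (x, y) of (x, y) \<Rightarrow> a x * b y))"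
    by (simp add: abs_mult)
  show "AE x in lborel. integrable lborel (\<lambda>y. case (x, y) of (x, y) \<Rightarrow> a x * b y)"
    using integrable_mult_right[OF b] by auto
qed

text \<open>Averaging is symmetric for the pairing of functions, since the kernel is even. The product of all
factors is integrable because \<open>F\<close> has compact support, which confines \<open>w\<close> to a larger ball.\<close>

lemma ball_average_pairing:
  fixes \<phi> :: "complex ^ 'n \<Rightarrow> real"
  assumes \<phi>: "loc_integrable \<phi>" and F: "test_fun F"
  shows "(LINT z|lborel. complex_of_real (ball_average r \<phi> z) * F z)
       = (LINT w|lborel. complex_of_real (\<phi> w) * ball_average r F w)"
proof -
  define f where "f z w = complex_of_real (ball_kernel r (z - w) * \<phi> w) * F z" for z w
  obtain K where K: "0 < K" "\<And>x. K < norm x \<Longrightarrow> F x = 0" using test_fun_support[OF F] by blast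
  define B where "B = 1 / measure lborel (ball (0 :: complex ^ 'n) r)"
  have B: "ball_kernel r (w :: complex ^ 'n) \<le> B" for w
    unfolding B_def using ball_kernel_bound[of r w] by linarith
  have B0: "0 \<le> B" by (simp add: B_def)
  have [measurable]: "F \<in> borel_measurable borel" "\<phi> \<in> borel_measurable borel"
    using test_fun_continuous[OF F] \<phi> by (auto simp: borel_measurable_continuous_onI loc_integrable_def)
  have a: "integrable lborel (\<lambda>z. norm (F z))"
    using test_fun_integrable[OF F] by (rule integrable_norm)
  have b: "integrable lborel (\<lambda>w. B * norm (indicat_real (cball 0 (K + r)) w *\<^sub>R \<phi> w))"
    using \<phi> unfolding loc_integrable_def set_integrable_def
    by (intro integrable_mult_right integrable_norm) auto
  have "integrable (lborel \<Otimes>\<^sub>M lborel) (\<lambda>(z, w). f z w)"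
  proof (rule Bochner_Integration.integrable_bound[OF integrable_product_lborel[OF a b]])
    show "(\<lambda>(z, w). f z w) \<in> borel_measurable (lborel \<Otimes>\<^sub>M lborel)"
      unfolding f_def by measurable
    have "norm (f z w) \<le> norm (F z) * (B * norm (indicat_real (cball 0 (K + r)) w *\<^sub>R \<phi> w))" for z w
    proof (cases "F z = 0 \<or> ball_kernel r (z - w) = 0")
      case False
      then have "norm z \<le> K" using K(2)[of z] by force
      moreover have "norm (z - w) < r" using False by (auto simp: ball_kernel_def indicator_def split: if_splits)
      ultimately have w: "norm w \<le> K + r" using norm_triangle_ineq2[of w z] by (simp add: norm_minus_commute)
      have "norm (f z w) = norm (F z) * (ball_kernel r (z - w) * \<bar>\<phi> w\<bar>)"
        by (simp add: f_def norm_mult abs_mult ball_kernel_nonneg)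
      also have "\<dots> \<le> norm (F z) * (B * \<bar>\<phi> w\<bar>)"
        using B by (intro mult_left_mono mult_right_mono) auto
      finally show ?thesis using w by simp
    qed (use B0 in \<open>auto simp: f_def\<close>)
    then show "AE x in lborel \<Otimes>\<^sub>M lborel. norm (case x of (z, w) \<Rightarrow> f z w)
       \<le> norm (case x of (z, w) \<Rightarrow> norm (F z) * (B * norm (indicat_real (cball 0 (K + r)) w *\<^sub>R \<phi> w)))"
      by (intro AE_I2) (auto intro: order_trans[OF _ abs_ge_self])
  qed
  from lborel_pair.Fubini_integral[OF this]
  have Fub: "(LINT w|lborel. LINT z|lborel. f z w) = (LINT z|lborel. LINT w|lborel. f z w)" .
  have 1: "complex_of_real (ball_average r \<phi> z) * F z = (LINT w|lborel. f z w)" for z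
  proof -
    have "(LINT w|lborel. f z w) = (LINT w|lborel. complex_of_real (ball_kernel r (z - w) * \<phi> w)) * F z"
      unfolding f_def by (rule integral_mult_left_zero)
    also have "(LINT w|lborel. complex_of_real (ball_kernel r (z - w) * \<phi> w)) =
        complex_of_real (LINT w|lborel. ball_kernel r (z - w) * \<phi> w)" by (rule integral_complex_of_real)
    finally show ?thesis unfolding ball_average_def ball_kernel_def[symmetric] by simp
  qed
  have 2: "complex_of_real (\<phi> w) * ball_average r F w = (LINT z|lborel. f z w)" for w
  proof -
    have sym: "ball_kernel r (w - z) = ball_kernel r (z - w)" for z
      using ball_kernel_minus[of r "z - w"] by simp
    have "f z w = complex_of_real (\<phi> w) * (ball_kernel r (w - z) *\<^sub>R F z)" for z
      by (simp add: f_def sym scaleR_conv_of_real)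
    then have "(LINT z|lborel. f z w) = (LINT z|lborel. complex_of_real (\<phi> w) * (ball_kernel r (w - z) *\<^sub>R F z))"
      by simp
    also have "\<dots> = complex_of_real (\<phi> w) * (LINT z|lborel. ball_kernel r (w - z) *\<^sub>R F z)"
      by (rule integral_mult_right_zero)
    finally show ?thesis unfolding ball_average_def ball_kernel_def[symmetric] by simp
  qed
  show ?thesis using Fub by (simp only: 1 2)
qed

lemma loc_integrable_continuous:
  assumes "continuous_on UNIV k"
  shows "loc_integrable k"
  unfolding loc_integrable_def set_integrable_def
proof (intro conjI allI)
  show "k \<in> borel_measurable borel" using assms by (rule borel_measurable_continuous_onI)
  show "integrable lborel (\<lambda>x. indicat_real (cball 0 R) x *\<^sub>R k x)" for R
    by (rule borel_integrable_compact[OF _ continuous_on_subset[OF assms]]) auto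
qed

lemma ddir_eqI: "(f has_derivative D) (at x) \<Longrightarrow> ddir v f x = D v"
  using frechet_derivative_at[of f D x] by (simp add: ddir_def)

lemma ddir_lincomb:
  assumes "test_fun f" "test_fun g"
  shows "ddir v (\<lambda>x. a * f x + b * g x) z = a * ddir v f z + b * ddir v g z"
proof -
  have "((\<lambda>x. a * f x + b * g x) has_derivative (\<lambda>v. a * ddir v f z + b * ddir v g z)) (at z)"
    by (intro has_derivative_add has_derivative_mult_right test_fun_has_derivative assms)
  from ddir_eqI[OF this] show ?thesis .
qed

lemma ddir_sum:
  assumes "\<And>i. i \<in> I \<Longrightarrow> test_fun (u i)"
  shows "ddir v (\<lambda>x. \<Sum>i\<in>I. c i * u i x) z = (\<Sum>i\<in>I. c i * ddir v (u i) z)"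
proof -
  have "((\<lambda>x. \<Sum>i\<in>I. c i * u i x) has_derivative (\<lambda>v. \<Sum>i\<in>I. c i * ddir v (u i) z)) (at z)"
    by (intro has_derivative_sum has_derivative_mult_right test_fun_has_derivative assms)
  from ddir_eqI[OF this] show ?thesis .
qed

lemma wirtinger_sum:
  assumes "\<And>i. i \<in> I \<Longrightarrow> test_fun (u i)"
  shows "wirtinger a (\<lambda>x. \<Sum>i\<in>I. c i * u i x) z v = (\<Sum>i\<in>I. c i * wirtinger a (u i) z v)"
proof -
  have "wirtinger a (\<lambda>x. \<Sum>i\<in>I. c i * u i x) z v =
      1 / 2 * (\<Sum>i\<in>I. c i * ddir v (u i) z) + a / 2 * (\<Sum>i\<in>I. c i * ddir (\<i> *s v) (u i) z)"
    by (simp only: wirtinger_def ddir_sum[OF assms])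
  also have "\<dots> = (\<Sum>i\<in>I. 1 / 2 * (c i * ddir v (u i) z) + a / 2 * (c i * ddir (\<i> *s v) (u i) z))"
    by (simp only: sum_distrib_left sum.distrib)
  also have "\<dots> = (\<Sum>i\<in>I. c i * wirtinger a (u i) z v)"
    by (intro sum.cong refl) (simp add: wirtinger_def algebra_simps)
  finally show ?thesis .
qed

text \<open>Integration by parts without boundary terms: the convolution of \<open>f\<close> with \<open>|w|\<^sup>2\<close> is an explicit
quadratic polynomial, with leading coefficient \<open>\<integral> f\<close>. Its second derivatives at the origin are
computed once from this formula and once by differentiating under the integral.\<close>

lemma integral_norm_sq_second_derivative:
  fixes f :: "'a::euclidean_space \<Rightarrow> complex"
  assumes f: "test_fun f"
  shows "(LINT z|lborel. complex_of_real ((norm z)\<^sup>2) * ddir u (ddir v f) z)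
     = complex_of_real (2 * (u \<bullet> v)) * (LINT z|lborel. f z)"
proof -
  define q where "q w = (norm w)\<^sup>2" for w :: 'a
  define I0 where "I0 = (LINT w|lborel. f w)"
  define I2 where "I2 = (LINT w|lborel. (norm w)\<^sup>2 *\<^sub>R f w)"
  define J where "J x = (LINT w|lborel. (x \<bullet> w) *\<^sub>R f w)" for x
  have q: "loc_integrable q" unfolding q_def[abs_def] by (intro loc_integrable_continuous continuous_intros)
  have int0: "integrable lborel f" using test_fun_integrable[OF f] .
  have int1: "integrable lborel (\<lambda>w. (x \<bullet> w) *\<^sub>R f w)" for x
    by (intro test_fun_weighted_integrable loc_integrable_continuous continuous_intros f)
  have int2: "integrable lborel (\<lambda>w. (norm w)\<^sup>2 *\<^sub>R f w)"
    by (intro test_fun_weighted_integrable loc_integrable_continuous continuous_intros f)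
  have [measurable]: "f \<in> borel_measurable borel"
    using test_fun_continuous[OF f] by (rule borel_measurable_continuous_onI)
  have "linear J"
  proof (rule linearI)
    show "J (a + b) = J a + J b" for a b
      unfolding J_def using int1 by (simp add: inner_add_left scaleR_add_left)
    show "J (c *\<^sub>R a) = c *\<^sub>R J a" for c a
      unfolding J_def by (simp only: inner_scaleR_left scaleR_scaleR[symmetric] integral_scaleR_right)
  qed
  then have J: "(J has_derivative J) (at x)" for x
    by (simp add: bounded_linear_imp_has_derivative linear_conv_bounded_linear)
  have conv_eq: "conv q f x = complex_of_real (x \<bullet> x) * I0 - 2 * J x + I2" for x
  proof -
    have "conv q f x = (LINT w|lborel. q (x - w) *\<^sub>R f (x - (x - w)))"
      unfolding conv_def by (rule integral_reflect[symmetric]) (auto simp: q_def)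
    also have "\<dots> = (LINT w|lborel. (x \<bullet> x) *\<^sub>R f w - 2 *\<^sub>R ((x \<bullet> w) *\<^sub>R f w) + (norm w)\<^sup>2 *\<^sub>R f w)"
      by (intro Bochner_Integration.integral_cong refl)
        (simp add: q_def power2_norm_eq_inner inner_diff_left inner_diff_right inner_commute scaleR_left_diff_distrib scaleR_add_left algebra_simps)
    also have "\<dots> = (x \<bullet> x) *\<^sub>R I0 - 2 *\<^sub>R J x + I2"
      unfolding I0_def I2_def J_def
      by (simp only: Bochner_Integration.integral_add Bochner_Integration.integral_diff
          Bochner_Integration.integrable_add Bochner_Integration.integrable_diff
          integrable_scaleR_right int0 int1 int2 integral_scaleR_right)
    finally show ?thesis by (simp add: scaleR_conv_of_real)
  qed
  have D1: "ddir v (conv q f) = (\<lambda>x. complex_of_real (2 * (x \<bullet> v)) * I0 - 2 * J v)"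
  proof
    fix x
    have "(conv q f has_derivative (\<lambda>h. complex_of_real (2 * (x \<bullet> h)) * I0 - 2 * J h + 0)) (at x)"
      unfolding conv_eq[abs_def]
      by (intro derivative_intros J has_derivative_of_real)
        (auto intro!: derivative_eq_intros simp: inner_commute)
    from ddir_eqI[OF this, of v] show "ddir v (conv q f) x = complex_of_real (2 * (x \<bullet> v)) * I0 - 2 * J v"
      by simp
  qed
  have "((\<lambda>x. complex_of_real (2 * (x \<bullet> v)) * I0 - 2 * J v) has_derivative
      (\<lambda>h. complex_of_real (2 * (h \<bullet> v)) * I0 - 0)) (at 0)"
    by (intro derivative_intros has_derivative_of_real) 
  from ddir_eqI[OF this, of u] have "ddir u (ddir v (conv q f)) 0 = complex_of_real (2 * (u \<bullet> v)) * I0"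
    unfolding D1 by simp
  moreover have "ddir u (ddir v (conv q f)) = conv q (ddir u (ddir v f))"
    by (simp only: ddir_conv[OF q f] ddir_conv[OF q test_fun_ddir[OF f]])
  moreover have "conv q (ddir u (ddir v f)) 0 = (LINT w|lborel. q w *\<^sub>R ddir u (ddir v f) w)"
  proof -
    have m: "(\<lambda>w. q w *\<^sub>R ddir u (ddir v f) w) \<in> borel_measurable borel"
      using borel_measurable_continuous_onI[OF test_fun_continuous[OF test_fun_ddir[OF test_fun_ddir[OF f]]], of u v]
        q unfolding loc_integrable_def by (intro borel_measurable_scaleR) auto
    have "conv q (ddir u (ddir v f)) 0 = (LINT w|lborel. q (0 - w) *\<^sub>R ddir u (ddir v f) (0 - w))"
      unfolding conv_def by (simp add: q_def)
    then show ?thesis using integral_reflect[OF m, of 0] by simp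
  qed
  ultimately show ?thesis by (simp add: I0_def q_def scaleR_conv_of_real)
qed

text \<open>The Hermitian inner product; the real inner product of the vector space is its real part.\<close>

definition herm :: "complex ^ 'n \<Rightarrow> complex ^ 'n \<Rightarrow> complex" where
  "herm u v = (\<Sum>k\<in>UNIV. u $ k * cnj (v $ k))"

lemma Re_herm: "Re (herm u v) = u \<bullet> v"
  by (simp add: herm_def inner_vec_def inner_complex_def)

lemma herm_scale: "herm (a *s u) v = a * herm u v" "herm u (a *s v) = cnj a * herm u v"
  by (simp_all add: herm_def sum_distrib_left mult_ac)

lemma inner_i: "u \<bullet> (\<i> *s v) = Im (herm u v)" "(\<i> *s u) \<bullet> v = - Im (herm u v)"
    "(\<i> *s u) \<bullet> (\<i> *s v) = Re (herm u v)"
  by (simp_all add: Re_herm[symmetric] herm_scale)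

lemma integral_norm_sq_del_delbar:
  fixes f :: "complex ^ 'n \<Rightarrow> complex"
  assumes f: "test_fun f"
  shows "(LINT z|lborel. complex_of_real ((norm z)\<^sup>2) * wirtinger (- \<i>) (\<lambda>x. wirtinger \<i> f x v) z u)
     = herm u v * (LINT z|lborel. f z)"
proof -
  define N where "N z = complex_of_real ((norm z)\<^sup>2)" for z :: "complex ^ 'n"
  define I where "I a b = (LINT z|lborel. N z * ddir a (ddir b f) z)" for a b
  have I: "I a b = 2 * complex_of_real (a \<bullet> b) * (LINT z|lborel. f z)" for a b
    unfolding I_def N_def using integral_norm_sq_second_derivative[OF f, of a b] by simp
  have int: "integrable lborel (\<lambda>z. N z * ddir a (ddir b f) z)" for a b
    using test_fun_weighted_integrable[OF _ test_fun_ddir[OF test_fun_ddir[OF f]], of "\<lambda>z. (norm z)\<^sup>2"]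
    by (simp add: N_def scaleR_conv_of_real loc_integrable_continuous continuous_on_power continuous_on_norm_id)
  have "N z * wirtinger (- \<i>) (\<lambda>x. wirtinger \<i> f x v) z u =
     1 / 4 * (N z * ddir u (ddir v f) z) + \<i> / 4 * (N z * ddir u (ddir (\<i> *s v) f) z)
     + (- \<i> / 4 * (N z * ddir (\<i> *s u) (ddir v f) z) + 1 / 4 * (N z * ddir (\<i> *s u) (ddir (\<i> *s v) f) z))" for z
    unfolding wirtinger_def ddir_lincomb[OF test_fun_ddir[OF f] test_fun_ddir[OF f]]
    by (simp add: algebra_simps)
  then have "(LINT z|lborel. N z * wirtinger (- \<i>) (\<lambda>x. wirtinger \<i> f x v) z u) =
     1 / 4 * I u v + \<i> / 4 * I u (\<i> *s v) + (- \<i> / 4 * I (\<i> *s u) v + 1 / 4 * I (\<i> *s u) (\<i> *s v))"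
    unfolding I_def
    by (simp only: Bochner_Integration.integral_add integrable_mult_right int Bochner_Integration.integrable_add integral_mult_right_zero)
  also have "\<dots> = (complex_of_real (Re (herm u v)) + \<i> * complex_of_real (Im (herm u v))) * (LINT z|lborel. f z)"
    unfolding I unfolding inner_i(3) unfolding inner_i(1,2) by (simp add: Re_herm algebra_simps)
  also have "complex_of_real (Re (herm u v)) + \<i> * complex_of_real (Im (herm u v)) = herm u v"
    by (simp add: complex_eq_iff)
  finally show ?thesis by (simp add: N_def)
qed

section \<open>Positive covectors on complex frames\<close>

lemma complex_frame_Nil [simp]: "complex_frame [] = []"
  and complex_frame_Cons [simp]: "complex_frame (w # ws) = w # \<i> *s w # complex_frame ws"
  and complex_frame_append [simp]: "complex_frame (xs @ ys) = complex_frame xs @ complex_frame ys"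
  by (simp_all add: complex_frame_def)

lemma length_complex_frame [simp]: "length (complex_frame ws) = 2 * length ws"
  by (induction ws) auto

lemma nth_complex_frame:
  "k < length ws \<Longrightarrow> complex_frame ws ! (2 * k) = ws ! k \<and> complex_frame ws ! (2 * k + 1) = \<i> *s (ws ! k)"
proof (induction ws arbitrary: k)
  case (Cons w ws)
  then show ?case by (cases k) auto
qed simp

lemma remove_nth_append: "length A = k \<Longrightarrow> remove_nth k (A @ x # B) = A @ B"
  by (simp add: remove_nth_def)

lemma remove_nth_map: "remove_nth k (map f xs) = map f (remove_nth k xs)"
  by (simp add: remove_nth_def take_map drop_map)

lemma remove_nth_complex_frame:
  assumes "k < length ws"
  shows "remove_nth (2 * k) (remove_nth (2 * k) (complex_frame ws)) = complex_frame (remove_nth k ws)"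
    "remove_nth (2 * k) (remove_nth (2 * k + 1) (complex_frame ws)) = complex_frame (remove_nth k ws)"
proof -
  define A B w where "A = take k ws" and "B = drop (Suc k) ws" and "w = ws ! k"
  have ws: "ws = A @ w # B" unfolding A_def B_def w_def using id_take_nth_drop[OF assms] .
  have A: "length A = k" using assms by (simp add: A_def)
  have r: "remove_nth k ws = A @ B" unfolding ws using A by (rule remove_nth_append)
  have "remove_nth (2 * k) (complex_frame ws) = complex_frame A @ (\<i> *s w) # complex_frame B"
    unfolding ws using remove_nth_append[of "complex_frame A" "2 * k" w] A by simp
  then show "remove_nth (2 * k) (remove_nth (2 * k) (complex_frame ws)) = complex_frame (remove_nth k ws)"
    unfolding r using remove_nth_append[of "complex_frame A" "2 * k"] A by simp
  have "remove_nth (2 * k + 1) (complex_frame ws) = complex_frame A @ w # complex_frame B"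
    unfolding ws using remove_nth_append[of "complex_frame A @ [w]" "2 * k + 1" "\<i> *s w"] A by simp
  then show "remove_nth (2 * k) (remove_nth (2 * k + 1) (complex_frame ws)) = complex_frame (remove_nth k ws)"
    unfolding r using remove_nth_append[of "complex_frame A" "2 * k"] A by simp
qed

lemma alternating_linear_slot:
  assumes "alternating_multilinear m a" "length P + length R + 1 = m"
  shows "linear (\<lambda>x. a (P @ x # R))"
proof -
  have "linear (\<lambda>v. a ((P @ 0 # R)[length P := v]))"
    by (rule assms(1)[unfolded alternating_multilinear_def, THEN conjunct1, rule_format]) (use assms(2) in auto)
  then show ?thesis by simp
qed

lemma alternating_equal:
  assumes "alternating_multilinear m a" "length vs = m" "i < j" "j < m" "vs ! i = vs ! j"
  shows "a vs = 0"
  using assms unfolding alternating_multilinear_def by blast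

lemma alternating_swap:
  assumes a: "alternating_multilinear m a" and len: "length P + length R + 2 = m"
  shows "a (P @ y # x # R) = - a (P @ x # y # R)"
proof -
  have same: "a (P @ z # z # R) = 0" for z
    by (rule alternating_equal[OF a, of _ "length P" "Suc (length P)"]) (use len in \<open>auto simp: nth_append\<close>)
  have l1: "linear (\<lambda>x. a (P @ x # w # R))" for w
    using alternating_linear_slot[OF a, of P "w # R"] len by simp
  have l2: "linear (\<lambda>x. a (P @ w # x # R))" for w
    using alternating_linear_slot[OF a, of "P @ [w]" R] len by simp
  have "0 = a (P @ (x + y) # (x + y) # R)" using same by simp
  also have "\<dots> = a (P @ x # (x + y) # R) + a (P @ y # (x + y) # R)" by (rule linear_add[OF l1])
  also have "a (P @ x # (x + y) # R) = a (P @ x # x # R) + a (P @ x # y # R)" by (rule linear_add[OF l2])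
  also have "a (P @ y # (x + y) # R) = a (P @ y # x # R) + a (P @ y # y # R)" by (rule linear_add[OF l2])
  finally show ?thesis using same by (simp add: eq_neg_iff_add_eq_0 add.commute)
qed

text \<open>A function on lists that is invariant under adjacent transpositions depends only on the multiset
of entries. The common prefix \<open>P\<close> grows during the induction.\<close>

lemma swap_invariant_mset:
  assumes swap: "\<And>P x y R. length P + length R + 2 = m \<Longrightarrow> F (P @ x # y # R) = F (P @ y # x # R)"
  shows "mset xs = mset ys \<Longrightarrow> length P + length xs = m \<Longrightarrow> F (P @ xs) = F (P @ ys)"
proof (induction xs arbitrary: P ys)
  case (Cons x xs)
  have move: "length P + length A + length B + 1 = m \<Longrightarrow> F (P @ A @ x # B) = F (P @ x # A @ B)" for A B P
  proof (induction A arbitrary: P)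
    case (Cons a A)
    have "F (P @ (a # A) @ x # B) = F ((P @ [a]) @ A @ x # B)" by simp
    also have "\<dots> = F ((P @ [a]) @ x # A @ B)" using Cons by (intro Cons.IH) simp
    also have "\<dots> = F (P @ a # x # A @ B)" by simp
    also have "\<dots> = F (P @ x # a # A @ B)" using Cons.prems by (intro swap) simp
    finally show ?case by simp
  qed simp
  have "x \<in> set ys" using Cons.prems(1) by (metis list.set_intros(1) set_mset_mset)
  then obtain A B where ys: "ys = A @ x # B" by (meson split_list)
  have m: "mset xs = mset (A @ B)" using Cons.prems(1) ys by simp
  then have len: "length xs = length A + length B" by (metis length_append mset_eq_length)
  have "F (P @ x # xs) = F ((P @ [x]) @ xs)" by simp
  also have "\<dots> = F ((P @ [x]) @ A @ B)" using m Cons.prems by (intro Cons.IH) auto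
  also have "\<dots> = F (P @ A @ x # B)" using move[of P A B] Cons.prems len by simp
  finally show ?case using ys by simp
qed simp

text \<open>A positive \<open>(p, p)\<close>-covector, seen through its values \<open>frame_mass\<close> on complex frames. The aim is
to bound all of them by those on the coordinate subspaces.\<close>

locale positive_alternating =
  fixes p :: nat and a :: "(complex ^ 'n) list \<Rightarrow> complex"
  assumes alt: "alternating_multilinear (2 * p) a" and pos: "positive_covector p a"
begin

definition frame_mass :: "(complex ^ 'n) list \<Rightarrow> real" where "frame_mass ws = Re (a (complex_frame ws))"

lemma a_complex_frame: "length ws = p \<Longrightarrow> a (complex_frame ws) = complex_of_real (frame_mass ws)"
  and frame_mass_nonneg: "length ws = p \<Longrightarrow> 0 \<le> frame_mass ws"
  using pos unfolding positive_covector_def frame_mass_def complex_nonneg_Reals_iff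
  by (auto simp: complex_eq_iff)

text \<open>In each vector separately, \<open>frame_mass\<close> is a nonnegative quadratic form that scales with
\<open>|c|\<^sup>2\<close>. Nonnegativity and the parallelogram law give the first inequality.\<close>

lemma frame_mass_slot:
  assumes len: "length P + length R + 1 = p"
  shows "frame_mass (P @ (x + y) # R) \<le> 2 * frame_mass (P @ x # R) + 2 * frame_mass (P @ y # R)"
    and "frame_mass (P @ (c *s x) # R) = (cmod c)\<^sup>2 * frame_mass (P @ x # R)"
proof -
  define b where "b x y = a (complex_frame P @ x # y # complex_frame R)" for x y
  have Q: "frame_mass (P @ x # R) = Re (b x (\<i> *s x))" for x by (simp add: frame_mass_def b_def)
  have l1: "linear (\<lambda>x. b x w)" for w unfolding b_def
    by (rule alternating_linear_slot[OF alt]) (use len in simp)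
  have l2: "linear (\<lambda>x. b w x)" for w unfolding b_def
    using alternating_linear_slot[OF alt, of "complex_frame P @ [w]" "complex_frame R"] len by simp
  have swap: "b y x = - b x y" for x y unfolding b_def
    by (rule alternating_swap[OF alt]) (use len in simp)
  have same: "b x x = 0" for x using swap[of x x] by simp
  have add: "b (x + y) (\<i> *s (x + y)) = b x (\<i> *s x) + b y (\<i> *s y) + (b x (\<i> *s y) + b y (\<i> *s x))" for x y
    by (simp add: vector_add_ldistrib linear_add[OF l1] linear_add[OF l2])
  \<comment> \<open>The mixed terms change sign with \<open>y\<close> and cancel in the sum.\<close>
  have "b (x + - y) (\<i> *s (x + - y)) = b x (\<i> *s x) + b y (\<i> *s y) - (b x (\<i> *s y) + b y (\<i> *s x))"
  proof -
    have "\<i> *s (- y) = - (\<i> *s y)" by (simp add: vec_eq_iff)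
    then show ?thesis using add[of x "- y"] by (simp add: linear_neg[OF l1] linear_neg[OF l2])
  qed
  then have "frame_mass (P @ (x + y) # R) + frame_mass (P @ (x + - y) # R) = 2 * frame_mass (P @ x # R) + 2 * frame_mass (P @ y # R)"
    unfolding Q using add[of x y] by simp
  moreover have "0 \<le> frame_mass (P @ (x + - y) # R)" using len by (intro frame_mass_nonneg) simp
  ultimately show "frame_mass (P @ (x + y) # R) \<le> 2 * frame_mass (P @ x # R) + 2 * frame_mass (P @ y # R)" by simp
  define s t where "s = Re c" and "t = Im c"
  have cx: "c *s x = s *\<^sub>R x + t *\<^sub>R (\<i> *s x)" "\<i> *s (c *s x) = s *\<^sub>R (\<i> *s x) + (- t) *\<^sub>R x"
    by (simp_all add: vec_eq_iff s_def t_def complex_eq_iff algebra_simps)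
  have "b (c *s x) (\<i> *s (c *s x)) = of_real (s\<^sup>2 + t\<^sup>2) * b x (\<i> *s x)"
    unfolding cx(2) unfolding cx(1)
    unfolding linear_add[OF l1] linear_add[OF l2] linear_cmul[OF l1] linear_cmul[OF l2] same
    using swap[of "\<i> *s x" x]
    by (simp add: scaleR_conv_of_real[where 'a = complex] algebra_simps power2_eq_square)
  then show "frame_mass (P @ (c *s x) # R) = (cmod c)\<^sup>2 * frame_mass (P @ x # R)"
    unfolding Q by (simp add: cmod_power2 s_def t_def)
qed

lemma frame_mass_slot_sum:
  assumes len: "length P + length R + 1 = p" and S: "finite S"
    and c: "\<And>j. j \<in> S \<Longrightarrow> cmod (c j) \<le> 1"
  shows "frame_mass (P @ (\<Sum>j\<in>S. c j *s e j) # R) \<le> 2 ^ card S * (\<Sum>j\<in>S. frame_mass (P @ e j # R))"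
  using S c
proof (induction S rule: finite_induct)
  case empty
  show ?case using frame_mass_slot(2)[OF len, of 0 0] by simp
next
  case (insert i S)
  have nn: "0 \<le> frame_mass (P @ x # R)" for x using len by (intro frame_mass_nonneg) simp
  have "frame_mass (P @ (\<Sum>j\<in>insert i S. c j *s e j) # R) = frame_mass (P @ (c i *s e i + (\<Sum>j\<in>S. c j *s e j)) # R)"
    using insert by simp
  also have "\<dots> \<le> 2 * frame_mass (P @ (c i *s e i) # R) + 2 * frame_mass (P @ (\<Sum>j\<in>S. c j *s e j) # R)"
    by (rule frame_mass_slot(1)[OF len])
  also have "frame_mass (P @ (c i *s e i) # R) \<le> 2 ^ card S * frame_mass (P @ e i # R)"
  proof -
    have "(cmod (c i))\<^sup>2 \<le> 1" using insert.prems by (simp add: power_le_one)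
    also have "1 \<le> (2::real) ^ card S" by simp
    finally show ?thesis unfolding frame_mass_slot(2)[OF len] using nn by (rule mult_right_mono)
  qed
  also have "frame_mass (P @ (\<Sum>j\<in>S. c j *s e j) # R) \<le> 2 ^ card S * (\<Sum>j\<in>S. frame_mass (P @ e j # R))"
    using insert by simp
  finally show ?case using insert by (simp add: algebra_simps)
qed

lemma frame_mass_le_sum_axes:
  assumes "length P + length us = p" "\<And>u j. u \<in> set us \<Longrightarrow> cmod (u $ j) \<le> 1"
  shows "frame_mass (P @ us) \<le> (2 ^ CARD('n)) ^ length us *
     (\<Sum>js | length js = length us. frame_mass (P @ map (\<lambda>j. axis j 1) js))"
  using assms
proof (induction us arbitrary: P)
  case (Cons u us)
  let ?K = "(2::real) ^ CARD('n)"
  have "u = (\<Sum>j\<in>UNIV. u $ j *s axis j 1)" by (simp add: basis_expansion)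
  then have "frame_mass (P @ u # us) = frame_mass (P @ (\<Sum>j\<in>UNIV. u $ j *s axis j 1) # us)" by simp
  also have "\<dots> \<le> ?K * (\<Sum>j\<in>UNIV. frame_mass (P @ axis j 1 # us))"
    using Cons.prems by (intro frame_mass_slot_sum) auto
  also have "\<dots> \<le> ?K * (\<Sum>j\<in>UNIV. ?K ^ length us * (\<Sum>js | length js = length us. frame_mass (P @ axis j 1 # map (\<lambda>j. axis j 1) js)))"
  proof (intro mult_left_mono sum_mono)
    fix j
    show "frame_mass (P @ axis j 1 # us) \<le> ?K ^ length us * (\<Sum>js | length js = length us. frame_mass (P @ axis j 1 # map (\<lambda>j. axis j 1) js))"
      using Cons.IH[of "P @ [axis j 1]"] Cons.prems by simp
  qed simp
  also have "\<dots> = ?K ^ Suc (length us) * (\<Sum>j\<in>UNIV. \<Sum>js | length js = length us. frame_mass (P @ map (\<lambda>j. axis j 1) (j # js)))"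
    by (simp add: sum_distrib_left mult_ac)
  also have "(\<Sum>j\<in>UNIV. \<Sum>js | length js = length us. frame_mass (P @ map (\<lambda>j. axis j 1) (j # js)))
     = (\<Sum>x\<in>UNIV \<times> {js. length js = length us}. frame_mass (P @ map (\<lambda>j. axis j 1) (fst x # snd x)))"
    by (simp add: sum.cartesian_product case_prod_beta)
  also have "\<dots> = (\<Sum>js | length js = Suc (length us). frame_mass (P @ map (\<lambda>j. axis j 1) js))"
    by (rule sum.reindex_bij_witness[where i = "\<lambda>js. (hd js, tl js)" and j = "\<lambda>x. fst x # snd x"])
      (auto simp: length_Suc_conv)
  finally show ?case by simp
qed simp

lemma frame_mass_swap:
  assumes "length P + length R + 2 = p"
  shows "frame_mass (P @ x # y # R) = frame_mass (P @ y # x # R)"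
proof -
  let ?P = "complex_frame P" and ?R = "complex_frame R"
  have sw: "a (P' @ u # v # R') = - a (P' @ v # u # R')" if "length P' + length R' + 2 = 2 * p" for P' u v R'
    by (rule alternating_swap[OF alt that])
  have "a (?P @ x # \<i> *s x # y # \<i> *s y # ?R) = - a (?P @ x # y # \<i> *s x # \<i> *s y # ?R)"
    using sw[of "?P @ [x]" "\<i> *s y # ?R" "\<i> *s x" y] assms by simp
  also have "a (?P @ x # y # \<i> *s x # \<i> *s y # ?R) = - a (?P @ y # x # \<i> *s x # \<i> *s y # ?R)"
    using sw[of ?P "\<i> *s x # \<i> *s y # ?R" x y] assms by simp
  also have "a (?P @ y # x # \<i> *s x # \<i> *s y # ?R) = - a (?P @ y # x # \<i> *s y # \<i> *s x # ?R)"
    using sw[of "?P @ [y, x]" ?R "\<i> *s x" "\<i> *s y"] assms by simp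
  also have "a (?P @ y # x # \<i> *s y # \<i> *s x # ?R) = - a (?P @ y # \<i> *s y # x # \<i> *s x # ?R)"
    using sw[of "?P @ [y]" "\<i> *s x # ?R" x "\<i> *s y"] assms by simp
  finally show ?thesis by (simp add: frame_mass_def)
qed

text \<open>Expanding all \<open>p\<close> vectors in the coordinate basis leaves lists of coordinate vectors. A list with
a repetition contributes nothing; one without repetition omits exactly one coordinate and is, up to
a permutation, one of the terms of the trace. The constant is far from optimal, but only its
independence of the covector matters.\<close>

lemma frame_mass_le_trace:
  assumes p: "p = CARD('n) - 1" and us: "length us = p" "\<And>u j. u \<in> set us \<Longrightarrow> cmod (u $ j) \<le> 1"
    and js0: "distinct js0" "set js0 = (UNIV :: 'n set)"
  shows "frame_mass us \<le> (2 ^ CARD('n)) ^ p * real (CARD('n) ^ p) *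
     (\<Sum>k<CARD('n). frame_mass (remove_nth k (map (\<lambda>j. axis j 1) js0)))" (is "_ \<le> _ * ?tr")
proof -
  have len0: "length js0 = CARD('n)" using js0 by (metis distinct_card)
  have nn: "0 \<le> frame_mass (remove_nth k (map (\<lambda>j. axis j 1) js0))" if "k < CARD('n)" for k
    using that len0 p by (intro frame_mass_nonneg) (simp add: length_remove_nth)
  have each: "frame_mass (map (\<lambda>j. axis j 1) js) \<le> ?tr" if len: "length js = p" for js :: "'n list"
  proof (cases "distinct js")
    case True
    have "card (UNIV - set js) = 1"
      using True len p by (simp add: card_Diff_subset distinct_card)
    then obtain j where j: "UNIV - set js = {j}" using card_1_singletonE by blast
    obtain k where k: "k < length js0" "js0 ! k = j" using js0(2) by (metis UNIV_I in_set_conv_nth)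
    have js0_eq: "js0 = take k js0 @ j # drop (Suc k) js0" using id_take_nth_drop[OF k(1)] k(2) by simp
    have d: "distinct (remove_nth k js0)" "set (remove_nth k js0) = UNIV - {j}"
    proof -
      have "distinct (take k js0 @ j # drop (Suc k) js0)" "set (take k js0 @ j # drop (Suc k) js0) = UNIV"
        using js0 js0_eq by simp_all
      then show "distinct (remove_nth k js0)" "set (remove_nth k js0) = UNIV - {j}"
        unfolding remove_nth_def by (auto simp del: append_take_drop_id)
    qed
    have "set js = UNIV - {j}" using j by blast
    then have "mset js = mset (remove_nth k js0)"
      using d True set_eq_iff_mset_eq_distinct by metis
    then have m: "mset (map (\<lambda>j. axis j 1 :: complex ^ 'n) js) = mset (map (\<lambda>j. axis j 1) (remove_nth k js0))"
      by (simp only: mset_map)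
    have "frame_mass ([] @ map (\<lambda>j. axis j 1) js) = frame_mass ([] @ map (\<lambda>j. axis j 1) (remove_nth k js0))"
      by (rule swap_invariant_mset[where m = p and F = frame_mass, OF frame_mass_swap m]) (use len in auto)
    then have "frame_mass (map (\<lambda>j. axis j 1) js) = frame_mass (remove_nth k (map (\<lambda>j. axis j 1) js0))"
      by (simp add: remove_nth_map)
    also have "\<dots> \<le> ?tr" using k len0 nn by (intro member_le_sum) auto
    finally show ?thesis .
  next
    case False
    then obtain i l where il: "i < l" "l < length js" "js ! i = js ! l"
      unfolding distinct_conv_nth by (metis linorder_neqE_nat)
    have "a (complex_frame (map (\<lambda>j. axis j 1) js)) = 0"
    proof (rule alternating_equal[OF alt, of _ "2 * i" "2 * l"])
      show "complex_frame (map (\<lambda>j. axis j 1) js) ! (2 * i) = complex_frame (map (\<lambda>j. axis j 1) js) ! (2 * l)"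
        using nth_complex_frame[of i "map (\<lambda>j. axis j 1) js"] nth_complex_frame[of l "map (\<lambda>j. axis j 1) js"] il
        by simp
    qed (use il len in auto)
    then have "frame_mass (map (\<lambda>j. axis j 1) js) = 0" by (simp add: frame_mass_def)
    also have "0 \<le> ?tr" using nn by (intro sum_nonneg) auto
    finally show ?thesis .
  qed
  have "frame_mass ([] @ us) \<le> (2 ^ CARD('n)) ^ length us * (\<Sum>js | length js = length us. frame_mass ([] @ map (\<lambda>j. axis j 1) js))"
    using us by (intro frame_mass_le_sum_axes) auto
  also have "\<dots> \<le> (2 ^ CARD('n)) ^ p * (\<Sum>js :: 'n list | length js = p. ?tr)"
    unfolding us(1) using each by (intro mult_left_mono sum_mono) auto
  also have "\<dots> = (2 ^ CARD('n)) ^ p * real (CARD('n) ^ p) * ?tr"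
    using card_lists_length_eq[of "UNIV :: 'n set" p] by simp
  finally show ?thesis by simp
qed

end

section \<open>The Kaehler current as a trace\<close>

definition std_axes :: "(complex ^ 'n) list" where
  "std_axes = map (\<lambda>j. axis j 1) (SOME js. distinct js \<and> set js = (UNIV :: 'n set))"

lemma standard_frame_axes: "standard_frame = complex_frame std_axes"
  by (simp add: standard_frame_def std_axes_def)

lemma std_axes_list:
  obtains js where "distinct js" "set js = (UNIV :: 'n::finite set)"
    "(std_axes :: (complex ^ 'n) list) = map (\<lambda>j. axis j 1) js"
proof -
  have "\<exists>js. distinct js \<and> set js = (UNIV :: 'n set)"
    using finite_distinct_list[of "UNIV :: 'n set"] by auto
  from someI_ex[OF this] show thesis using that unfolding std_axes_def by blast
qed

lemma length_std_axes [simp]: "length (std_axes :: (complex ^ 'n) list) = CARD('n)"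
  by (rule std_axes_list[where 'n = 'n]) (metis distinct_card length_map)

lemma herm_axis: "herm (axis i 1) (axis j 1 :: complex ^ 'n) = of_bool (i = j)"
proof -
  have "herm (axis i 1) (axis j 1 :: complex ^ 'n) = (\<Sum>k\<in>UNIV. if k = i then of_bool (i = j) else 0)"
    unfolding herm_def by (intro sum.cong refl) (simp add: axis_def)
  then show ?thesis by simp
qed

lemma herm_std_axes:
  assumes "k < CARD('n)" "l < CARD('n)"
  shows "herm (std_axes ! k) (std_axes ! l :: complex ^ 'n) = of_bool (k = l)"
proof -
  obtain js where js: "distinct js" "set js = (UNIV :: 'n set)"
    "(std_axes :: (complex ^ 'n) list) = map (\<lambda>j. axis j 1) js" by (rule std_axes_list)
  have "length js = CARD('n)" using js(1,2) by (metis distinct_card)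
  then show ?thesis unfolding js(3) using assms js(1) by (simp add: herm_axis nth_eq_iff_index_eq)
qed

lemma sum_pairs: "(\<Sum>i<2 * n. F i) = (\<Sum>k<n. F (2 * k) + F (2 * k + 1))" for F :: "nat \<Rightarrow> 'b::comm_monoid_add"
  by (induction n) (auto simp: add.assoc)

lemma nth_complex_frame':
  assumes "l < 2 * length ws"
  shows "complex_frame ws ! l = (if even l then ws ! (l div 2) else \<i> *s (ws ! (l div 2)))"
proof (cases "even l")
  case True
  then show ?thesis using nth_complex_frame[of "l div 2" ws] assms by auto
next
  case False
  then show ?thesis using nth_complex_frame[of "l div 2" ws] assms odd_two_times_div_two_succ[OF False] by auto
qed

lemma nth_remove_nth:
  assumes "i < length xs" "j < length xs - 1"
  shows "remove_nth i xs ! j = xs ! (if j < i then j else Suc j)"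
  using assms by (auto simp: remove_nth_def nth_append)

text \<open>Only pairs consisting of a vector \<open>w\<^sub>k\<close> and its multiple \<open>\<i> w\<^sub>k\<close> contribute. Removing them in
either order leaves the frame without the \<open>k\<close>-th vector, and both orders contribute \<open>- \<i>\<close>: the
signs of the positions differ, and so do the Hermitian products.\<close>

lemma frame_double_sum:
  assumes len: "length ws = n" and orth: "\<And>k l. k < n \<Longrightarrow> l < n \<Longrightarrow> herm (ws ! k) (ws ! l) = of_bool (k = l)"
  defines "vs \<equiv> complex_frame ws"
  shows "(\<Sum>i<2 * n. (- 1) ^ i * (\<Sum>j<2 * n - 1. (- 1) ^ j *
       (herm (vs ! i) (remove_nth i vs ! j) * G (remove_nth j (remove_nth i vs)))))
     = - 2 * \<i> * (\<Sum>k<n. G (complex_frame (remove_nth k ws)))"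
proof -
  let ?I = "\<lambda>i. \<Sum>j<2 * n - 1. (- 1) ^ j * (herm (vs ! i) (remove_nth i vs ! j) * G (remove_nth j (remove_nth i vs)))"
  have lenvs: "length vs = 2 * n" by (simp add: vs_def len)
  have zero: "herm (vs ! i) (vs ! l) = 0" if "i < 2 * n" "l < 2 * n" "i div 2 \<noteq> l div 2" for i l
    using that orth[of "i div 2" "l div 2"] by (simp add: vs_def nth_complex_frame' len herm_scale)
  have single: "?I i = herm (vs ! i) (remove_nth i vs ! (2 * k)) * G (complex_frame (remove_nth k ws))"
    if k: "k < n" and i: "i = 2 * k \<or> i = 2 * k + 1" for i k
  proof -
    have "?I i = (\<Sum>j<2 * n - 1. if j = 2 * k then herm (vs ! i) (remove_nth i vs ! (2 * k)) * G (complex_frame (remove_nth k ws)) else 0)"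
    proof (intro sum.cong refl)
      fix j assume j: "j \<in> {..<2 * n - 1}"
      show "(- 1) ^ j * (herm (vs ! i) (remove_nth i vs ! j) * G (remove_nth j (remove_nth i vs))) =
         (if j = 2 * k then herm (vs ! i) (remove_nth i vs ! (2 * k)) * G (complex_frame (remove_nth k ws)) else 0)"
      proof (cases "j = 2 * k")
        case True
        have "remove_nth j (remove_nth i vs) = complex_frame (remove_nth k ws)"
          using i remove_nth_complex_frame[of k ws] k len unfolding vs_def True by auto
        then show ?thesis using True by simp
      next
        case False
        define l where "l = (if j < i then j else Suc j)"
        have "remove_nth i vs ! j = vs ! l"
          unfolding l_def using i k j lenvs by (intro nth_remove_nth) auto
        moreover have "i div 2 = k" using i by auto
        moreover have "l \<noteq> 2 * k" "l \<noteq> 2 * k + 1" using i False by (auto simp: l_def)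
        then have "l div 2 \<noteq> k" by presburger
        moreover have "l < 2 * n" "i < 2 * n" using j i k by (auto simp: l_def)
        ultimately have "herm (vs ! i) (remove_nth i vs ! j) = 0" using zero by simp
        then show ?thesis using False by simp
      qed
    qed
    also have "\<dots> = herm (vs ! i) (remove_nth i vs ! (2 * k)) * G (complex_frame (remove_nth k ws))"
      using k by simp
    finally show ?thesis .
  qed
  have "?I (2 * k) = - \<i> * G (complex_frame (remove_nth k ws))" if k: "k < n" for k
  proof -
    have "remove_nth (2 * k) vs ! (2 * k) = vs ! (2 * k + 1)"
      using nth_remove_nth[of "2 * k" vs "2 * k"] k lenvs by simp
    then have "herm (vs ! (2 * k)) (remove_nth (2 * k) vs ! (2 * k)) = - \<i>"
      using nth_complex_frame[of k ws] k len orth[of k k] by (simp add: vs_def herm_scale)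
    then show ?thesis using single[OF k, of "2 * k"] by simp
  qed
  moreover have "?I (2 * k + 1) = \<i> * G (complex_frame (remove_nth k ws))" if k: "k < n" for k
  proof -
    have "remove_nth (2 * k + 1) vs ! (2 * k) = vs ! (2 * k)"
      using nth_remove_nth[of "2 * k + 1" vs "2 * k"] k lenvs by simp
    then have "herm (vs ! (2 * k + 1)) (remove_nth (2 * k + 1) vs ! (2 * k)) = \<i>"
      using nth_complex_frame[of k ws] k len orth[of k k] by (simp add: vs_def herm_scale)
    then show ?thesis using single[OF k, of "2 * k + 1"] by simp
  qed
  ultimately have "(\<Sum>k<n. (- 1) ^ (2 * k) * ?I (2 * k) + (- 1) ^ (2 * k + 1) * ?I (2 * k + 1))
     = (\<Sum>k<n. - 2 * \<i> * G (complex_frame (remove_nth k ws)))"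
    by (intro sum.cong refl) simp
  then show ?thesis unfolding sum_pairs by (simp only: sum_distrib_left)
qed

text \<open>The density of \<open>\<omega> \<and> \<eta>\<close> with respect to Lebesgue measure.\<close>

definition trace_form :: "('n::finite) form \<Rightarrow> complex ^ 'n \<Rightarrow> complex" where
  "trace_form \<eta> z = (\<Sum>k<CARD('n). \<eta> z (complex_frame (remove_nth k std_axes)))"

lemma Suc_Suc_frame: "Suc (Suc (2 * (CARD('n::finite) - 1))) = 2 * CARD('n)"
  using zero_less_card_finite[where 'a = 'n] by linarith

lemma smooth_form_slot: "smooth_form m \<eta> \<Longrightarrow> length vs = m \<Longrightarrow> test_fun (\<lambda>z. \<eta> z vs)"
  by (simp add: smooth_form_def)

text \<open>Both derivatives of the form are moved to \<open>|z|\<^sup>2\<close>, whose complex Hessian is the identity.\<close>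

lemma kaehler_current_trace:
  fixes \<eta> :: "('n::finite) form"
  assumes \<eta>: "smooth_form (2 * (CARD('n) - 1)) \<eta>"
  shows "kaehler_current \<eta> = (LINT z|lborel. trace_form \<eta> z)"
proof -
  define n where "n = CARD('n)"
  define vs where "vs = (standard_frame :: (complex ^ 'n) list)"
  define N where "N z = complex_of_real ((norm z)\<^sup>2)" for z :: "complex ^ 'n"
  define g where "g i j = (\<lambda>y. \<eta> y (remove_nth j (remove_nth i vs)))" for i j
  define h where "h i j z = wirtinger (- \<i>) (\<lambda>x. wirtinger \<i> (g i j) x (remove_nth i vs ! j)) z (vs ! i)" for i j z
  have lenvs: "length vs = 2 * n" by (simp add: vs_def standard_frame_axes n_def)
  have len1: "length (remove_nth i vs) = 2 * n - 1" if "i < 2 * n" for i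
    using that lenvs by (simp add: length_remove_nth)
  have len2: "length (remove_nth j (remove_nth i vs)) = 2 * (CARD('n) - 1)" if "i < 2 * n" "j < 2 * n - 1" for i j
    using that len1 Suc_Suc_frame[where 'n = 'n] by (simp add: length_remove_nth n_def)
  have g: "test_fun (g i j)" if "i < 2 * n" "j < 2 * n - 1" for i j
    unfolding g_def using smooth_form_slot[OF \<eta> len2[OF that]] .
  have dd: "del (delbar \<eta>) z vs = (\<Sum>i<2 * n. (- 1) ^ i * (\<Sum>j<2 * n - 1. (- 1) ^ j * h i j z))" for z
    unfolding del_eq wirtinger_form_def[of "- \<i>"] lenvs
  proof (intro sum.cong refl arg_cong2[where f = "(*)"])
    fix i assume i: "i \<in> {..<2 * n}"
    have "(\<lambda>x. delbar \<eta> x (remove_nth i vs)) = (\<lambda>x. \<Sum>j<2 * n - 1. (- 1) ^ j * wirtinger \<i> (g i j) x (remove_nth i vs ! j))"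
      unfolding delbar_eq wirtinger_form_def g_def using len1 i by simp
    then show "wirtinger (- \<i>) (\<lambda>x. delbar \<eta> x (remove_nth i vs)) z (vs ! i) = (\<Sum>j<2 * n - 1. (- 1) ^ j * h i j z)"
      unfolding h_def using g i by (simp only:) (intro wirtinger_sum test_fun_wirtinger, auto)
  qed
  have h_int: "integrable lborel (\<lambda>z. N z * h i j z)" if "i < 2 * n" "j < 2 * n - 1" for i j
  proof -
    have "test_fun (h i j)"
      unfolding h_def[abs_def] by (intro test_fun_wirtinger g that)
    from test_fun_weighted_integrable[OF _ this, of "\<lambda>z. (norm z)\<^sup>2"]
    show ?thesis by (simp add: N_def scaleR_conv_of_real loc_integrable_continuous continuous_on_power continuous_on_norm_id)
  qed
  have "del_delbar_current (\<lambda>z. (norm z)\<^sup>2) \<eta> =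
     (LINT z|lborel. (\<Sum>i<2 * n. \<Sum>j<2 * n - 1. (- 1) ^ i * (- 1) ^ j * (N z * h i j z)))"
    unfolding del_delbar_current_def vs_def[symmetric] dd N_def
    by (simp add: sum_distrib_left mult_ac)
  also have "\<dots> = (\<Sum>i<2 * n. \<Sum>j<2 * n - 1. (- 1) ^ i * (- 1) ^ j * (LINT z|lborel. N z * h i j z))"
  proof -
    have 1: "integrable lborel (\<lambda>z. (- 1) ^ i * (- 1) ^ j * (N z * h i j z))"
      if "i \<in> {..<2 * n}" "j \<in> {..<2 * n - 1}" for i j
      using that by (intro integrable_mult_right h_int) auto
    have "(LINT z|lborel. (\<Sum>i<2 * n. \<Sum>j<2 * n - 1. (- 1) ^ i * (- 1) ^ j * (N z * h i j z))) =
        (\<Sum>i<2 * n. LINT z|lborel. (\<Sum>j<2 * n - 1. (- 1) ^ i * (- 1) ^ j * (N z * h i j z)))"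
      by (intro Bochner_Integration.integral_sum Bochner_Integration.integrable_sum 1)
    also have "\<dots> = (\<Sum>i<2 * n. \<Sum>j<2 * n - 1. LINT z|lborel. (- 1) ^ i * (- 1) ^ j * (N z * h i j z))"
      by (intro sum.cong refl Bochner_Integration.integral_sum 1)
    finally show ?thesis by (simp only: integral_mult_right_zero)
  qed
  also have "\<dots> = (\<Sum>i<2 * n. (- 1) ^ i * (\<Sum>j<2 * n - 1. (- 1) ^ j *
       (herm (vs ! i) (remove_nth i vs ! j) * (\<lambda>ws. LINT z|lborel. \<eta> z ws) (remove_nth j (remove_nth i vs)))))"
    unfolding sum_distrib_left
  proof (intro sum.cong refl)
    fix i j assume "i \<in> {..<2 * n}" "j \<in> {..<2 * n - 1}"
    then have "(LINT z|lborel. N z * h i j z) = herm (vs ! i) (remove_nth i vs ! j) * (LINT z|lborel. g i j z)"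
      unfolding N_def h_def by (intro integral_norm_sq_del_delbar g) auto
    then show "(- 1) ^ i * (- 1) ^ j * (LINT z|lborel. N z * h i j z) = (- 1) ^ i * ((- 1) ^ j *
       (herm (vs ! i) (remove_nth i vs ! j) * (\<lambda>ws. LINT z|lborel. \<eta> z ws) (remove_nth j (remove_nth i vs))))"
      by (simp add: g_def)
  qed
  also have "\<dots> = - 2 * \<i> * (\<Sum>k<n. (LINT z|lborel. \<eta> z (complex_frame (remove_nth k std_axes))))"
    unfolding vs_def standard_frame_axes
    by (rule frame_double_sum) (auto simp: n_def herm_std_axes)
  also have "(\<Sum>k<n. (LINT z|lborel. \<eta> z (complex_frame (remove_nth k std_axes)))) = (LINT z|lborel. trace_form \<eta> z)"
    unfolding trace_form_def n_def
    by (rule Bochner_Integration.integral_sum[symmetric])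
      (auto intro!: test_fun_integrable smooth_form_slot[OF \<eta>] simp: length_remove_nth)
  finally show ?thesis by (simp add: kaehler_current_def)
qed

text \<open>The current of an averaged function is the average of its current, in the sense of duality.\<close>

lemma del_delbar_current_average:
  fixes \<eta> :: "('n::finite) form"
  assumes \<phi>: "loc_integrable \<phi>" and \<eta>: "smooth_form (2 * (CARD('n) - 1)) \<eta>"
  shows "del_delbar_current (ball_average r \<phi>) \<eta> = del_delbar_current \<phi> (form_average r \<eta>)"
proof -
  define G where "G w = del (delbar \<eta>) w standard_frame" for w
  have len: "length (standard_frame :: (complex ^ 'n) list) = Suc (Suc (2 * (CARD('n) - 1)))"
    using Suc_Suc_frame[where 'n = 'n] by (simp add: standard_frame_axes)
  have G: "test_fun G"
    unfolding G_def[abs_def] del_eq delbar_eq by (rule smooth_form_slot[OF smooth_form_wirtinger[OF smooth_form_wirtinger[OF \<eta>]] len])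
  note k = loc_integrable_ball_kernel
  have "delbar (form_average r \<eta>) z ws = conv (ball_kernel r) (\<lambda>w. delbar \<eta> w ws) z"
    if "length ws = Suc (2 * (CARD('n) - 1))" for z ws
    unfolding delbar_eq using wirtinger_form_conv[OF k \<eta> that form_average_conv[OF \<eta>]] .
  from wirtinger_form_conv[OF k smooth_form_wirtinger[OF \<eta>] len this[unfolded delbar_eq]]
  have "del (delbar (form_average r \<eta>)) z standard_frame = ball_average r G z" for z
    unfolding ball_average_conv[OF test_fun_continuous[OF G]] G_def del_eq delbar_eq .
  then show ?thesis
    unfolding del_delbar_current_def using ball_average_pairing[OF \<phi> G, of r] by (simp add: G_def)
qed

lemma ball_average_one:
  assumes "r > 0"
  shows "ball_average r (\<lambda>_. 1 :: real) (z :: complex ^ 'n) = 1"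
proof -
  have "ball_average r (\<lambda>_. 1 :: real) z = (LINT w|lborel. ball_kernel r (z - w))"
    by (simp add: ball_average_def ball_kernel_def)
  also have "\<dots> = (LINT w|lborel. ball_kernel r (w :: complex ^ 'n))"
    by (rule integral_reflect[of "ball_kernel r" z]) measurable
  also have "\<dots> = 1"
    using assms by (simp add: ball_kernel_def[abs_def] content_ball_gt_0_iff less_imp_neq[THEN not_sym])
  finally show ?thesis .
qed

lemma integral_ball_average:
  assumes "r > 0" "test_fun F"
  shows "(LINT z|lborel. ball_average r F (z :: complex ^ 'n)) = (LINT z|lborel. F z)"
  using ball_average_pairing[OF loc_integrable_bounded[of "\<lambda>_. 1" 1] assms(2), of r]
  by (simp add: ball_average_one[OF assms(1)])

lemma length_trace_frame:
  "k < CARD('n) \<Longrightarrow> length (complex_frame (remove_nth k (std_axes :: (complex ^ 'n) list))) = 2 * (CARD('n) - 1)"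
  by (simp add: length_remove_nth)

lemma kaehler_current_average:
  fixes \<eta> :: "('n::finite) form"
  assumes r: "r > 0" and \<eta>: "smooth_form (2 * (CARD('n) - 1)) \<eta>"
  shows "kaehler_current (form_average r \<eta>) = (LINT z|lborel. trace_form \<eta> z)"
proof -
  have t: "test_fun (\<lambda>z. \<eta> z (complex_frame (remove_nth k std_axes)))" if "k < CARD('n)" for k
    using smooth_form_slot[OF \<eta> length_trace_frame[OF that]] .
  have t': "test_fun (\<lambda>z. form_average r \<eta> z (complex_frame (remove_nth k std_axes)))" if "k < CARD('n)" for k
    using smooth_form_slot[OF smooth_form_average[OF \<eta>] length_trace_frame[OF that]] .
  have "(LINT z|lborel. trace_form (form_average r \<eta>) z) =
      (\<Sum>k<CARD('n). LINT z|lborel. form_average r \<eta> z (complex_frame (remove_nth k std_axes)))"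
    unfolding trace_form_def by (intro Bochner_Integration.integral_sum test_fun_integrable t') auto
  also have "\<dots> = (\<Sum>k<CARD('n). LINT z|lborel. \<eta> z (complex_frame (remove_nth k std_axes)))"
    unfolding form_average_def by (intro sum.cong refl integral_ball_average r t) auto
  also have "\<dots> = (LINT z|lborel. trace_form \<eta> z)"
    unfolding trace_form_def by (intro Bochner_Integration.integral_sum[symmetric] test_fun_integrable t) auto
  finally show ?thesis using kaehler_current_trace[OF smooth_form_average[OF \<eta>]] by simp
qed

section \<open>Unitary tangent frames\<close>

lemma herm_commute: "herm v u = cnj (herm u v)"
  by (simp add: herm_def mult.commute)

lemma unitary_list_herm:
  "unitary_list us \<longleftrightarrow> (\<forall>i<length us. \<forall>j<length us. herm (us ! i) (us ! j) = of_bool (i = j))"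
  by (simp add: unitary_list_def herm_def)

lemma unitary_list_component:
  assumes "unitary_list us" "u \<in> set us"
  shows "cmod (u $ j) \<le> 1"
proof -
  obtain i where i: "i < length us" "u = us ! i" using assms(2) by (metis in_set_conv_nth)
  have "herm u u = 1" using assms(1) i by (simp add: unitary_list_herm)
  then have "u \<bullet> u = 1" by (simp add: Re_herm[symmetric])
  then have "norm u = 1" by (simp add: norm_eq_sqrt_inner)
  then show ?thesis using Finite_Cartesian_Product.norm_nth_le[of u j] by simp
qed

text \<open>Gram-Schmidt by counting real dimensions: orthogonality to the \<open>m + 1\<close> vectors \<open>l\<close> and \<open>us\<close> in
the Hermitian sense is real orthogonality to them and their multiples by \<open>\<i>\<close>, that is
at most \<open>2 (m + 1) < 2 n\<close> real conditions.\<close>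

lemma unitary_list_orthogonal_to:
  fixes l :: "complex ^ 'n"
  assumes "m < CARD('n)"
  shows "\<exists>us. length us = m \<and> unitary_list us \<and> (\<forall>u\<in>set us. herm u l = 0)"
  using assms
proof (induction m)
  case 0
  show ?case by (rule exI[of _ "[]"]) (simp add: unitary_list_def)
next
  case (Suc m)
  then obtain us where us: "length us = m" "unitary_list us" "\<forall>u\<in>set us. herm u l = 0" by auto
  define T where "T = insert l (set us)"
  define S where "S = T \<union> (\<lambda>v. \<i> *s v) ` T"
  have finT: "finite T" by (simp add: T_def)
  have "card T \<le> Suc m" unfolding T_def using card_length[of us] us(1) by (simp add: card_insert_if)
  moreover have "card S \<le> card T + card T"
    unfolding S_def using card_Un_le[of T "(\<lambda>v. \<i> *s v) ` T"] card_image_le[OF finT, of "\<lambda>v. \<i> *s v"] by linarith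
  ultimately have "card S < DIM(complex ^ 'n)" using Suc.prems by simp
  moreover have "dim S \<le> card S" using finT by (intro dim_le_card') (simp add: S_def)
  ultimately obtain x where x: "x \<noteq> 0" "span S \<subseteq> {y. x \<bullet> y = 0}"
    using lowdim_subset_hyperplane[of S] by auto
  have orth: "herm x v = 0" if "v \<in> T" for v
  proof -
    have "v \<in> span S" "\<i> *s v \<in> span S" using that by (auto simp: S_def intro: span_base)
    then have "x \<bullet> v = 0" "x \<bullet> (\<i> *s v) = 0" using x(2) by auto
    then show ?thesis by (simp add: complex_eq_iff Re_herm inner_i)
  qed
  define u where "u = complex_of_real (1 / norm x) *s x"
  have u0: "herm u v = 0" if "v \<in> T" for v using orth[OF that] by (simp add: u_def herm_scale)
  have u0': "herm v u = 0" if "v \<in> T" for v using u0[OF that] herm_commute[of v u] by simp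
  have "herm x x = complex_of_real ((norm x)\<^sup>2)"
    using herm_commute[of x x] by (simp add: complex_eq_iff Re_herm power2_norm_eq_inner)
  then have uu: "herm u u = 1"
    using x(1) by (simp add: u_def herm_scale power2_eq_square)
  have "unitary_list (us @ [u])"
    unfolding unitary_list_herm
  proof (intro allI impI)
    fix i j assume ij: "i < length (us @ [u])" "j < length (us @ [u])"
    have T: "us ! k \<in> T" if "k < m" for k using that us(1) by (simp add: T_def)
    show "herm ((us @ [u]) ! i) ((us @ [u]) ! j) = of_bool (i = j)"
      using ij us(1,2) uu u0[OF T] u0'[OF T] by (auto simp: nth_append unitary_list_herm less_Suc_eq)
  qed
  moreover have "\<forall>v\<in>set (us @ [u]). herm v l = 0"
    using us(3) u0[of l] by (simp add: T_def)
  ultimately show ?case using us(1) by (intro exI[of _ "us @ [u]"]) simp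
qed

text \<open>This makes the choice in the definition of \<open>tangent_frame\<close> a genuine one: at a regular point the
tangent space contains the kernel of a complex linear form.\<close>

lemma tangent_unitary_list:
  fixes W :: "(complex ^ 'n) set"
  assumes "z \<in> regular_part W"
  shows "\<exists>us. length us = CARD('n) - 1 \<and> unitary_list us \<and> set us \<subseteq> tangent_space W z"
proof -
  obtain U g where g: "submersive_equation W z U g" using assms by (auto simp: regular_part_def)
  define L where "L = frechet_derivative g (at z)"
  have hol: "holomorphic_at g z" using g by (auto simp: submersive_equation_def)
  then have "linear L" unfolding holomorphic_at_def L_def by (simp add: linear_frechet_derivative)
  define l where "l = (\<chi> k. cnj (L (axis k 1)))"
  have L: "L v = herm v l" for v
  proof -
    have "L v = L (\<Sum>k\<in>UNIV. v $ k *s axis k 1)" by (simp only: basis_expansion)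
    also have "\<dots> = (\<Sum>k\<in>UNIV. L (v $ k *s axis k 1))" using \<open>linear L\<close> by (rule linear_sum)
    also have "\<dots> = herm v l" using hol by (simp add: herm_def l_def holomorphic_at_def L_def)
    finally show ?thesis .
  qed
  obtain us where us: "length us = CARD('n) - 1" "unitary_list us" "\<forall>u\<in>set us. herm u l = 0"
    using unitary_list_orthogonal_to[of "CARD('n) - 1" l] by auto
  have "set us \<subseteq> tangent_space W z"
    using us(3) g by (auto simp: tangent_space_def L[symmetric] L_def)
  then show ?thesis using us by blast
qed

lemma tangent_frame_unitary:
  fixes W :: "(complex ^ 'n) set"
  assumes "z \<in> regular_part W"
  obtains us where "length us = CARD('n) - 1" "unitary_list us" "tangent_frame W z = complex_frame us"
  using someI_ex[OF tangent_unitary_list[OF assms]] unfolding tangent_frame_def by blast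

section \<open>Local integrability of plurisubharmonic functions\<close>

lemma linear_scalar_mult: "linear (\<lambda>z :: complex ^ 'n. c *s z)"
  by (rule linearI) (simp_all add: vec_eq_iff algebra_simps)

lemma measurable_scalar_mult [measurable]: "(\<lambda>z :: complex ^ 'n. c *s z) \<in> borel_measurable borel"
  by (rule borel_measurable_continuous_onI)
    (rule linear_continuous_on[OF linear_scalar_mult[of c, unfolded linear_conv_bounded_linear]])

lemma nn_integral_lborel_shift:
  fixes f :: "'a::euclidean_space \<Rightarrow> ennreal"
  assumes [measurable]: "f \<in> borel_measurable borel"
  shows "(\<integral>\<^sup>+x. f (t + x) \<partial>lborel) = (\<integral>\<^sup>+x. f x \<partial>lborel)"
  by (subst (2) lborel_distr_plus[of t, symmetric]) (simp add: nn_integral_distr)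

text \<open>Uniqueness of a translation invariant measure, in the form needed here. The Tonelli theorem,
applied to \<open>\<integral>\<integral> 1\<^sub>A(T x) 1\<^sub>B(y)\<close> after the shifts \<open>y \<mapsto> y - T x\<close> and
\<open>x \<mapsto> T\<^sup>-\<^sup>1 y + x\<close>, compares the volumes of \<open>T\<^sup>-\<^sup>1 A\<close> and \<open>A\<close>; the unit ball \<open>B\<close> is invariant
under \<open>T\<close>, so the two volumes agree.\<close>

lemma lborel_rotate:
  assumes c: "cmod c = 1"
  shows "distr lborel borel (\<lambda>z :: complex ^ 'n. c *s z) = lborel"
proof (rule measure_eqI)
  fix A :: "(complex ^ 'n) set"
  assume "A \<in> sets (distr lborel borel (\<lambda>z :: complex ^ 'n. c *s z))"
  then have [measurable]: "A \<in> sets borel" by simp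
  \<comment> \<open>Any rotation invariant set of positive finite volume would do.\<close>
  define B where "B = ball (0 :: complex ^ 'n) 1"
  have [measurable]: "B \<in> sets borel" by (simp add: B_def)
  define T where "T x = c *s x" for x :: "complex ^ 'n"
  have [measurable]: "T \<in> borel_measurable borel" unfolding T_def[abs_def] by measurable
  have shift: "T (inverse c *s y + x) = y + T x" for x y
  proof -
    have "c * inverse c = 1" using c by (intro right_inverse) auto
    then show ?thesis by (simp add: T_def vec_eq_iff distrib_left mult.assoc[symmetric])
  qed
  have TB: "- T x \<in> B \<longleftrightarrow> x \<in> B" for x
    using c by (simp add: T_def B_def norm_scalar_mult)
  have "emeasure lborel (T -` A) * emeasure lborel B
      = (\<integral>\<^sup>+x. indicator A (T x) * (\<integral>\<^sup>+y. indicator B y \<partial>lborel) \<partial>lborel)"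
    by (subst nn_integral_multc) (auto simp: nn_integral_indicator[symmetric] indicator_vimage[symmetric] vimage_def indicator_def intro!: nn_integral_cong)
  also have "\<dots> = (\<integral>\<^sup>+x. indicator A (T x) * (\<integral>\<^sup>+y. indicator B (- T x + y) \<partial>lborel) \<partial>lborel)"
  proof -
    have "(\<integral>\<^sup>+y. indicator B (- T x + y) \<partial>lborel) = (\<integral>\<^sup>+y. indicator B y \<partial>lborel)" for x
      by (rule nn_integral_lborel_shift) measurable
    then show ?thesis by (simp only:)
  qed
  also have "\<dots> = (\<integral>\<^sup>+x. (\<integral>\<^sup>+y. indicator A (T x) * indicator B (- T x + y) \<partial>lborel) \<partial>lborel)"
    by (simp add: nn_integral_cmult)
  also have "\<dots> = (\<integral>\<^sup>+y. (\<integral>\<^sup>+x. indicator A (T x) * indicator B (- T x + y) \<partial>lborel) \<partial>lborel)"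
    by (rule lborel_pair.Fubini') measurable
  also have "\<dots> = (\<integral>\<^sup>+y. (\<integral>\<^sup>+x. indicator A (T (inverse c *s y + x)) * indicator B (- T (inverse c *s y + x) + y) \<partial>lborel) \<partial>lborel)"
  proof (rule nn_integral_cong)
    fix y :: "complex ^ 'n"
    show "(\<integral>\<^sup>+x. indicator A (T x) * indicator B (- T x + y) \<partial>lborel) =
      (\<integral>\<^sup>+x. indicator A (T (inverse c *s y + x)) * indicator B (- T (inverse c *s y + x) + y) \<partial>lborel)"
      by (rule nn_integral_lborel_shift[symmetric]) measurable
  qed
  also have "\<dots> = (\<integral>\<^sup>+y. (\<integral>\<^sup>+x. indicator B x * indicator A (T x + y) \<partial>lborel) \<partial>lborel)"
    unfolding shift using TB by (intro nn_integral_cong) (simp add: indicator_def add.commute)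
  also have "\<dots> = (\<integral>\<^sup>+x. (\<integral>\<^sup>+y. indicator B x * indicator A (T x + y) \<partial>lborel) \<partial>lborel)"
    by (rule lborel_pair.Fubini') measurable
  also have "\<dots> = (\<integral>\<^sup>+x. indicator B x * (\<integral>\<^sup>+y. indicator A y \<partial>lborel) \<partial>lborel)"
    by (simp add: nn_integral_cmult nn_integral_lborel_shift)
  also have "\<dots> = emeasure lborel A * emeasure lborel B"
    by (simp add: nn_integral_multc mult.commute)
  finally have "emeasure lborel (T -` A) * emeasure lborel B = emeasure lborel A * emeasure lborel B" .
  moreover have "emeasure lborel B \<noteq> 0" "emeasure lborel B \<noteq> \<infinity>"
    unfolding B_def using emeasure_ball[of 1 "0 :: complex ^ 'n"] by (simp_all add: ennreal_eq_0_iff not_le)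
  ultimately have "emeasure lborel (T -` A) = emeasure lborel A"
    by (simp add: ennreal_mult_cancel_left mult.commute[of _ "emeasure lborel B"])
  then show "emeasure (distr lborel borel (\<lambda>z. c *s z)) A = emeasure lborel A"
    by (simp add: emeasure_distr T_def[abs_def])
qed simp

lemma psh_measurable:
  assumes "plurisubharmonic \<phi>"
  shows "\<phi> \<in> borel_measurable borel"
  by (rule borel_measurableI_less) (use assms in \<open>auto simp: plurisubharmonic_def\<close>)

lemma psh_bounded_above:
  assumes "plurisubharmonic \<phi>" "compact K"
  obtains M where "0 \<le> M" "\<And>z. z \<in> K \<Longrightarrow> \<phi> z \<le> ereal M"
proof -
  have op: "open {z. \<phi> z < ereal (real k)}" for k using assms(1) by (auto simp: plurisubharmonic_def)
  have "K \<subseteq> (\<Union>k\<in>(UNIV :: nat set). {z. \<phi> z < ereal (real k)})"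
  proof
    fix z
    have "\<phi> z < \<infinity>" using assms(1) by (simp add: plurisubharmonic_def)
    then obtain k where "\<phi> z < ereal (real k)" using less_PInf_Ex_of_nat[of "\<phi> z"] by auto
    then show "z \<in> (\<Union>k\<in>(UNIV :: nat set). {z. \<phi> z < ereal (real k)})" by auto
  qed
  then obtain F where F: "finite F" "K \<subseteq> (\<Union>k\<in>F. {z. \<phi> z < ereal (real k)})"
    using compactE_image[OF assms(2), of UNIV "\<lambda>k. {z. \<phi> z < ereal (real k)}"] op by metis
  show thesis
  proof (rule that[of "real (\<Sum>k\<in>F. k)"])
    fix z assume "z \<in> K"
    then obtain k where k: "k \<in> F" "\<phi> z < ereal (real k)" using F by auto
    then have "k \<le> (\<Sum>k\<in>F. k)" using F(1) by (intro member_le_sum) auto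
    then have "real k \<le> real (\<Sum>k\<in>F. k)" by (rule of_nat_mono)
    then show "\<phi> z \<le> ereal (real (\<Sum>k\<in>F. k))" using k by (meson ereal_less_eq(3) less_imp_le order_trans)
  qed (rule of_nat_0_le_iff)
qed

lemma emeasure_uniform_circle: "emeasure (uniform_measure lborel {0..2*pi :: real}) UNIV = 1"
proof -
  have "ennreal (2 * pi) \<noteq> 0" using pi_gt_zero by (simp add: ennreal_eq_0_iff not_le)
  then show ?thesis by (simp add: ennreal_divide_self)
qed

text \<open>The sub-mean value inequality at a point with finite value bounds the negative part of \<open>\<phi>\<close> on all
circles around that point.\<close>

lemma psh_circle_bound:
  assumes \<phi>: "plurisubharmonic \<phi>" and a: "\<phi> a = ereal x" and M: "0 \<le> M" "\<And>z. z \<in> cball a R \<Longrightarrow> \<phi> z \<le> ereal M"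
    and b: "norm b \<le> R"
  shows "(\<integral>\<^sup>+\<theta>. e2ennreal (- \<phi> (a + cis \<theta> *s b)) \<partial>uniform_measure lborel {0..2*pi}) \<le> ennreal (M - x)"
proof -
  let ?U = "uniform_measure lborel {0..2*pi}"
  define p where "p = (\<integral>\<^sup>+\<theta>. e2ennreal (\<phi> (a + cis \<theta> *s b)) \<partial>?U)"
  define n where "n = (\<integral>\<^sup>+\<theta>. e2ennreal (- \<phi> (a + cis \<theta> *s b)) \<partial>?U)"
  have "p \<le> (\<integral>\<^sup>+\<theta>. ennreal M \<partial>?U)"
    unfolding p_def
  proof (rule nn_integral_mono)
    fix \<theta>
    have "a + cis \<theta> *s b \<in> cball a R" using b by (simp add: dist_norm norm_scalar_mult)
    then have "e2ennreal (\<phi> (a + cis \<theta> *s b)) \<le> e2ennreal (ereal M)" by (intro e2ennreal_mono M)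
    then show "e2ennreal (\<phi> (a + cis \<theta> *s b)) \<le> ennreal M" by simp
  qed
  also have "\<dots> = ennreal M" by (simp add: emeasure_uniform_circle del: emeasure_uniform_measure)
  finally have pM: "p \<le> ennreal M" .
  have sub: "ereal x \<le> enn2ereal p - enn2ereal n"
    using \<phi> a unfolding plurisubharmonic_def ereal_integral_def p_def n_def by metis
  obtain p' where p': "p = ennreal p'" "0 \<le> p'" "p' \<le> M"
    using pM M(1) by (cases p) (auto simp: ennreal_le_iff top_unique)
  show ?thesis
  proof (cases n)
    case (real n')
    then have "x \<le> p' - n'" using sub p' by (simp add: enn2ereal_ennreal)
    then show ?thesis unfolding n_def[symmetric] using real p' by (simp add: ennreal_leI)
  next
    case top
    then show ?thesis using sub p' by (simp add: enn2ereal_ennreal)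
  qed
qed

text \<open>Integrating the bound on circles over all \<open>b\<close> in a ball, and using that rotations preserve the
volume, bounds the integral of the negative part over the ball. As the radius is arbitrary, one
point with finite value suffices.\<close>

lemma psh_integrable_cball:
  fixes \<phi> :: "complex ^ 'n \<Rightarrow> ereal"
  assumes \<phi>: "plurisubharmonic \<phi>" and a: "\<phi> a = ereal x" and R: "R > 0"
  shows "set_integrable lborel (cball a R) (\<lambda>z. real_of_ereal (\<phi> z))"
proof -
  let ?U = "uniform_measure lborel {0..2*pi} :: real measure"
  let ?N = "\<lambda>z. e2ennreal (- \<phi> z)"
  let ?B = "cball (0 :: complex ^ 'n) R"
  interpret U: finite_measure ?U by (rule finite_measureI) (simp add: emeasure_uniform_circle del: emeasure_uniform_measure)
  interpret UL: pair_sigma_finite ?U "lborel :: (complex ^ 'n) measure"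
    by (intro pair_sigma_finite.intro U.sigma_finite_measure_axioms sigma_finite_lborel)
  have [measurable]: "\<phi> \<in> borel_measurable borel" using psh_measurable[OF \<phi>] .
  have [measurable]: "?B \<in> sets borel" "cball a R \<in> sets borel" by auto
  obtain M where M: "0 \<le> M" "\<And>z. z \<in> cball a R \<Longrightarrow> \<phi> z \<le> ereal M"
    using psh_bounded_above[OF \<phi>, of "cball a R"] by auto
  have "(\<lambda>p. a + cis (fst p) *s snd p) \<in> borel_measurable (borel :: (real \<times> (complex ^ 'n)) measure)"
    unfolding vector_scalar_mult_def
    by (intro borel_measurable_continuous_onI continuous_intros continuous_on_vec_lambda) 
  then have "(\<lambda>p. a + cis (fst p) *s snd p) \<in> borel_measurable (borel \<Otimes>\<^sub>M (borel :: (complex ^ 'n) measure))"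
    by (simp add: borel_prod)
  moreover have "sets (?U \<Otimes>\<^sub>M (lborel :: (complex ^ 'n) measure)) = sets (borel \<Otimes>\<^sub>M borel)"
    by (intro sets_pair_measure_cong) auto
  ultimately have [measurable]: "(\<lambda>p. a + cis (fst p) *s snd p) \<in> borel_measurable (?U \<Otimes>\<^sub>M (lborel :: (complex ^ 'n) measure))"
    by (subst measurable_cong_sets) auto
  define f where "f \<theta> b = indicator ?B b * ?N (a + cis \<theta> *s b)" for \<theta> b
  have f_meas: "(\<lambda>(\<theta>, b). f \<theta> b) \<in> borel_measurable (?U \<Otimes>\<^sub>M lborel)"
    unfolding f_def case_prod_beta
  proof (rule borel_measurable_times_ennreal)
    have "?N \<in> borel_measurable borel" by measurable
    then show "(\<lambda>p. ?N (a + cis (fst p) *s snd p)) \<in> borel_measurable (?U \<Otimes>\<^sub>M lborel)"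
      by (rule measurable_compose[rotated]) measurable
    have "(indicator ?B :: _ \<Rightarrow> ennreal) \<in> borel_measurable lborel"
      by (rule borel_measurable_indicator) simp
    then show "(\<lambda>p. indicator ?B (snd p) :: ennreal) \<in> borel_measurable (?U \<Otimes>\<^sub>M lborel)"
      by (rule measurable_compose[rotated]) (rule measurable_snd)
  qed
  define I where "I = (\<integral>\<^sup>+b. indicator ?B b * ?N (a + b) \<partial>lborel)"
  have rot: "(\<integral>\<^sup>+b. f \<theta> b \<partial>lborel) = I" for \<theta>
  proof -
    have "I = (\<integral>\<^sup>+b. indicator ?B b * ?N (a + b) \<partial>distr lborel borel (\<lambda>z. cis \<theta> *s z))"
      unfolding I_def by (subst lborel_rotate) auto
    also have "\<dots> = (\<integral>\<^sup>+b. indicator ?B (cis \<theta> *s b) * ?N (a + cis \<theta> *s b) \<partial>lborel)"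
      by (subst nn_integral_distr) auto
    also have "\<dots> = (\<integral>\<^sup>+b. f \<theta> b \<partial>lborel)"
      by (intro nn_integral_cong) (simp add: f_def indicator_def norm_scalar_mult)
    finally show ?thesis by simp
  qed
  have "I = (\<integral>\<^sup>+\<theta>. (\<integral>\<^sup>+b. f \<theta> b \<partial>lborel) \<partial>?U)"
    unfolding rot by (simp add: emeasure_uniform_circle del: emeasure_uniform_measure)
  also have "\<dots> = (\<integral>\<^sup>+b. (\<integral>\<^sup>+\<theta>. f \<theta> b \<partial>?U) \<partial>lborel)"
    using f_meas by (rule UL.Fubini'[symmetric])
  also have "\<dots> \<le> (\<integral>\<^sup>+b. ennreal (M - x) * indicator ?B b \<partial>lborel)"
  proof (rule nn_integral_mono)
    fix b
    show "(\<integral>\<^sup>+\<theta>. f \<theta> b \<partial>?U) \<le> ennreal (M - x) * indicator ?B b"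
      using psh_circle_bound[OF \<phi> a M, where b = b] by (simp add: f_def indicator_def)
  qed
  also have "\<dots> = ennreal (M - x) * emeasure lborel ?B" by (simp add: nn_integral_cmult)
  also have "\<dots> < \<infinity>"
    using emeasure_lborel_cball_finite[of "0 :: complex ^ 'n" R] by (simp add: ennreal_mult_less_top)
  finally have I: "I < \<infinity>" .
  have shift: "(\<integral>\<^sup>+z. indicator (cball a R) z * ?N z \<partial>lborel) = I"
  proof -
    have "(\<integral>\<^sup>+z. indicator (cball a R) z * ?N z \<partial>lborel) = (\<integral>\<^sup>+b. indicator (cball a R) (a + b) * ?N (a + b) \<partial>lborel)"
      by (rule nn_integral_lborel_shift[symmetric]) measurable
    also have "\<dots> = I" unfolding I_def by (intro nn_integral_cong) (simp add: indicator_def dist_norm)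
    finally show ?thesis .
  qed
  have "(\<integral>\<^sup>+z. ennreal (norm (indicat_real (cball a R) z *\<^sub>R real_of_ereal (\<phi> z))) \<partial>lborel)
      \<le> (\<integral>\<^sup>+z. ennreal M * indicator (cball a R) z + indicator (cball a R) z * ?N z \<partial>lborel)"
  proof (rule nn_integral_mono)
    fix z
    show "ennreal (norm (indicat_real (cball a R) z *\<^sub>R real_of_ereal (\<phi> z)))
       \<le> ennreal M * indicator (cball a R) z + indicator (cball a R) z * ?N z"
    proof (cases "z \<in> cball a R")
      case True
      have "ennreal \<bar>real_of_ereal (\<phi> z)\<bar> \<le> ennreal M + ?N z"
      proof (cases "\<phi> z")
        case (real y)
        then have "y \<le> M" using M(2)[OF True] by simp
        then have "\<bar>y\<bar> \<le> M + max 0 (- y)" using M(1) by auto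
        then have "ennreal \<bar>y\<bar> \<le> ennreal (M + max 0 (- y))" by (rule ennreal_leI)
        also have "\<dots> = ennreal M + ennreal (max 0 (- y))" using M(1) by (rule ennreal_plus) simp
        finally have "ennreal \<bar>y\<bar> \<le> ennreal M + ennreal (max 0 (- y))" .
        moreover have "ennreal (max 0 (- y)) = ?N z"
          using real by (cases "y \<le> 0") (simp_all add: max_def e2ennreal_neg ennreal_neg)
        ultimately show ?thesis using real by simp
      qed (use M(2)[OF True] in auto)
      then show ?thesis using True by simp
    qed simp
  qed
  also have "\<dots> = ennreal M * emeasure lborel (cball a R) + I"
    by (subst nn_integral_add) (simp_all add: nn_integral_cmult shift)
  also have "\<dots> < \<infinity>"
    using I emeasure_lborel_cball_finite[of a R] by (simp add: ennreal_mult_less_top)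
  finally show ?thesis
    unfolding set_integrable_def by (intro integrableI_bounded) auto
qed

lemma psh_loc_integrable:
  fixes \<phi> :: "complex ^ 'n \<Rightarrow> ereal"
  assumes \<phi>: "plurisubharmonic \<phi>"
  shows "loc_integrable (\<lambda>z. real_of_ereal (\<phi> z))"
proof -
  obtain a where "\<phi> a \<noteq> - \<infinity>" "\<phi> a < \<infinity>" using \<phi> by (auto simp: plurisubharmonic_def)
  then obtain x where a: "\<phi> a = ereal x" by (cases "\<phi> a") auto
  have [measurable]: "\<phi> \<in> borel_measurable borel" using psh_measurable[OF \<phi>] .
  have "set_integrable lborel (cball 0 R) (\<lambda>z. real_of_ereal (\<phi> z))" for R
  proof (rule set_integrable_subset[OF psh_integrable_cball[OF \<phi> a]])
    show "0 < \<bar>R\<bar> + norm a + 1" using norm_ge_zero[of a] by linarith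
    show "cball 0 R \<subseteq> cball a (\<bar>R\<bar> + norm a + 1)"
    proof
      fix z assume "z \<in> cball (0 :: complex ^ 'n) R"
      then show "z \<in> cball a (\<bar>R\<bar> + norm a + 1)"
        using norm_triangle_ineq4[of a z] by (simp add: dist_norm)
    qed
  qed simp
  moreover have "(\<lambda>z. real_of_ereal (\<phi> z)) \<in> borel_measurable borel" by measurable
  ultimately show ?thesis unfolding loc_integrable_def by blast
qed

section \<open>Averaged currents of integration\<close>

lemma emeasure_density_indicator:
  assumes "W \<in> sets H" "A \<in> sets H"
  shows "emeasure (density H (indicator W)) A = emeasure H (W \<inter> A)"
  using assms by (simp add: emeasure_density flip: indicator_inter_arith)

lemma sum_nonneg_Reals: "(\<And>i. i \<in> I \<Longrightarrow> f i \<in> \<real>\<^sub>\<ge>\<^sub>0) \<Longrightarrow> sum f I \<in> \<real>\<^sub>\<ge>\<^sub>0"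
  by (induction I rule: infinite_finite_induct) (simp_all add: nonneg_Reals_add_I)

lemma sets_hausdorff_measure [simp]: "sets (hausdorff_measure d) = sets borel"
  using sets.sigma_sets_eq[of borel] unfolding hausdorff_measure_def by simp

lemma trace_form_test_fun:
  fixes \<eta> :: "('n::finite) form"
  assumes "smooth_form (2 * (CARD('n) - 1)) \<eta>"
  shows "test_fun (trace_form \<eta>)"
  unfolding trace_form_def[abs_def]
  by (intro test_fun_sum smooth_form_slot[OF assms] length_trace_frame) simp

lemma trace_form_nonneg:
  fixes \<eta> :: "('n::finite) form"
  assumes "positive_covector (CARD('n) - 1) (\<eta> z)"
  shows "trace_form \<eta> z = complex_of_real (Re (trace_form \<eta> z))" "0 \<le> Re (trace_form \<eta> z)"
proof -
  have "trace_form \<eta> z \<in> \<real>\<^sub>\<ge>\<^sub>0"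
    unfolding trace_form_def
    using assms by (intro sum_nonneg_Reals) (simp add: positive_covector_def length_remove_nth)
  then show "trace_form \<eta> z = complex_of_real (Re (trace_form \<eta> z))" "0 \<le> Re (trace_form \<eta> z)"
    by (auto simp: complex_nonneg_Reals_iff complex_eq_iff)
qed

lemma positive_covector_average:
  assumes "\<And>z. positive_covector p (\<eta> z)"
  shows "positive_covector p (form_average r \<eta> z)"
  unfolding positive_covector_def form_average_def
  using assms by (auto intro!: ball_average_nonneg_Reals simp: positive_covector_def)

lemma trace_form_average:
  fixes \<eta> :: "('n::finite) form"
  assumes \<eta>: "smooth_form (2 * (CARD('n) - 1)) \<eta>"
  shows "trace_form (form_average r \<eta>) z = ball_average r (trace_form \<eta>) z"
proof -
  have "trace_form (form_average r \<eta>) z = (\<Sum>k<CARD('n). 1 * conv (ball_kernel r) (\<lambda>w. \<eta> w (complex_frame (remove_nth k std_axes))) z)"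
    unfolding trace_form_def using form_average_conv[OF \<eta> length_trace_frame] by simp
  also have "\<dots> = conv (ball_kernel r) (\<lambda>w. \<Sum>k<CARD('n). 1 * \<eta> w (complex_frame (remove_nth k std_axes))) z"
    by (intro conv_sum[symmetric] loc_integrable_ball_kernel smooth_form_slot[OF \<eta>] length_trace_frame) simp
  also have "\<dots> = ball_average r (trace_form \<eta>) z"
    using ball_average_conv[OF test_fun_continuous[OF trace_form_test_fun[OF \<eta>]], of r z]
    by (simp add: trace_form_def[abs_def])
  finally show ?thesis .
qed

lemma nn_integral_ball_kernel_le:
  fixes \<mu> :: "(complex ^ 'n) measure"
  assumes sets: "sets \<mu> = sets borel" and bound: "emeasure \<mu> (cball w r) \<le> ennreal m" and m: "0 \<le> m"
  shows "(\<integral>\<^sup>+z. ennreal (ball_kernel r (z - w)) \<partial>\<mu>) \<le> ennreal (m / measure lborel (ball (0 :: complex ^ 'n) r))"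
proof -
  define V where "V = measure lborel (ball (0 :: complex ^ 'n) r)"
  have V: "0 \<le> V" by (simp add: V_def)
  have "(\<integral>\<^sup>+z. ennreal (ball_kernel r (z - w)) \<partial>\<mu>) \<le> (\<integral>\<^sup>+z. ennreal (1 / V) * indicator (cball w r) z \<partial>\<mu>)"
    by (intro nn_integral_mono)
      (auto simp: ball_kernel_def V_def[symmetric] indicator_def dist_norm norm_minus_commute)
  also have "\<dots> = ennreal (1 / V) * emeasure \<mu> (cball w r)"
    using sets by (intro nn_integral_cmult_indicator) simp
  also have "\<dots> \<le> ennreal (1 / V) * ennreal m" using bound by (rule mult_left_mono) simp
  also have "\<dots> = ennreal (m / V)" using V m by (simp add: ennreal_mult[symmetric])
  finally show ?thesis by (simp add: V_def)
qed

text \<open>The Tonelli theorem: averaging a function over balls and integrating against \<open>\<mu>\<close> is the same as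
integrating the \<open>\<mu>\<close>-mass of the balls, divided by their volume.\<close>

lemma nn_integral_average_le:
  fixes \<mu> :: "(complex ^ 'n) measure" and \<tau> :: "complex ^ 'n \<Rightarrow> real"
  assumes sets: "sets \<mu> = sets borel" and bound: "\<And>w. emeasure \<mu> (cball w r) \<le> ennreal m" and m: "0 \<le> m"
    and fin: "\<And>k::nat. emeasure \<mu> (cball 0 (real k)) < \<infinity>"
    and \<tau>: "integrable lborel \<tau>" "\<And>w. 0 \<le> \<tau> w"
  shows "(\<integral>\<^sup>+z. (\<integral>\<^sup>+w. ennreal (ball_kernel r (z - w) * \<tau> w) \<partial>lborel) \<partial>\<mu>)
     \<le> ennreal (m / measure lborel (ball (0 :: complex ^ 'n) r) * (LINT w|lborel. \<tau> w))"
proof -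
  interpret \<mu>: sigma_finite_measure \<mu>
  proof (unfold_locales, intro exI[of _ "range (\<lambda>k::nat. cball 0 (real k))"] conjI ballI)
    show "\<Union> (range (\<lambda>k::nat. cball (0 :: complex ^ 'n) (real k))) = space \<mu>"
    proof -
      have "\<exists>k::nat. z \<in> cball 0 (real k)" for z :: "complex ^ 'n"
        using real_arch_simple[of "norm z"] by simp
      moreover have "space \<mu> = UNIV" using sets_eq_imp_space_eq[OF sets] by simp
      ultimately show ?thesis by blast
    qed
    show "emeasure \<mu> A \<noteq> \<infinity>" if "A \<in> range (\<lambda>k::nat. cball (0 :: complex ^ 'n) (real k))" for A
    proof -
      obtain k :: nat where "A = cball 0 (real k)" using \<open>A \<in> _\<close> by blast
      then show ?thesis using fin[of k] by simp
    qed
    show "countable (range (\<lambda>k::nat. cball (0 :: complex ^ 'n) (real k)))" by simp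
    show "range (\<lambda>k::nat. cball (0 :: complex ^ 'n) (real k)) \<subseteq> sets \<mu>"
      unfolding sets by auto
  qed
  interpret P: pair_sigma_finite \<mu> "lborel :: (complex ^ 'n) measure"
    by (intro pair_sigma_finite.intro \<mu>.sigma_finite_measure_axioms sigma_finite_lborel)
  have [measurable_cong]: "sets \<mu> = sets borel" by (rule sets)
  have [measurable]: "\<tau> \<in> borel_measurable borel" using \<tau>(1) by auto
  define c where "c = m / measure lborel (ball (0 :: complex ^ 'n) r)"
  have c: "0 \<le> c" using m by (simp add: c_def)
  have "(\<integral>\<^sup>+z. (\<integral>\<^sup>+w. ennreal (ball_kernel r (z - w) * \<tau> w) \<partial>lborel) \<partial>\<mu>)
      = (\<integral>\<^sup>+w. (\<integral>\<^sup>+z. ennreal (ball_kernel r (z - w) * \<tau> w) \<partial>\<mu>) \<partial>lborel)"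
    by (rule P.Fubini'[symmetric]) measurable
  also have "\<dots> = (\<integral>\<^sup>+w. ennreal (\<tau> w) * (\<integral>\<^sup>+z. ennreal (ball_kernel r (z - w)) \<partial>\<mu>) \<partial>lborel)"
  proof (rule nn_integral_cong)
    fix w
    have "(\<integral>\<^sup>+z. ennreal (ball_kernel r (z - w) * \<tau> w) \<partial>\<mu>) = (\<integral>\<^sup>+z. ennreal (\<tau> w) * ennreal (ball_kernel r (z - w)) \<partial>\<mu>)"
      using \<tau>(2) by (simp add: ennreal_mult ball_kernel_nonneg mult.commute)
    also have "\<dots> = ennreal (\<tau> w) * (\<integral>\<^sup>+z. ennreal (ball_kernel r (z - w)) \<partial>\<mu>)"
      by (rule nn_integral_cmult) measurable
    finally show "(\<integral>\<^sup>+z. ennreal (ball_kernel r (z - w) * \<tau> w) \<partial>\<mu>) =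
        ennreal (\<tau> w) * (\<integral>\<^sup>+z. ennreal (ball_kernel r (z - w)) \<partial>\<mu>)" .
  qed
  also have "\<dots> \<le> (\<integral>\<^sup>+w. ennreal (\<tau> w) * ennreal c \<partial>lborel)"
    unfolding c_def by (intro nn_integral_mono mult_left_mono nn_integral_ball_kernel_le sets bound m) simp
  also have "\<dots> = (\<integral>\<^sup>+w. ennreal (\<tau> w) \<partial>lborel) * ennreal c"
    by (rule nn_integral_multc) measurable
  also have "(\<integral>\<^sup>+w. ennreal (\<tau> w) \<partial>lborel) = ennreal (LINT w|lborel. \<tau> w)"
    using \<tau> by (intro nn_integral_eq_integral) auto
  also have "ennreal (LINT w|lborel. \<tau> w) * ennreal c = ennreal (c * (LINT w|lborel. \<tau> w))"
    using c \<tau>(2) by (simp add: ennreal_mult[symmetric] integral_nonneg_AE mult.commute)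
  finally show ?thesis by (simp add: c_def)
qed

text \<open>At a regular point, the averaged form evaluated on the tangent frame is at most a constant times
its trace. Integrating over \<open>W\<close> and exchanging the order of averaging leaves the area of \<open>W\<close> in
balls of radius \<open>r\<close>. The estimate holds also if the integrand over the regular part fails to be
integrable, as the integral is then \<open>0\<close>.\<close>

lemma Upsilon_le_trace:
  fixes W :: "(complex ^ 'n) set" and \<eta> :: "'n form"
  defines "d \<equiv> 2 * (CARD('n) - 1)" and "p \<equiv> CARD('n) - 1"
  assumes W: "closed W" and C: "0 \<le> C" "\<And>a r. r > 0 \<Longrightarrow> emeasure (hausdorff_measure d) (W \<inter> cball a r) \<le> ennreal (C * r ^ d)"
    and \<eta>: "test_form p p \<eta>" "\<And>z. positive_covector p (\<eta> z)" and r: "r > 0"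
  shows "\<exists>u\<ge>0. Upsilon r W \<eta> = complex_of_real u \<and>
     u \<le> (2 ^ CARD('n)) ^ p * real (CARD('n) ^ p) * (C * r ^ d / measure lborel (ball (0 :: complex ^ 'n) r))
         * (LINT w|lborel. Re (trace_form \<eta> w))"
proof -
  define K where "K = (2 ^ CARD('n)) ^ p * real (CARD('n) ^ p)"
  have K: "K \<ge> 0" by (simp add: K_def)
  define H where "H = (hausdorff_measure d :: (complex ^ 'n) measure)"
  have setsH [measurable_cong]: "sets H = sets borel" by (simp add: H_def)
  have [measurable]: "W \<in> sets borel" using W by simp
  have s: "smooth_form (2 * (CARD('n) - 1)) \<eta>" using test_form_smooth[OF \<eta>(1)] by (simp add: p_def mult_2)
  have tf: "test_fun (trace_form \<eta>)" using trace_form_test_fun[OF s] .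
  define \<eta>' where "\<eta>' = form_average r \<eta>"
  define \<tau> where "\<tau> w = Re (trace_form \<eta> w)" for w
  have \<tau>: "0 \<le> \<tau> w" "trace_form \<eta> w = complex_of_real (\<tau> w)" for w
    using trace_form_nonneg[of \<eta> w] \<eta>(2)[of w] by (auto simp: \<tau>_def p_def)
  have \<tau>_int: "integrable lborel \<tau>"
    unfolding \<tau>_def[abs_def] by (rule integrable_Re[OF test_fun_integrable[OF tf]])
  have [measurable]: "\<tau> \<in> borel_measurable borel" using \<tau>_int by auto
  \<comment> \<open>The trace of the averaged form.\<close>
  define \<rho> where "\<rho> z = (LINT w|lborel. ball_kernel r (z - w) * \<tau> w)" for z
  have tr_avg: "trace_form \<eta>' z = complex_of_real (\<rho> z)" for z
  proof -
    have "trace_form \<eta>' z = (LINT w|lborel. complex_of_real (ball_kernel r (z - w) * \<tau> w))"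
      unfolding \<eta>'_def trace_form_average[OF s] ball_average_def ball_kernel_def[symmetric]
      by (simp add: \<tau>(2) scaleR_conv_of_real)
    then show ?thesis unfolding \<rho>_def by (simp only: integral_complex_of_real)
  qed
  have \<rho>: "ennreal (\<rho> z) = (\<integral>\<^sup>+w. ennreal (ball_kernel r (z - w) * \<tau> w) \<partial>lborel)" for z
  proof -
    have "integrable lborel (\<lambda>w. ball_kernel r (z - w) * \<tau> w)"
    proof (rule Bochner_Integration.integrable_bound[OF integrable_mult_right[OF \<tau>_int, of "1 / measure lborel (ball (0 :: complex ^ 'n) r)"]])
      show "AE w in lborel. norm (ball_kernel r (z - w) * \<tau> w) \<le> norm (1 / measure lborel (ball (0 :: complex ^ 'n) r) * \<tau> w)"
        unfolding real_norm_def abs_mult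
        by (intro AE_I2 mult_right_mono order_trans[OF ball_kernel_bound abs_ge_self]) simp
    qed measurable
    then show ?thesis unfolding \<rho>_def
      using \<tau>(1) by (intro nn_integral_eq_integral[symmetric]) (auto simp: ball_kernel_nonneg)
  qed
  have frame: "\<exists>y. 0 \<le> y \<and> y \<le> K * \<rho> z \<and> \<eta>' z (tangent_frame W z) = complex_of_real y"
    if z: "z \<in> regular_part W" for z
  proof -
    obtain us where us: "length us = CARD('n) - 1" "unitary_list us" "tangent_frame W z = complex_frame us"
      using tangent_frame_unitary[OF z] .
    have t': "test_form p p \<eta>'" unfolding \<eta>'_def using \<eta>(1) by (rule test_form_average)
    have pos': "positive_covector p (\<eta>' z)"
      unfolding \<eta>'_def using \<eta>(2) by (rule positive_covector_average)
    interpret positive_alternating p "\<eta>' z"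
      using t' pos' by unfold_locales (simp_all add: test_form_def of_type_def mult_2)
    obtain js where js: "distinct js" "set js = (UNIV :: 'n set)" "(std_axes :: (complex ^ 'n) list) = map (\<lambda>j. axis j 1) js"
      by (rule std_axes_list)
    have "frame_mass us \<le> K * (\<Sum>k<CARD('n). frame_mass (remove_nth k (map (\<lambda>j. axis j 1) js)))"
      unfolding K_def using us unitary_list_component[OF us(2)]
      by (intro frame_mass_le_trace js) (auto simp: p_def)
    also have "(\<Sum>k<CARD('n). frame_mass (remove_nth k (map (\<lambda>j. axis j 1) js))) = Re (trace_form \<eta>' z)"
      by (simp add: trace_form_def js(3) frame_mass_def)
    finally have "frame_mass us \<le> K * \<rho> z" by (simp add: tr_avg)
    moreover have "0 \<le> frame_mass us" "\<eta>' z (complex_frame us) = complex_of_real (frame_mass us)"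
      using frame_mass_nonneg a_complex_frame us(1) by (simp_all add: p_def)
    ultimately show ?thesis using us(3) by auto
  qed
  define f where "f z = indicat_real (regular_part W) z * Re (\<eta>' z (tangent_frame W z))" for z
  have f: "0 \<le> f z" "f z \<le> indicat_real W z * (K * \<rho> z)" "indicat_real (regular_part W) z *\<^sub>R \<eta>' z (tangent_frame W z) = complex_of_real (f z)" for z
  proof -
    have "0 \<le> \<rho> z" unfolding \<rho>_def by (intro integral_nonneg_AE AE_I2) (simp add: \<tau>(1) ball_kernel_nonneg)
    then have "0 \<le> f z \<and> f z \<le> indicat_real W z * (K * \<rho> z) \<and> indicat_real (regular_part W) z *\<^sub>R \<eta>' z (tangent_frame W z) = complex_of_real (f z)"
    proof (cases "z \<in> regular_part W")
      case True
      then have "z \<in> W" by (simp add: regular_part_def)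
      then show ?thesis using frame[OF True] True by (auto simp: f_def)
    qed (use K in \<open>simp add: f_def indicator_def\<close>)
    then show "0 \<le> f z" "f z \<le> indicat_real W z * (K * \<rho> z)" "indicat_real (regular_part W) z *\<^sub>R \<eta>' z (tangent_frame W z) = complex_of_real (f z)"
      by auto
  qed
  define u where "u = (LINT z|H. f z)"
  have Ups: "Upsilon r W \<eta> = complex_of_real u"
    unfolding Upsilon_def ball_average_current_def integration_current_def form_average_def[symmetric] \<eta>'_def[symmetric]
      set_lebesgue_integral_def d_def[symmetric] H_def[symmetric] f(3) u_def
    by (rule integral_complex_of_real)
  have u0: "0 \<le> u" unfolding u_def using f(1) by (intro integral_nonneg_AE AE_I2)
  define V where "V = measure lborel (ball (0 :: complex ^ 'n) r)"
  define B where "B = K * (C * r ^ d / V * (LINT w|lborel. \<tau> w))"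
  have T: "0 \<le> (LINT w|lborel. \<tau> w)" using \<tau>(1) by (intro integral_nonneg_AE AE_I2)
  have V: "0 \<le> V" by (simp add: V_def)
  have B: "0 \<le> B" unfolding B_def using K C r T V by (intro mult_nonneg_nonneg divide_nonneg_nonneg) auto
  \<comment> \<open>The integrand is dominated on all of \<open>W\<close>, which is closed, so that the Tonelli theorem applies to the bound.\<close>
  define \<mu> where "\<mu> = density H (indicator W)"
  have \<mu>_sets: "sets \<mu> = sets borel" by (simp add: \<mu>_def setsH)
  have \<mu>_cball: "emeasure \<mu> (cball a t) \<le> ennreal (C * t ^ d)" if "t > 0" for a t
    unfolding \<mu>_def using C(2)[OF that, of a] W by (subst emeasure_density_indicator) (simp_all add: setsH H_def)
  have \<rho>_borel: "(\<lambda>z. ennreal (\<rho> z)) \<in> borel_measurable borel"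
    unfolding \<rho> by measurable
  have \<rho>_H: "(\<lambda>z. ennreal (\<rho> z)) \<in> borel_measurable H"
    using \<rho>_borel by (simp only: measurable_cong_sets[OF setsH refl])
  have \<rho>_\<mu>: "(\<lambda>z. ennreal (\<rho> z)) \<in> borel_measurable \<mu>"
    using \<rho>_borel by (simp only: measurable_cong_sets[OF \<mu>_sets refl])
  have "(\<integral>\<^sup>+z. ennreal (f z) \<partial>H) \<le> (\<integral>\<^sup>+z. indicator W z * (ennreal K * ennreal (\<rho> z)) \<partial>H)"
  proof (rule nn_integral_mono)
    fix z
    have "ennreal (f z) \<le> ennreal (indicat_real W z * (K * \<rho> z))" using f(2) by (rule ennreal_leI)
    also have "\<dots> = indicator W z * (ennreal K * ennreal (\<rho> z))"
      using K by (simp add: indicator_def ennreal_mult')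
    finally show "ennreal (f z) \<le> indicator W z * (ennreal K * ennreal (\<rho> z))" .
  qed
  also have "\<dots> = (\<integral>\<^sup>+z. ennreal K * ennreal (\<rho> z) \<partial>\<mu>)"
    unfolding \<mu>_def using W \<rho>_H setsH
    by (intro nn_integral_density[symmetric] borel_measurable_indicator borel_measurable_times_ennreal) auto
  also have "\<dots> = ennreal K * (\<integral>\<^sup>+z. ennreal (\<rho> z) \<partial>\<mu>)"
    by (rule nn_integral_cmult[OF \<rho>_\<mu>])
  also have "\<dots> \<le> ennreal K * ennreal (C * r ^ d / V * (LINT w|lborel. \<tau> w))"
    unfolding \<rho> V_def
  proof (intro mult_left_mono nn_integral_average_le \<mu>_sets \<tau>_int \<tau>(1))
    show "emeasure \<mu> (cball w r) \<le> ennreal (C * r ^ d)" for w using \<mu>_cball[OF r] .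
    show "0 \<le> C * r ^ d" using C r by simp
    show "emeasure \<mu> (cball 0 (real k)) < \<infinity>" for k :: nat
    proof -
      have "emeasure \<mu> (cball 0 (real k)) \<le> emeasure \<mu> (cball 0 (real (Suc k)))"
        using \<mu>_sets by (intro emeasure_mono) auto
      also have "\<dots> \<le> ennreal (C * real (Suc k) ^ d)" by (rule \<mu>_cball) simp
      also have "\<dots> < \<infinity>" by simp
      finally show ?thesis .
    qed
  qed simp
  also have "\<dots> = ennreal B" unfolding B_def using K by (rule ennreal_mult'[symmetric])
  finally have nn: "(\<integral>\<^sup>+z. ennreal (f z) \<partial>H) \<le> ennreal B" .
  have "u \<le> B"
  proof (cases "integrable H f")
    case True
    then have "ennreal u \<le> ennreal B"
      using nn nn_integral_eq_integral[OF True] f(1) by (simp add: u_def)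
    then show ?thesis using B by simp
  next
    case False
    then show ?thesis using B by (simp add: u_def not_integrable_integral_eq)
  qed
  then show ?thesis
    using u0 Ups unfolding B_def K_def V_def \<tau>_def by (intro exI[of _ u]) (simp add: mult.assoc)
qed

section \<open>Vanishing of the upper density\<close>

theorem proposition3p2:
  fixes \<phi> :: "complex ^ 'n \<Rightarrow> ereal" and \<epsilon> :: real and W :: "(complex ^ 'n) set"
  assumes "plurisubharmonic \<phi>"
    and "\<epsilon> > 0"
    and "positive_current (\<lambda>\<eta>. \<i> * del_delbar_current (\<lambda>z. real_of_ereal (\<phi> z)) \<eta>
            - complex_of_real \<epsilon> * kaehler_current \<eta>)"
    and "algebraic_hypersurface W"
  shows "upper_density \<phi> W = 0"
proof -
  define p where "p = CARD('n) - 1"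
  define d where "d = 2 * (CARD('n) - 1)"
  define \<Phi> where "\<Phi> = (\<lambda>z. real_of_ereal (\<phi> z))"
  obtain P where P: "polynomial_map P" "\<not> P constant_on UNIV" "W = {z. P z = 0}"
    using assms(4) unfolding algebraic_hypersurface_def by blast
  obtain D where D: "line_poly D P" using polynomial_map_line_poly[OF P(1)] by blast
  have nz: "\<exists>z. P z \<noteq> 0" using P(2) unfolding constant_on_def by blast
  have W: "closed W"
    unfolding P(3) by (rule closed_Collect_eq[OF continuous_polynomial_map[OF P(1)] continuous_on_const])
  obtain C where C: "0 \<le> C" "\<And>a r. r > 0 \<Longrightarrow> emeasure (hausdorff_measure d) (W \<inter> cball a r) \<le> ennreal (C * r ^ d)"
    using zero_set_area_growth[OF D nz] unfolding P(3) d_def by blast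
  \<comment> \<open>With this constant, the averaged current of \<open>W\<close> is at most \<open>K / r\<^sup>2\<close> times the Kaehler form.\<close>
  define K where "K = (2 ^ CARD('n)) ^ p * real (CARD('n) ^ p) * C / unit_ball_vol (real (2 * CARD('n)))"
  have K: "0 \<le> K" using C(1) by (simp add: K_def)
  have "positive_current (\<lambda>\<eta>. \<i> / complex_of_real (2 * pi) * del_delbar_current (ball_average r \<Phi>) \<eta>
        - complex_of_real c * Upsilon r W \<eta>)"
    \<comment> \<open>Here \<open>c\<close> stands for \<open>1 / \<alpha>\<close>, also for \<open>\<alpha> = \<infinity>\<close>. The second bound on \<open>r\<close> makes \<open>c K / r\<^sup>2\<close> at most \<open>\<epsilon> / (2 \<pi>)\<close>.\<close>
    if c: "0 \<le> c" and r: "r \<ge> 1" "r \<ge> c * K * (2 * pi) / \<epsilon>" for c r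
    unfolding positive_current_def p_def[symmetric]
  proof (intro allI impI, elim conjE)
    fix \<eta> :: "'n form" assume \<eta>: "test_form p p \<eta>" "\<forall>z. positive_covector p (\<eta> z)"
    have r0: "r > 0" using r by simp
    have s: "smooth_form (2 * (CARD('n) - 1)) \<eta>" using test_form_smooth[OF \<eta>(1)] by (simp add: p_def mult_2)
    define T where "T = (LINT w|lborel. Re (trace_form \<eta> w))"
    have tr: "trace_form \<eta> w = complex_of_real (Re (trace_form \<eta> w))" "0 \<le> Re (trace_form \<eta> w)" for w
      using trace_form_nonneg[of \<eta> w] \<eta>(2) by (simp_all add: p_def)
    have T0: "0 \<le> T" unfolding T_def using tr(2) by (intro integral_nonneg_AE AE_I2)
    have kaehler: "kaehler_current (form_average r \<eta>) = complex_of_real T"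
    proof -
      have "kaehler_current (form_average r \<eta>) = (LINT w|lborel. complex_of_real (Re (trace_form \<eta> w)))"
        unfolding kaehler_current_average[OF r0 s] using tr(1) by simp
      then show ?thesis unfolding T_def by (simp only: integral_complex_of_real)
    qed
    have avg_test: "test_form p p (form_average r \<eta>)" using \<eta>(1) by (rule test_form_average)
    have avg_pos: "positive_covector p (form_average r \<eta> z)" for z
      using \<eta>(2) by (intro positive_covector_average) blast
    have "\<i> * del_delbar_current \<Phi> (form_average r \<eta>) - complex_of_real \<epsilon> * complex_of_real T \<in> \<real>\<^sub>\<ge>\<^sub>0"
      using assms(3) avg_test avg_pos unfolding positive_current_def p_def[symmetric] \<Phi>_def[symmetric] kaehler[symmetric] by blast
    then obtain x where x: "x \<ge> 0" "\<i> * del_delbar_current \<Phi> (form_average r \<eta>) - complex_of_real \<epsilon> * complex_of_real T = complex_of_real x"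
      by (rule nonneg_Reals_cases)
    have dd: "\<i> * del_delbar_current (ball_average r \<Phi>) \<eta> = complex_of_real (x + \<epsilon> * T)"
      unfolding \<Phi>_def del_delbar_current_average[OF psh_loc_integrable[OF assms(1)] s]
      using x(2) unfolding \<Phi>_def by (simp add: algebra_simps)
    obtain u where u: "0 \<le> u" "Upsilon r W \<eta> = complex_of_real u"
      "u \<le> (2 ^ CARD('n)) ^ p * real (CARD('n) ^ p) * (C * r ^ d / measure lborel (ball (0 :: complex ^ 'n) r)) * T"
      using Upsilon_le_trace[OF W C(1) C(2)[unfolded d_def] \<eta>(1)[unfolded p_def] _ r0] \<eta>(2)
      unfolding T_def p_def d_def by blast
    have "C * r ^ d / measure lborel (ball (0 :: complex ^ 'n) r) = C / unit_ball_vol (real (2 * CARD('n))) / r\<^sup>2"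
    proof -
      have "measure lborel (ball (0 :: complex ^ 'n) r) = unit_ball_vol (real (2 * CARD('n))) * (r\<^sup>2 * r ^ d)"
      proof -
        have dim: "DIM(complex ^ 'n) = 2 * CARD('n)" by simp
        have "2 * CARD('n) = Suc (Suc d)" unfolding d_def by (rule Suc_Suc_frame[symmetric])
        then have "r ^ (2 * CARD('n)) = r\<^sup>2 * r ^ d" by (simp only: power_Suc power2_eq_square mult.assoc)
        then show ?thesis using content_ball[of r "0 :: complex ^ 'n"] r0 unfolding dim by simp
      qed
      then show ?thesis using r0 by simp
    qed
    then have "u \<le> K / r\<^sup>2 * T" using u(3) by (simp add: K_def mult_ac)
    then have "c * u \<le> c * (K / r\<^sup>2 * T)" using c by (rule mult_left_mono)
    also have "\<dots> = c * K / r\<^sup>2 * T" by simp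
    also have "\<dots> \<le> \<epsilon> / (2 * pi) * T"
    proof (rule mult_right_mono[OF _ T0])
      have "c * K * (2 * pi) \<le> r * \<epsilon>" using r(2) assms(2) by (simp add: divide_le_eq)
      also have "\<dots> \<le> r\<^sup>2 * \<epsilon>" using r(1) assms(2) by (intro mult_right_mono) (auto simp: power2_eq_square)
      finally show "c * K / r\<^sup>2 \<le> \<epsilon> / (2 * pi)" using r0 by (simp add: divide_simps mult_ac)
    qed
    also have "\<dots> \<le> (x + \<epsilon> * T) / (2 * pi)" using x(1) by (simp add: divide_simps)
    finally have le: "0 \<le> (x + \<epsilon> * T) / (2 * pi) - c * u" by simp
    have "\<i> / complex_of_real (2 * pi) * del_delbar_current (ball_average r \<Phi>) \<eta> - complex_of_real c * Upsilon r W \<eta>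
        = complex_of_real ((x + \<epsilon> * T) / (2 * pi) - c * u)"
      using dd u(2) by (simp add: field_simps)
    then show "\<i> / complex_of_real (2 * pi) * del_delbar_current (ball_average r \<Phi>) \<eta> - complex_of_real c * Upsilon r W \<eta> \<in> \<real>\<^sub>\<ge>\<^sub>0"
      using le by (simp only: nonneg_Reals_of_real_iff)
  qed
  then have "eventually (\<lambda>r. positive_current (\<lambda>\<eta>. \<i> / complex_of_real (2 * pi) * del_delbar_current (ball_average r \<Phi>) \<eta>
        - complex_of_real c * Upsilon r W \<eta>)) at_top" if "0 \<le> c" for c
    using that unfolding eventually_at_top_linorder
    by (intro exI[of _ "max 1 (c * K * (2 * pi) / \<epsilon>)"]) auto
  then have mem: "upper_density \<phi> W \<le> \<alpha>" if "0 < \<alpha>" for \<alpha>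
    unfolding upper_density_def \<Phi>_def using that by (intro Inf_lower) simp
  show ?thesis
  proof (rule ccontr)
    assume "upper_density \<phi> W \<noteq> 0"
    then obtain \<alpha> where "0 < \<alpha>" "\<alpha> < upper_density \<phi> W" using dense[of 0 "upper_density \<phi> W"] by (auto simp: zero_less_iff_neq_zero)
    then show False using mem[of \<alpha>] by simp
  qed
qed

end
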